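(* Let $k$ be a field of characteristic zero, let $I\subsetneq k[x_1,\dots,x_n]$ be a square-free monomial ideal containing none of the variables $x_1,\dots,x_n$, and let $X$ be the Stanley--Reisner complex of $I$. Then \[ \operatorname{reg}(I)\le \deg(k[X]) - \operatorname{codim}(k[X]) + 1 + \alpha(X) + \gamma(X). \]
   Context: The Stanley--Reisner complex of a square-free monomial ideal $I\subset S=k[x_1,\dots,x_n]$ is the simplicial complex $X=\{F\subseteq\{1,\dots,n\}: \prod_{i\in F}x_i\notin I\}$, and $k[X]=S/I$. Facets are the inclusion-maximal faces; $\dim F=|F|-1$ and $\dim X=\max_{F\in X}\dim F$. $V(X)$ is the vertex set of $X$, here $\{1,\dots,n\}$. $\operatorname{reg}(I)=\max\{j:\beta_{i,i+j}(I)\ne0\text{ for some }i\}$ is the Castelnuovo--Mumford regularity, where $\beta_{i,i+j}(I)=\dim_k\operatorname{Tor}_i^S(I,k)_{i+j}$. (If $I=0$, the inequality may be read with $\operatorname{reg}(I)=1$, i.e. $\operatorname{reg}(I)$ is the Leray number of $X$ plus one.) $\deg(k[X])$ is the degree (multiplicity) of $S/I$, which equals the number of facets of $X$ of dimension $\dim X$; $\operatorname{codim}(k[X])=n-\dim X-1$. $\alpha(X)$ is the number of facets of $X$ whose dimension is strictly less than $\dim X$. For a linear order $\prec:\sigma_1\prec\cdots\prec\sigma_m$ of all the facets of $X$, set $\operatorname{conn}_\prec\sigma_j=\max\{|\sigma_i\cap\sigma_j|: i<j\}$ for $j=2,\dots,m$, and $\gamma_\prec(X)=\sum_{j=2}^m(\dim\sigma_j-\operatorname{conn}_\prec\sigma_j)$.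 Then $\gamma(X)=\min_\prec\gamma_\prec(X)$ over all linear orders $\prec$ of the facets of $X$. *)

theory Defs
  imports Complex_Main "HOL-Library.Function_Algebras" "HOL-Library.Poly_Mapping" "HOL-Computational_Algebra.Polynomial"
begin

section \<open>The polynomial ring\<close>

text \<open>The ring \<open>S = k[x\<^sub>1,\<dots>,x\<^sub>n]\<close> is the whole type \<open>('n, 'k) mpoly\<close>; the variables are
  indexed by the finite type \<open>'n\<close>, so \<open>n = card (UNIV :: 'n set)\<close>.\<close>

type_synonym ('n, 'k) mpoly = "('n \<Rightarrow>\<^sub>0 nat) \<Rightarrow>\<^sub>0 'k"

definition pvar :: "'n \<Rightarrow> ('n, 'k::comm_ring_1) mpoly"
  where "pvar i = Poly_Mapping.single (Poly_Mapping.single i 1) 1"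

definition mono_degree :: "('n \<Rightarrow>\<^sub>0 nat) \<Rightarrow> nat"
  where "mono_degree m = (\<Sum>i\<in>Poly_Mapping.keys m. Poly_Mapping.lookup m i)"

text \<open>Degrees are integers, as graded modules are \<open>\<int>\<close>-graded; the zero polynomial is
  homogeneous of every degree.\<close>

definition homogeneous :: "('n, 'k::zero) mpoly \<Rightarrow> int \<Rightarrow> bool"
  where "homogeneous p d \<longleftrightarrow> (\<forall>m\<in>Poly_Mapping.keys p. int (mono_degree m) = d)"

definition poly_scale :: "'k \<Rightarrow> ('n, 'k::comm_ring_1) mpoly \<Rightarrow> ('n, 'k) mpoly"
  where "poly_scale c p = Poly_Mapping.single 0 c * p"

lemma vector_space_poly_scale:
  "vector_space (poly_scale :: 'k::field \<Rightarrow> ('n, 'k) mpoly \<Rightarrow> ('n, 'k) mpoly)"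
  by unfold_locales
    (simp_all add: poly_scale_def distrib_left distrib_right single_add mult_single
      flip: mult.assoc)

lemma module_times: "module ((*) :: ('n, 'k::comm_ring_1) mpoly \<Rightarrow> _)"
  by unfold_locales (simp_all add: algebra_simps)

text \<open>Ideals are the submodules of \<open>S\<close> over itself, hence \<open>module.span (*) B\<close> is the ideal
  generated by \<open>B\<close>.\<close>

definition squarefree_monomial_ideal :: "('n, 'k::comm_ring_1) mpoly set \<Rightarrow> bool"
  where "squarefree_monomial_ideal I \<longleftrightarrow>
    (\<exists>G :: 'n set set. I = module.span (*) ((\<lambda>A. \<Prod>i\<in>A. pvar i) ` G))"


section \<open>Graded free resolutions, Tor and regularity\<close>

text \<open>A complex \<open>\<dots> \<rightarrow> F\<^sub>1 \<rightarrow> F\<^sub>0 \<rightarrow> S\<close> of finitely generated graded free modules, where \<open>F\<^sub>i\<close> has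
  the basis \<open>e\<^sub>b\<close> for \<open>b < rnk F i\<close> with \<open>e\<^sub>b\<close> in degree \<open>shift F i b\<close>.  The augmentation sends
  the \<open>b\<close>-th basis element of \<open>F\<^sub>0\<close> to \<open>aug F b\<close>, and the differential \<open>F\<^sub>i\<^sub>+\<^sub>1 \<rightarrow> F\<^sub>i\<close> sends the
  \<open>b\<close>-th basis element to the vector \<open>diff F i b\<close>.  Entries lie in \<open>'s\<close>.\<close>

record 's free_complex =
  rnk :: "nat \<Rightarrow> nat"
  shift :: "nat \<Rightarrow> nat \<Rightarrow> int"
  aug :: "nat \<Rightarrow> 's"
  diff :: "nat \<Rightarrow> nat \<Rightarrow> nat \<Rightarrow> 's"

definition free_mod :: "nat \<Rightarrow> (nat \<Rightarrow> ('n, 'k::comm_ring_1) mpoly) set"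
  where "free_mod r = {v. \<forall>b. b \<ge> r \<longrightarrow> v b = 0}"

definition aug_map ::
  "('n, 'k::comm_ring_1) mpoly free_complex \<Rightarrow> (nat \<Rightarrow> ('n, 'k) mpoly) \<Rightarrow> ('n, 'k) mpoly"
  where "aug_map F v = (\<Sum>b<rnk F 0. v b * aug F b)"

definition diff_map ::
  "('n, 'k::comm_ring_1) mpoly free_complex \<Rightarrow> nat \<Rightarrow> (nat \<Rightarrow> ('n, 'k) mpoly)
    \<Rightarrow> (nat \<Rightarrow> ('n, 'k) mpoly)"
  where "diff_map F i v = (\<lambda>c. \<Sum>b<rnk F (Suc i). v b * diff F i b c)"

definition graded_free_resolution ::
  "('n, 'k::comm_ring_1) mpoly free_complex \<Rightarrow> ('n, 'k) mpoly set \<Rightarrow> bool"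
  where "graded_free_resolution F I \<longleftrightarrow>
    (\<forall>b<rnk F 0. homogeneous (aug F b) (shift F 0 b)) \<and>
    (\<forall>i. \<forall>b<rnk F (Suc i). diff F i b \<in> free_mod (rnk F i) \<and>
       (\<forall>c<rnk F i. homogeneous (diff F i b c) (shift F (Suc i) b - shift F i c))) \<and>
    aug_map F ` free_mod (rnk F 0) = I \<and>
    {v \<in> free_mod (rnk F 0). aug_map F v = 0} = diff_map F 0 ` free_mod (rnk F 1) \<and>
    (\<forall>i. {v \<in> free_mod (rnk F (Suc i)). diff_map F i v = (\<lambda>_. 0)}
         = diff_map F (Suc i) ` free_mod (rnk F (Suc (Suc i))))"

text \<open>The complex \<open>F \<otimes>\<^sub>S k\<close> with \<open>k = S/(x\<^sub>1,\<dots>,x\<^sub>n)\<close>.  The degree-\<open>d\<close> part of \<open>F\<^sub>i \<otimes>\<^sub>S k\<close> is the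
  \<open>k\<close>-vector space on the basis elements of degree \<open>d\<close>, and the matrix of the differential is
  reduced modulo \<open>(x\<^sub>1,\<dots>,x\<^sub>n)\<close>, i.e. every entry is replaced by its constant coefficient.\<close>

definition tens_mod :: "('n, 'k::field) mpoly free_complex \<Rightarrow> nat \<Rightarrow> int \<Rightarrow> (nat \<Rightarrow> 'k) set"
  where "tens_mod F i d = {v. \<forall>b. v b \<noteq> 0 \<longrightarrow> b < rnk F i \<and> shift F i b = d}"

definition tens_diff :: "('n, 'k::field) mpoly free_complex \<Rightarrow> nat \<Rightarrow> (nat \<Rightarrow> 'k) \<Rightarrow> (nat \<Rightarrow> 'k)"
  where "tens_diff F i v =
    (\<lambda>c. \<Sum>b<rnk F (Suc i). v b * Poly_Mapping.lookup (diff F i b c) 0)"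

fun tens_cycles :: "('n, 'k::field) mpoly free_complex \<Rightarrow> nat \<Rightarrow> int \<Rightarrow> (nat \<Rightarrow> 'k) set"
  where
    "tens_cycles F 0 d = tens_mod F 0 d"
  | "tens_cycles F (Suc i) d = {v \<in> tens_mod F (Suc i) d. tens_diff F i v = (\<lambda>_. 0)}"

definition tens_boundaries :: "('n, 'k::field) mpoly free_complex \<Rightarrow> nat \<Rightarrow> int \<Rightarrow> (nat \<Rightarrow> 'k) set"
  where "tens_boundaries F i d = tens_diff F i ` tens_mod F (Suc i) d"

definition vec_scale :: "'k \<Rightarrow> (nat \<Rightarrow> 'k) \<Rightarrow> (nat \<Rightarrow> 'k::field)"
  where "vec_scale c v = (\<lambda>b. c * v b)"

lemma vector_space_vec_scale: "vector_space vec_scale"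
  by unfold_locales (simp_all add: vec_scale_def fun_eq_iff algebra_simps)

text \<open>Cycles and boundaries are finite-dimensional, so the dimension of the homology is the
  difference of their dimensions.\<close>

definition tens_homology_dim :: "('n, 'k::field) mpoly free_complex \<Rightarrow> nat \<Rightarrow> int \<Rightarrow> nat"
  where "tens_homology_dim F i d =
    vector_space.dim vec_scale (tens_cycles F i d) -
    vector_space.dim vec_scale (tens_boundaries F i d)"

text \<open>\<open>betti I i d\<close> is the dimension of \<open>Tor\<^sub>i\<^sup>S(I,k)\<^sub>d\<close>, for a homogeneous ideal \<open>I\<close>; Tor does
  not depend on the chosen resolution, and one by finitely generated free modules exists since
  \<open>S\<close> is Noetherian.\<close>

definition betti :: "('n, 'k::field) mpoly set \<Rightarrow> nat \<Rightarrow> int \<Rightarrow> nat"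
  where "betti I i d = tens_homology_dim (SOME F. graded_free_resolution F I) i d"

text \<open>By convention the zero ideal, all of whose Betti numbers vanish, has regularity \<open>1\<close>.\<close>

definition regularity :: "('n, 'k::field) mpoly set \<Rightarrow> int"
  where "regularity I =
    (if I = {0} then 1 else Max {j. \<exists>i. betti I i (int i + j) \<noteq> 0})"


section \<open>Multiplicity\<close>

definition homogeneous_part :: "('n, 'k::zero) mpoly set \<Rightarrow> nat \<Rightarrow> ('n, 'k) mpoly set"
  where "homogeneous_part I t = {p \<in> I. homogeneous p (int t)}"

text \<open>The Hilbert function of \<open>S/I\<close> for a homogeneous ideal \<open>I\<close>, and its Hilbert polynomial.\<close>

definition hilbert_fun :: "('n::finite, 'k::field) mpoly set \<Rightarrow> nat \<Rightarrow> nat"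
  where "hilbert_fun I t =
    vector_space.dim poly_scale (homogeneous_part (UNIV :: ('n, 'k) mpoly set) t) -
    vector_space.dim poly_scale (homogeneous_part I t)"

definition hilbert_poly :: "('n::finite, 'k::field) mpoly set \<Rightarrow> real poly"
  where "hilbert_poly I =
    (THE P. eventually (\<lambda>t. poly P (real t) = real (hilbert_fun I t)) sequentially)"

text \<open>The degree of the Hilbert polynomial is \<open>dim (S/I) - 1\<close>.  If the Hilbert polynomial
  is zero, then \<open>S/I\<close> has
  finite length and the multiplicity is that length.\<close>

definition multiplicity_quot :: "('n::finite, 'k::field) mpoly set \<Rightarrow> real"
  where "multiplicity_quot I =
    (if hilbert_poly I = 0 then (\<Sum>t | hilbert_fun I t \<noteq> 0. real (hilbert_fun I t))
     else fact (degree (hilbert_poly I)) * lead_coeff (hilbert_poly I))"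


section \<open>Simplicial complexes\<close>

definition stanley_reisner :: "('n, 'k::comm_ring_1) mpoly set \<Rightarrow> 'n set set"
  where "stanley_reisner I = {F. (\<Prod>i\<in>F. pvar i) \<notin> I}"

definition facets :: "'a set set \<Rightarrow> 'a set set"
  where "facets X = {F \<in> X. \<forall>G\<in>X. F \<subseteq> G \<longrightarrow> G = F}"

definition face_dim :: "'a set \<Rightarrow> int"
  where "face_dim F = int (card F) - 1"

definition complex_dim :: "'a set set \<Rightarrow> int"
  where "complex_dim X = Max (face_dim ` X)"

text \<open>The codimension of \<open>k[X]\<close> for a complex \<open>X\<close> on the vertex set \<open>UNIV :: 'n set\<close>.\<close>

definition codim :: "'n::finite set set \<Rightarrow> int"
  where "codim X = int (card (UNIV :: 'n set)) - complex_dim X - 1"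

definition alpha :: "'a set set \<Rightarrow> nat"
  where "alpha X = card {F \<in> facets X. face_dim F < complex_dim X}"

text \<open>Linear orders of the facets are given as lists enumerating them without repetition;
  list positions start at \<open>0\<close>.\<close>

definition facet_orders :: "'a set set \<Rightarrow> 'a set list set"
  where "facet_orders X = {\<sigma>s. distinct \<sigma>s \<and> set \<sigma>s = facets X}"

definition conn :: "'a set list \<Rightarrow> nat \<Rightarrow> nat"
  where "conn \<sigma>s j = Max ((\<lambda>i. card (\<sigma>s ! i \<inter> \<sigma>s ! j)) ` {..<j})"

definition gamma_order :: "'a set list \<Rightarrow> int"
  where "gamma_order \<sigma>s = (\<Sum>j\<in>{1..<length \<sigma>s}. face_dim (\<sigma>s ! j) - int (conn \<sigma>s j))"

definition gamma :: "'a set set \<Rightarrow> int"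
  where "gamma X = Min (gamma_order ` facet_orders X)"

end

theory Submission
  imports Defs "HOL-Library.Countable"
begin

text \<open>Write \<open>\<sigma>\<^sub>1,\<dots>,\<sigma>\<^sub>m\<close> for an order of the facets attaining \<open>\<gamma>(X)\<close> and put
  \<open>\<delta>\<^sub>j = |\<sigma>\<^sub>j \<inter> (\<sigma>\<^sub>1 \<union> \<dots> \<union> \<sigma>\<^sub>j\<^sub>-\<^sub>1)| - conn \<sigma>\<^sub>j \<ge> 0\<close>.  Counting how many new vertices each facet
  contributes, the right-hand side equals \<open>2 + (dim X + 1 - |\<sigma>\<^sub>1|) + \<Sum>\<delta>\<^sub>j\<close>.  If \<open>X\<^sub>j\<close> is generated by
  the first \<open>j\<close> facets, then \<open>X\<^sub>j = X\<^sub>j\<^sub>-\<^sub>1 \<union> \<sigma>\<^sub>j\<close>, and \<open>X\<^sub>j\<^sub>-\<^sub>1 \<inter> \<sigma>\<^sub>j\<close> is the subcomplex of \<open>X\<^sub>j\<^sub>-\<^sub>1\<close>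
  induced on \<open>\<sigma>\<^sub>j\<close>, so its regularity is at most that of \<open>X\<^sub>j\<^sub>-\<^sub>1\<close>; it is a simplex if \<open>\<delta>\<^sub>j = 0\<close>.
  By the Mayer--Vietoris sequence the regularity grows by at most one at each step with
  \<open>\<delta>\<^sub>j > 0\<close>, and does not grow beyond \<open>2\<close> at the others, whence \<open>reg I \<le> 2 + \<Sum>\<delta>\<^sub>j\<close>.

  All homology is that of the Koszul complex with coefficients in monomial ideals; dimension
  shifting along an arbitrary graded free resolution transfers its vanishing to Tor.  The same
  vanishing bounds the degrees of the generators of every syzygy module, so that a resolution
  exists without an appeal to Hilbert's basis theorem.\<close>

section \<open>Monomials, derivatives and monomial ideals\<close>

text \<open>The induction runs on ideals: a bound for an intersection follows from bounds for both
  ideals and a bound, smaller by one, for their sum. The ideal of a simplex is generated by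
  variables and has bound 1, so attaching a facet along a simplex requires only a bound of at least
  2; this is the origin of the starting value 2. Restricting to an induced subcomplex adds variables
  to the ideal, and the fine grading of the Koszul complex shows that this preserves any bound that
  is at least 1. Two features of the definitions shape the rest. \<open>betti\<close> uses a
  resolution picked by \<open>SOME\<close>: it need not be minimal, and nothing is known about it
  until some resolution is shown to exist. \<open>regularity\<close> is a \<open>Max\<close>,
  informative only for a finite nonempty set; hence vanishing in negative degrees and one nonzero
  Betti number are needed besides the vanishing above the bound. Characteristic zero permits
  division by the total degree in the contracting homotopy of the Koszul complex.\<close>

lemma lookup_single_times_add:
  fixes k :: "'a::cancel_comm_monoid_add" and p :: "'a \<Rightarrow>\<^sub>0 'k::comm_ring_1"
  shows "Poly_Mapping.lookup (Poly_Mapping.single k c * p) (k + q) = c * Poly_Mapping.lookup p q"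
proof -
  have "Poly_Mapping.lookup (Poly_Mapping.single k c * p) (k + q)
    = (\<Sum>l. (c * (\<Sum>q'. Poly_Mapping.lookup p q' when k + q = k + q')) when l = k)"
    unfolding lookup_mult by (rule Sum_any.cong) (auto simp: lookup_single when_def)
  also have "\<dots> = c * (\<Sum>q'. Poly_Mapping.lookup p q' when q' = q)"
    by (simp add: eq_commute)
  finally show ?thesis by simp
qed

lemma lookup_single_times_not_ge:
  fixes k :: "'a::cancel_comm_monoid_add" and p :: "'a \<Rightarrow>\<^sub>0 'k::comm_ring_1"
  assumes "\<And>q. m \<noteq> k + q"
  shows "Poly_Mapping.lookup (Poly_Mapping.single k c * p) m = 0"
proof -
  have "m \<notin> Poly_Mapping.keys (Poly_Mapping.single k c * p)"
    using keys_mult[of "Poly_Mapping.single k c" p] assms by (auto split: if_splits)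
  then show ?thesis by (simp add: in_keys_iff)
qed

abbreviation evar :: "'n \<Rightarrow> ('n \<Rightarrow>\<^sub>0 nat)" where "evar i \<equiv> Poly_Mapping.single i (Suc 0)"

lemma lookup_pvar_times:
  "Poly_Mapping.lookup (pvar i * p) m =
    (if Poly_Mapping.lookup m i = 0 then 0 else Poly_Mapping.lookup p (m - evar i))"
proof (cases "Poly_Mapping.lookup m i = 0")
  case True
  have "m \<noteq> evar i + q" for q
    using True by (auto simp: lookup_add)
  then show ?thesis using True unfolding pvar_def by (simp add: lookup_single_times_not_ge)
next
  case False
  have eq: "m = evar i + (m - evar i)"
    using False by (intro poly_mapping_eqI) (auto simp: lookup_add lookup_minus lookup_single when_def)
  show ?thesis using False lookup_single_times_add[of "evar i" 1 p "m - evar i"]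
    unfolding pvar_def by (simp flip: eq)
qed

lemma lookup_pvar_times_add [simp]:
  "Poly_Mapping.lookup (pvar i * p) (m + evar i) = Poly_Mapping.lookup p m"
  by (simp add: lookup_pvar_times lookup_add)

lemma lookup_times_0:
  fixes p q :: "('n, 'k::comm_ring_1) mpoly"
  shows "Poly_Mapping.lookup (p * q) 0 = Poly_Mapping.lookup p 0 * Poly_Mapping.lookup q 0"
proof -
  define p' where "p' = p - Poly_Mapping.single 0 (Poly_Mapping.lookup p 0)"
  have "0 \<notin> Poly_Mapping.keys p'"
    by (simp add: p'_def in_keys_iff lookup_minus)
  moreover have "a + b = 0 \<longleftrightarrow> a = 0 \<and> b = 0" for a b :: "'n \<Rightarrow>\<^sub>0 nat"
    by (auto simp: poly_mapping_eq_iff lookup_add fun_eq_iff)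
  ultimately have "0 \<notin> Poly_Mapping.keys (p' * q)"
    using keys_mult[of p' q] by force
  moreover have "p * q = p' * q + Poly_Mapping.single 0 (Poly_Mapping.lookup p 0) * q"
    by (simp add: p'_def algebra_simps)
  moreover have "Poly_Mapping.lookup (Poly_Mapping.single 0 (Poly_Mapping.lookup p 0) * q) 0
      = Poly_Mapping.lookup p 0 * Poly_Mapping.lookup q 0"
    using lookup_single_times_add[of 0 _ q 0] by simp
  ultimately show ?thesis by (simp add: lookup_add in_keys_iff)
qed

section \<open>Selection of monomials, division by a variable, partial derivatives\<close>

definition pfilter :: "('a \<Rightarrow> bool) \<Rightarrow> ('a \<Rightarrow>\<^sub>0 'k::zero) \<Rightarrow> ('a \<Rightarrow>\<^sub>0 'k)"
  where "pfilter P = Poly_Mapping.mapp (\<lambda>m c. if P m then c else 0)"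

lemma lookup_pfilter: "Poly_Mapping.lookup (pfilter P p) m = (if P m then Poly_Mapping.lookup p m else 0)"
  by (auto simp: pfilter_def lookup_mapp in_keys_iff when_def)

lemma keys_pfilter: "Poly_Mapping.keys (pfilter P p) = {m \<in> Poly_Mapping.keys p. P m}"
  by (auto simp: in_keys_iff lookup_pfilter split: if_splits)

lemma pfilter_0 [simp]: "pfilter P 0 = 0"
  by (simp add: poly_mapping_eq_iff fun_eq_iff lookup_pfilter)

lemma pfilter_add: "pfilter P (p + q) = pfilter P p + pfilter P q"
  by (simp add: poly_mapping_eq_iff fun_eq_iff lookup_pfilter lookup_add)

lemma pfilter_sum: "pfilter P (\<Sum>i\<in>A. f i) = (\<Sum>i\<in>A. pfilter P (f i))"
  by (induction A rule: infinite_finite_induct) (simp_all add: pfilter_add)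

lemma pfilter_uminus: "pfilter P (- p) = - pfilter P (p :: 'a \<Rightarrow>\<^sub>0 'k::ab_group_add)"
  by (simp add: poly_mapping_eq_iff fun_eq_iff lookup_pfilter)

lemma pfilter_id: "(\<And>m. m \<in> Poly_Mapping.keys p \<Longrightarrow> P m) \<Longrightarrow> pfilter P p = p"
  by (auto simp: poly_mapping_eq_iff fun_eq_iff lookup_pfilter in_keys_iff)

lemma pfilter_disjoint: "(\<And>m. m \<in> Poly_Mapping.keys p \<Longrightarrow> \<not> P m) \<Longrightarrow> pfilter P p = 0"
  by (auto simp: poly_mapping_eq_iff fun_eq_iff lookup_pfilter in_keys_iff)

lemma pfilter_compl: "pfilter P p + pfilter (\<lambda>m. \<not> P m) p = (p :: 'a \<Rightarrow>\<^sub>0 'k::comm_monoid_add)"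
  by (simp add: poly_mapping_eq_iff fun_eq_iff lookup_pfilter lookup_add)

definition pdiv :: "'n \<Rightarrow> ('n, 'k::zero) mpoly \<Rightarrow> ('n, 'k) mpoly"
  where "pdiv i = Poly_Mapping.map_key (\<lambda>m. m + evar i)"

lemma lookup_pdiv: "Poly_Mapping.lookup (pdiv i p) m = Poly_Mapping.lookup p (m + evar i)"
  by (simp add: pdiv_def map_key.rep_eq)

lemma pdiv_pvar_times [simp]: "pdiv i (pvar i * p) = p"
  by (simp add: poly_mapping_eq_iff fun_eq_iff lookup_pdiv)

lemma pvar_times_cancel: "pvar i * p = pvar i * q \<Longrightarrow> p = q"
  by (metis pdiv_pvar_times)

lemma pfilter_plus_pdiv:
  "pfilter (\<lambda>m. Poly_Mapping.lookup m i = 0) p + pvar i * pdiv i p = p"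
proof (intro poly_mapping_eqI)
  fix m
  have "Poly_Mapping.lookup m i \<noteq> 0 \<Longrightarrow> m - evar i + evar i = m"
    by (intro poly_mapping_eqI) (auto simp: lookup_add lookup_minus lookup_single when_def)
  then show "Poly_Mapping.lookup (pfilter (\<lambda>m. Poly_Mapping.lookup m i = 0) p + pvar i * pdiv i p) m
      = Poly_Mapping.lookup p m"
    by (simp add: lookup_add lookup_pfilter lookup_pvar_times lookup_pdiv)
qed

lemma pfilter_pvar_times_self: "pfilter (\<lambda>m. Poly_Mapping.lookup m i = 0) (pvar i * p) = 0"
  by (simp add: poly_mapping_eq_iff fun_eq_iff lookup_pfilter lookup_pvar_times)

lemma pfilter_pvar_times_other:
  "i \<noteq> l \<Longrightarrow> pfilter (\<lambda>m. Poly_Mapping.lookup m i = 0) (pvar l * p)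
    = pvar l * pfilter (\<lambda>m. Poly_Mapping.lookup m i = 0) p"
  by (simp add: poly_mapping_eq_iff fun_eq_iff lookup_pfilter lookup_pvar_times lookup_minus lookup_single)

text \<open>The formal partial derivative: the coefficient at \<open>m\<close> comes from that of
  \<open>m + evar i\<close>, whose exponent at \<open>i\<close> is one larger.\<close>

definition pderv :: "'n \<Rightarrow> ('n, 'k::comm_ring_1) mpoly \<Rightarrow> ('n, 'k) mpoly"
  where "pderv i p = Poly_Mapping.mapp (\<lambda>m c. of_nat (Suc (Poly_Mapping.lookup m i)) * c) (pdiv i p)"

lemma lookup_pderv: "Poly_Mapping.lookup (pderv i p) m
    = of_nat (Suc (Poly_Mapping.lookup m i)) * Poly_Mapping.lookup p (m + evar i)"
  by (auto simp: pderv_def lookup_mapp lookup_pdiv in_keys_iff when_def)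

lemma pderv_add: "pderv i (p + q) = pderv i p + pderv i q"
  by (simp add: poly_mapping_eq_iff fun_eq_iff lookup_pderv lookup_add algebra_simps)

lemma pderv_0 [simp]: "pderv i 0 = 0"
  by (simp add: poly_mapping_eq_iff fun_eq_iff lookup_pderv)

lemma pderv_sum: "pderv i (\<Sum>a\<in>A. f a) = (\<Sum>a\<in>A. pderv i (f a))"
  by (induction A rule: infinite_finite_induct) (simp_all add: pderv_add)

lemma pderv_uminus: "pderv i (- p) = - pderv i p"
  by (simp add: poly_mapping_eq_iff fun_eq_iff lookup_pderv)

lemma pderv_pvar_times: "pderv l (pvar i * p) = (if i = l then p else 0) + pvar i * pderv l p"
proof (intro poly_mapping_eqI)
  fix m
  have 1: "m - evar i + evar i = m" if "Poly_Mapping.lookup m i \<noteq> 0"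
    using that by (intro poly_mapping_eqI) (auto simp: lookup_add lookup_minus lookup_single when_def)
  have 2: "m + evar l - evar i = m - evar i + evar l" if "i \<noteq> l" 
    using that by (intro poly_mapping_eqI) (auto simp: lookup_add lookup_minus lookup_single when_def)
  show "Poly_Mapping.lookup (pderv l (pvar i * p)) m
      = Poly_Mapping.lookup ((if i = l then p else 0) + pvar i * pderv l p) m"
  proof (cases "i = l")
    case True
    show ?thesis
    proof (cases "Poly_Mapping.lookup m i")
      case 0
      then show ?thesis using True
        by (simp add: lookup_pderv lookup_add lookup_pvar_times[of _ "pderv _ _"])
    next
      case (Suc a)
      then show ?thesis using True 1
        by (simp add: lookup_pderv lookup_add lookup_pvar_times[of _ "pderv _ _"] lookup_minus ring_distribs)
    qed
  next
    case False
    then show ?thesis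
      by (simp add: lookup_pderv lookup_pvar_times 2 lookup_add lookup_minus lookup_single)
  qed
qed

section \<open>Degrees and homogeneous polynomials\<close>

lemma mono_degree_eq: "mono_degree (m :: 'n::finite \<Rightarrow>\<^sub>0 nat) = (\<Sum>i\<in>UNIV. Poly_Mapping.lookup m i)"
  unfolding mono_degree_def by (rule sum.mono_neutral_left) (auto simp: in_keys_iff)

lemma mono_degree_add: "mono_degree (m + m') = mono_degree m + mono_degree (m' :: 'n::finite \<Rightarrow>\<^sub>0 nat)"
  by (simp add: mono_degree_eq lookup_add sum.distrib)

lemma mono_degree_single [simp]: "mono_degree (Poly_Mapping.single i d) = d"
  by (simp add: mono_degree_def)

lemma mono_degree_0 [simp]: "mono_degree 0 = 0"
  by (simp add: mono_degree_def)

lemma mono_degree_eq_0_iff: "mono_degree (m :: 'n::finite \<Rightarrow>\<^sub>0 nat) = 0 \<longleftrightarrow> m = 0"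
  by (simp add: mono_degree_eq poly_mapping_eq_iff fun_eq_iff)

lemma pderv_euler:
  fixes p :: "('n::finite, 'k::comm_ring_1) mpoly"
  assumes "homogeneous p d"
  shows "(\<Sum>i\<in>UNIV. pvar i * pderv i p) = Poly_Mapping.single 0 (of_int d) * p"
proof (intro poly_mapping_eqI)
  fix m :: "'n \<Rightarrow>\<^sub>0 nat"
  have "m - evar i + evar i = m" if "Poly_Mapping.lookup m i \<noteq> 0" for i
    using that by (intro poly_mapping_eqI) (auto simp: lookup_add lookup_minus lookup_single when_def)
  then have "Poly_Mapping.lookup (pvar i * pderv i p) m = of_nat (Poly_Mapping.lookup m i) * Poly_Mapping.lookup p m" for i
    by (auto simp: lookup_pvar_times lookup_pderv lookup_minus simp flip: of_nat_Suc)
  then have "Poly_Mapping.lookup (\<Sum>i\<in>UNIV. pvar i * pderv i p) m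
      = of_nat (mono_degree m) * Poly_Mapping.lookup p m"
    by (simp add: lookup_sum mono_degree_eq sum_distrib_right)
  also have "\<dots> = of_int d * Poly_Mapping.lookup p m"
    using assms by (cases "m \<in> Poly_Mapping.keys p") (auto simp: homogeneous_def in_keys_iff)
  also have "\<dots> = Poly_Mapping.lookup (Poly_Mapping.single 0 (of_int d) * p) m"
    using lookup_single_times_add[of 0 "of_int d" p m] by simp
  finally show "Poly_Mapping.lookup (\<Sum>i\<in>UNIV. pvar i * pderv i p) m
      = Poly_Mapping.lookup (Poly_Mapping.single 0 (of_int d) * p) m" .
qed

lemma homogeneous_0 [simp]: "homogeneous 0 d"
  by (simp add: homogeneous_def)

lemma homogeneous_add: "homogeneous p d \<Longrightarrow> homogeneous q d \<Longrightarrow> homogeneous (p + q) d"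
  unfolding homogeneous_def using keys_add[of p q] by blast

lemma homogeneous_uminus: "homogeneous p d \<Longrightarrow> homogeneous (- p :: ('n, 'k::ab_group_add) mpoly) d"
  by (auto simp: homogeneous_def in_keys_iff)

lemma homogeneous_diff: "homogeneous p d \<Longrightarrow> homogeneous q d \<Longrightarrow> homogeneous (p - q :: ('n, 'k::ab_group_add) mpoly) d"
  using homogeneous_add[of p d "- q"] by (simp add: homogeneous_uminus)

lemma homogeneous_sum: "(\<And>i. i \<in> A \<Longrightarrow> homogeneous (f i) d) \<Longrightarrow> homogeneous (\<Sum>i\<in>A. f i) d"
  by (induction A rule: infinite_finite_induct) (auto intro: homogeneous_add)

lemma homogeneous_mult:
  "homogeneous p a \<Longrightarrow> homogeneous q b \<Longrightarrow> homogeneous (p * q :: ('n::finite, 'k::comm_ring_1) mpoly) (a + b)"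
  unfolding homogeneous_def using keys_mult[of p q] by (fastforce simp: mono_degree_add)

lemma homogeneous_single: "homogeneous (Poly_Mapping.single m c) (int (mono_degree m))"
  by (simp add: homogeneous_def)

lemma homogeneous_const: "homogeneous (Poly_Mapping.single 0 c) 0"
  by (simp add: homogeneous_def)

lemma homogeneous_pvar: "homogeneous (pvar i) 1"
  by (simp add: homogeneous_def pvar_def)

lemma homogeneous_pvar_times:
  "homogeneous p (d - 1) \<Longrightarrow> homogeneous (pvar i * p :: ('n::finite, 'k::comm_ring_1) mpoly) d"
  using homogeneous_mult[OF homogeneous_pvar, of p "d - 1" i] by simp

lemma homogeneous_pfilter: "homogeneous p d \<Longrightarrow> homogeneous (pfilter P p) d"
  by (simp add: homogeneous_def keys_pfilter)

lemma homogeneous_pdiv: "homogeneous p d \<Longrightarrow> homogeneous (pdiv i p :: ('n::finite, 'k::comm_ring_1) mpoly) (d - 1)"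
proof -
  assume h: "homogeneous p d"
  have "m \<in> Poly_Mapping.keys (pdiv i p) \<Longrightarrow> m + evar i \<in> Poly_Mapping.keys p" for m
    by (auto simp: in_keys_iff lookup_pdiv)
  with h show ?thesis
    unfolding homogeneous_def by (fastforce simp: mono_degree_add)
qed

lemma homogeneous_pderv: "homogeneous p d \<Longrightarrow> homogeneous (pderv i p :: ('n::finite, 'k::comm_ring_1) mpoly) (d - 1)"
proof -
  assume h: "homogeneous p d"
  have "m \<in> Poly_Mapping.keys (pderv i p) \<Longrightarrow> m + evar i \<in> Poly_Mapping.keys p" for m
    by (auto simp: in_keys_iff lookup_pderv)
  with h show ?thesis
    unfolding homogeneous_def by (fastforce simp: mono_degree_add)
qed

lemma homogeneous_neg: "homogeneous p d \<Longrightarrow> d < 0 \<Longrightarrow> p = 0"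
  by (metis all_not_in_conv homogeneous_def keys_eq_empty linorder_not_less of_nat_0_le_iff)

lemma homogeneous_deg0:
  assumes "homogeneous (p :: ('n::finite, 'k::comm_ring_1) mpoly) 0"
  shows "p = Poly_Mapping.single 0 (Poly_Mapping.lookup p 0)"
proof -
  have "m = 0" if "m \<in> Poly_Mapping.keys p" for m
    using assms that by (auto simp: homogeneous_def mono_degree_eq_0_iff)
  then show ?thesis
    by (intro poly_mapping_eqI) (auto simp: lookup_single when_def in_keys_iff)
qed

lemma homogeneous_const_coeff: "homogeneous p d \<Longrightarrow> d \<noteq> 0 \<Longrightarrow> Poly_Mapping.lookup p 0 = 0"
  by (metis homogeneous_def in_keys_iff mono_degree_0 of_nat_0)

definition hcomp :: "int \<Rightarrow> ('n, 'k::zero) mpoly \<Rightarrow> ('n, 'k) mpoly"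
  where "hcomp d = pfilter (\<lambda>m. int (mono_degree m) = d)"

lemma homogeneous_hcomp [simp]: "homogeneous (hcomp d p) d"
  by (simp add: hcomp_def homogeneous_def keys_pfilter)

lemma hcomp_0 [simp]: "hcomp d 0 = 0"
  by (simp add: hcomp_def)

lemma hcomp_sum: "hcomp d (\<Sum>i\<in>A. f i) = (\<Sum>i\<in>A. hcomp d (f i))"
  by (simp add: hcomp_def pfilter_sum)

lemma hcomp_homogeneous: "homogeneous p e \<Longrightarrow> hcomp d p = (if d = e then p else 0)"
  by (auto simp: hcomp_def homogeneous_def intro!: pfilter_id pfilter_disjoint)

lemma hcomp_times:
  fixes p q :: "('n::finite, 'k::comm_ring_1) mpoly"
  assumes "homogeneous q e"
  shows "hcomp d (p * q) = hcomp (d - e) p * q"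
proof -
  define r where "r = pfilter (\<lambda>m. \<not> int (mono_degree m) = d - e) p"
  have "p = hcomp (d - e) p + r"
    unfolding hcomp_def r_def by (rule pfilter_compl[symmetric])
  then have "p * q = hcomp (d - e) p * q + r * q"
    by (metis distrib_right)
  moreover have "homogeneous (hcomp (d - e) p * q) d"
    using homogeneous_mult[OF homogeneous_hcomp assms, of "d - e" p] by simp
  moreover have "hcomp d (r * q) = 0"
    unfolding hcomp_def
  proof (rule pfilter_disjoint)
    fix m assume "m \<in> Poly_Mapping.keys (r * q)"
    then obtain a b where "m = a + b" "a \<in> Poly_Mapping.keys r" "b \<in> Poly_Mapping.keys q"
      using keys_mult[of r q] by blast
    then show "\<not> int (mono_degree m) = d"
      using assms by (auto simp: r_def keys_pfilter homogeneous_def mono_degree_add)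
  qed
  ultimately show ?thesis
    by (simp add: hcomp_homogeneous) (simp add: hcomp_def pfilter_add hcomp_homogeneous[unfolded hcomp_def])
qed

text \<open>Whether a monomial lies in a square-free monomial ideal depends only on its support, so
  the ideal is encoded by its family of supports, the nonfaces of the complex. For upward closed
  families, sums and intersections of ideals become unions and intersections of families.\<close>

definition monI :: "'n set set \<Rightarrow> ('n, 'k::zero) mpoly set"
  where "monI N = {p. \<forall>m\<in>Poly_Mapping.keys p. Poly_Mapping.keys m \<in> N}"

definition upclosed :: "'n set set \<Rightarrow> bool"
  where "upclosed N \<longleftrightarrow> (\<forall>A\<in>N. \<forall>B. A \<subseteq> B \<longrightarrow> B \<in> N)"

lemma monI_0 [simp]: "0 \<in> monI N"
  by (simp add: monI_def)

lemma monI_add: "p \<in> monI N \<Longrightarrow> q \<in> monI N \<Longrightarrow> p + q \<in> monI N"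
  unfolding monI_def using keys_add[of p q] by blast

lemma monI_uminus: "p \<in> monI N \<Longrightarrow> - p \<in> (monI N :: ('n, 'k::ab_group_add) mpoly set)"
  by (auto simp: monI_def in_keys_iff)

lemma monI_diff: "p \<in> monI N \<Longrightarrow> q \<in> monI N \<Longrightarrow> p - q \<in> (monI N :: ('n, 'k::ab_group_add) mpoly set)"
  using monI_add[of p N "- q"] by (simp add: monI_uminus)

lemma monI_sum: "(\<And>i. i \<in> A \<Longrightarrow> f i \<in> monI N) \<Longrightarrow> (\<Sum>i\<in>A. f i) \<in> monI N"
  by (induction A rule: infinite_finite_induct) (auto intro: monI_add)

lemma keys_add_nat: "Poly_Mapping.keys (a + b :: 'n \<Rightarrow>\<^sub>0 nat) = Poly_Mapping.keys a \<union> Poly_Mapping.keys b"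
  by (auto simp: in_keys_iff lookup_add)

lemma monI_mult:
  assumes "upclosed N" "p \<in> monI N"
  shows "q * p \<in> (monI N :: ('n, 'k::comm_ring_1) mpoly set)"
  unfolding monI_def
proof safe
  fix m assume "m \<in> Poly_Mapping.keys (q * p)"
  then obtain a b where "m = a + b" "b \<in> Poly_Mapping.keys p"
    using keys_mult[of q p] by blast
  then show "Poly_Mapping.keys m \<in> N"
    using assms by (auto simp: monI_def upclosed_def keys_add_nat)
qed

lemma monI_pfilter: "p \<in> monI N \<Longrightarrow> pfilter P p \<in> monI N"
  by (simp add: monI_def keys_pfilter)

lemma monI_mono: "N \<subseteq> N' \<Longrightarrow> monI N \<subseteq> monI N'"
  by (auto simp: monI_def)

section \<open>The Koszul complex\<close>

type_synonym ('n, 'k) chain = "'n set \<Rightarrow> ('n, 'k) mpoly"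

text \<open>A chain \<open>f\<close> stands for the sum of the \<open>f T e_T\<close> in an exterior
  algebra. No order on \<open>'n\<close> is assumed; \<open>to_nat\<close> supplies one to fix the
  signs.\<close>

definition ksign :: "'n::finite \<Rightarrow> 'n set \<Rightarrow> ('n, 'k::comm_ring_1) mpoly"
  where "ksign i T = (- 1) ^ card {t \<in> T. to_nat t < to_nat i}"

text \<open>Contraction with the dual of \<open>e_i\<close>; \<open>wedge i\<close> is left
  multiplication by \<open>e_i\<close>. All sign bookkeeping is confined to the anticommutation
  rules \<open>contr_contr\<close> and \<open>contr_wedge\<close>.\<close>

definition contr :: "'n::finite \<Rightarrow> ('n, 'k::comm_ring_1) chain \<Rightarrow> ('n, 'k) chain"
  where "contr i f T = (if i \<in> T then 0 else ksign i T * f (insert i T))"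

definition wedge :: "'n::finite \<Rightarrow> ('n, 'k::comm_ring_1) chain \<Rightarrow> ('n, 'k) chain"
  where "wedge i f T = (if i \<in> T then ksign i (T - {i}) * f (T - {i}) else 0)"

definition kd :: "('n::finite, 'k::comm_ring_1) chain \<Rightarrow> ('n, 'k) chain"
  where "kd f T = (\<Sum>i\<in>UNIV. pvar i * contr i f T)"

lemma sum_apply: "(\<Sum>a\<in>A. f a) T = (\<Sum>a\<in>A. f a T)"
  by (induction A rule: infinite_finite_induct) auto

lemma ksign_square [simp]: "ksign i T * ksign i T = 1"
  by (simp add: ksign_def flip: power_mult_distrib)

lemma ksign_square_left [simp]: "ksign i T * (ksign i T * p) = p"
  by (simp flip: mult.assoc)

lemma ksign_cases: "ksign i T = 1 \<or> ksign i T = - 1"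
  unfolding ksign_def by (cases "even (card {t \<in> T. to_nat t < to_nat i})") auto

lemma ksign_insert:
  assumes "l \<notin> T"
  shows "ksign i (insert l T) = (if to_nat l < to_nat i then - ksign i T else ksign i T)"
proof -
  have "{t \<in> insert l T. to_nat t < to_nat i} =
    (if to_nat l < to_nat i then insert l {t \<in> T. to_nat t < to_nat i} else {t \<in> T. to_nat t < to_nat i})"
    by auto
  then show ?thesis using assms by (simp add: ksign_def)
qed

lemma ksign_swap:
  assumes "i \<noteq> l" "i \<notin> T" "l \<notin> T"
  shows "ksign i T * ksign l (insert i T) = - (ksign l T * ksign i (insert l T))"
proof -
  have "to_nat i \<noteq> to_nat l" using assms(1) by simp
  then show ?thesis using assms by (auto simp: ksign_insert)
qed

lemma contr_contr:
  fixes f :: "('n::finite, 'k::comm_ring_1) chain"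
  shows "contr i (contr l f) = - contr l (contr i f)"
proof
  fix T
  show "contr i (contr l f) T = (- contr l (contr i f)) T"
  proof (cases "i = l \<or> i \<in> T \<or> l \<in> T")
    case True
    then show ?thesis by (auto simp: contr_def)
  next
    case False
    then show ?thesis using arg_cong[OF ksign_swap[of i l T], of "\<lambda>s. s * f (insert i (insert l T))"]
      by (cases "i = l") (simp_all add: contr_def insert_commute mult.assoc)
  qed
qed

lemma contr_wedge:
  fixes f :: "('n::finite, 'k::comm_ring_1) chain"
  shows "contr i (wedge l f) + wedge l (contr i f) = (if i = l then f else 0)"
proof
  fix T
  show "(contr i (wedge l f) + wedge l (contr i f)) T = (if i = l then f else 0) T"
  proof (cases "i = l")
    case True
    then show ?thesis by (auto simp: contr_def wedge_def insert_absorb)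
  next
    case False
    show ?thesis
    proof (cases "i \<in> T \<or> l \<notin> T")
      case True
      then show ?thesis using False by (auto simp: contr_def wedge_def)
    next
      case F: False
      define R where "R = T - {l}"
      have R: "T = insert l R" "i \<notin> R" "l \<notin> R" "insert i T - {l} = insert i R" "i \<notin> T"
        using F False by (auto simp: R_def)
      have "to_nat i \<noteq> to_nat l" using False by simp
      then have "ksign i (insert l R) * ksign l (insert i R) + ksign l R * ksign i R = (0 :: ('n, 'k) mpoly)"
        using R(2,3) by (auto simp: ksign_insert)
      then have "(ksign i (insert l R) * ksign l (insert i R) + ksign l R * ksign i R) * f (insert i R) = 0"
        by simp
      then show ?thesis using False R
        by (simp add: contr_def wedge_def algebra_simps insert_commute)
    qed
  qed
qed

lemma contr_add: "contr i (f + g) = contr i f + contr i g"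
  by (auto simp: contr_def algebra_simps)

lemma contr_sum: "contr i (\<Sum>a\<in>A. f a) = (\<Sum>a\<in>A. contr i (f a))"
  by (rule ext) (simp add: contr_def sum_apply sum_distrib_left)

lemma kd_add: "kd (f + g) = kd f + kd g"
  by (auto simp: kd_def contr_add sum.distrib algebra_simps)

lemma kd_0 [simp]: "kd 0 = 0"
  by (simp add: fun_eq_iff kd_def contr_def cong: if_cong)

lemma kd_uminus: "kd (- f) = - kd f"
  using kd_add[of f "- f"] by (simp add: eq_neg_iff_add_eq_0 add.commute)

lemma kd_diff: "kd (f - g) = kd f - kd g"
  using kd_add[of f "- g"] by (simp add: kd_uminus)

lemma kd_sum: "kd (\<Sum>a\<in>A. f a) = (\<Sum>a\<in>A. kd (f a))"
proof (induction A rule: infinite_finite_induct)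
  case (insert x F)
  show ?case unfolding sum.insert[OF insert(1,2)] kd_add insert(3) ..
qed (simp_all only: sum.infinite sum.empty kd_0 not_False_eq_True)

lemma kd_mult_right: "kd (\<lambda>T. f T * p) = (\<lambda>T. kd f T * p)"
  unfolding kd_def contr_def sum_distrib_right
  by (intro ext sum.cong) (auto simp: mult.assoc)

lemma kd_mult_left: "kd (\<lambda>T. p * f T) = (\<lambda>T. p * kd f T)"
  using kd_mult_right[of f p] by (simp add: mult.commute)

lemma contr_mult_left: "contr i (\<lambda>T. p * f T) = (\<lambda>T. p * contr i f T)"
  by (rule ext) (simp add: contr_def mult.left_commute)

lemma kd_alt: "kd f = (\<Sum>i\<in>UNIV. (\<lambda>T. pvar i * contr i f T))"
  by (simp add: fun_eq_iff kd_def sum_apply)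

lemma contr_kd: "contr i (kd f) = - kd (contr i f)"
proof
  fix T
  have "contr i (kd f) T = (\<Sum>l\<in>UNIV. pvar l * contr i (contr l f) T)"
    unfolding kd_alt[of f] contr_sum contr_mult_left kd_alt[of f]
    by (simp add: sum_apply)
  also have "\<dots> = (- kd (contr i f)) T"
    by (subst contr_contr) (simp add: kd_def sum_negf)
  finally show "contr i (kd f) T = (- kd (contr i f)) T" .
qed

lemma kd_kd [simp]: "kd (kd f) = (0 :: ('n::finite, 'k::field_char_0) chain)"
proof
  fix T
  have "kd (kd f) T = (\<Sum>i\<in>UNIV. \<Sum>l\<in>UNIV. pvar i * (pvar l * contr i (contr l f) T))"
  proof -
    have "contr i (kd f) T = (\<Sum>l\<in>UNIV. pvar l * contr i (contr l f) T)" for i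
      by (subst contr_kd, subst contr_contr) (simp add: kd_def sum_negf)
    then show ?thesis by (subst kd_def) (simp add: sum_distrib_left)
  qed
  \<comment> \<open>Exchanging the summations and anticommuting the contractions turns the double
    sum into its own negative.\<close>
  moreover have "(\<Sum>i\<in>UNIV. \<Sum>l\<in>UNIV. pvar i * (pvar l * contr i (contr l f) T))
      = - (\<Sum>i\<in>UNIV. \<Sum>l\<in>UNIV. pvar i * (pvar l * contr i (contr l f) T))"
    by (subst (2) sum.swap, subst contr_contr) (simp add: sum_negf mult.left_commute)
  moreover have "p = 0" if "p = - p" for p :: "('n, 'k) mpoly"
  proof (intro poly_mapping_eqI)
    fix m
    have "Poly_Mapping.lookup p m = - Poly_Mapping.lookup p m"
      by (subst that) simp
    then show "Poly_Mapping.lookup p m = Poly_Mapping.lookup 0 m" by simp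
  qed
  ultimately show "kd (kd f) T = 0 T" by simp
qed

lemma wedge_add: "wedge i (f + g) = wedge i f + wedge i g"
  by (auto simp: wedge_def algebra_simps)

lemma wedge_sum: "wedge i (\<Sum>a\<in>A. f a) = (\<Sum>a\<in>A. wedge i (f a))"
  by (rule ext) (simp add: wedge_def sum_apply sum_distrib_left)

lemma wedge_mult_left: "wedge i (\<lambda>T. p * f T) = (\<lambda>T. p * wedge i f T)"
  by (rule ext) (simp add: wedge_def mult.left_commute)

lemma kd_wedge: "kd (wedge l g) = (\<lambda>T. pvar l * g T) - wedge l (kd g)"
proof -
  have "kd (wedge l g) + wedge l (kd g) = (\<Sum>i\<in>UNIV. (\<lambda>T. pvar i * (contr i (wedge l g) + wedge l (contr i g)) T))"
    unfolding kd_alt wedge_sum wedge_mult_left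
    by (rule ext) (simp add: sum.distrib sum_apply distrib_left)
  also have "\<dots> = (\<Sum>i\<in>UNIV. if i = l then (\<lambda>T. pvar l * g T) else 0)"
    by (rule sum.cong) (auto simp: contr_wedge)
  also have "\<dots> = (\<lambda>T. pvar l * g T)" by simp
  finally show ?thesis by (simp add: eq_diff_eq)
qed

text \<open>With \<open>e_l\<close> read as the differential of \<open>x_l\<close>, this is the de
  Rham differential.\<close>

definition khom :: "('n::finite, 'k::comm_ring_1) chain \<Rightarrow> ('n, 'k) chain"
  where "khom f = (\<Sum>l\<in>UNIV. wedge l (\<lambda>T. pderv l (f T)))"

lemma pderv_ksign: "pderv l (ksign i T * p) = ksign i T * pderv l p"
  for p :: "('n::finite, 'k::comm_ring_1) mpoly"
proof -
  have "(ksign i T :: ('n, 'k) mpoly) = 1 \<or> (ksign i T :: ('n, 'k) mpoly) = - 1"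
    by (rule ksign_cases)
  then show ?thesis by (auto simp: pderv_uminus)
qed

lemma pderv_contr: "pderv l (contr i f T) = contr i (\<lambda>T. pderv l (f T)) T"
  by (simp add: contr_def pderv_ksign)

lemma pderv_kd: "(\<lambda>T. pderv l (kd f T)) = contr l f + kd (\<lambda>T. pderv l (f T))"
  by (rule ext) (simp add: kd_def pderv_sum pderv_pvar_times sum.distrib pderv_contr)

lemma wedge_contr: "wedge l (contr l f) T = (if l \<in> T then f T else 0)"
  by (simp add: wedge_def contr_def insert_absorb)

definition is_chain :: "nat \<Rightarrow> int \<Rightarrow> ('n::finite, 'k::comm_ring_1) chain \<Rightarrow> bool"
  where "is_chain p j f \<longleftrightarrow> (\<forall>T. homogeneous (f T) j \<and> (f T \<noteq> 0 \<longrightarrow> card T = p))"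

lemma is_chain_0 [simp]: "is_chain p j 0"
  by (simp add: is_chain_def)

lemma is_chain_add: "is_chain p j f \<Longrightarrow> is_chain p j g \<Longrightarrow> is_chain p j (f + g)"
  unfolding is_chain_def by (metis add.right_neutral homogeneous_add plus_fun_apply)

lemma is_chain_diff: "is_chain p j f \<Longrightarrow> is_chain p j g \<Longrightarrow> is_chain p j (f - g)"
  unfolding is_chain_def by (metis diff_zero diff_0 fun_diff_def homogeneous_diff neg_equal_0_iff_equal)

lemma is_chain_sum: "(\<And>a. a \<in> A \<Longrightarrow> is_chain p j (f a)) \<Longrightarrow> is_chain p j (\<Sum>a\<in>A. f a)"
  by (induction A rule: infinite_finite_induct) (auto intro: is_chain_add)

lemma homogeneous_ksign_times: "homogeneous p d \<Longrightarrow> homogeneous (ksign i T * p) d"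
  for p :: "('n::finite, 'k::comm_ring_1) mpoly"
proof -
  have "(ksign i T :: ('n, 'k) mpoly) = 1 \<or> (ksign i T :: ('n, 'k) mpoly) = - 1"
    by (rule ksign_cases)
  then show "homogeneous p d \<Longrightarrow> homogeneous (ksign i T * p) d" by (auto intro: homogeneous_uminus)
qed

lemma ksign_times_eq_0_iff: "ksign i T * p = 0 \<longleftrightarrow> p = 0"
  by (metis ksign_square_left mult_zero_right)

lemma is_chain_wedge: "is_chain p j f \<Longrightarrow> is_chain (Suc p) j (wedge i f)"
  unfolding is_chain_def wedge_def
  by (auto simp: homogeneous_ksign_times ksign_times_eq_0_iff)
    (metis card_Suc_Diff1 finite)

lemma is_chain_contr: "is_chain (Suc p) j f \<Longrightarrow> is_chain p j (contr i f)"
  unfolding is_chain_def contr_def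
  by (auto simp: homogeneous_ksign_times ksign_times_eq_0_iff)

lemma is_chain_contr_0: "is_chain 0 j f \<Longrightarrow> contr i f = 0"
  unfolding is_chain_def contr_def by (auto simp: fun_eq_iff ksign_times_eq_0_iff)

lemma is_chain_map:
  assumes "is_chain p j f" "\<And>T. homogeneous (f T) j \<Longrightarrow> homogeneous (g T) j'" "\<And>T. f T = 0 \<Longrightarrow> g T = 0"
  shows "is_chain p j' g"
  using assms unfolding is_chain_def by blast

lemma is_chain_pvar_times: "is_chain p (j - 1) f \<Longrightarrow> is_chain p j (\<lambda>T. pvar i * f T)"
  by (erule is_chain_map) (auto simp: homogeneous_pvar_times)

lemma is_chain_kd: "is_chain (Suc p) (j - 1) f \<Longrightarrow> is_chain p j (kd f)"
  unfolding kd_alt by (intro is_chain_sum is_chain_pvar_times is_chain_contr)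

lemma is_chain_const_times:
  "is_chain p j f \<Longrightarrow> is_chain p j (\<lambda>T. Poly_Mapping.single 0 c * f T)"
  by (erule is_chain_map) (use homogeneous_mult[OF homogeneous_const, of _ j c] in auto)

text \<open>Cartan's formula for the Euler vector field, contraction with which is
  \<open>kd\<close>. Moving \<open>kd\<close> past \<open>wedge\<close> and past the derivatives
  leaves two sums: Euler's identity evaluates the first to the factor \<open>j\<close>, and the
  second counts the elements of \<open>T\<close>, giving \<open>p\<close>.\<close>

lemma khom_homotopy:
  assumes "is_chain p j f"
  shows "kd (khom f) + khom (kd f) = (\<lambda>T. Poly_Mapping.single 0 (of_int (j + int p)) * f T)"
proof -
  let ?D = "\<lambda>l T. pderv l (f T)"
  have "kd (khom f) + khom (kd f) = (\<Sum>l\<in>UNIV. kd (wedge l (?D l)) + wedge l (\<lambda>T. pderv l (kd f T)))"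
    unfolding khom_def by (simp add: kd_sum sum.distrib)
  also have "\<dots> = (\<Sum>l\<in>UNIV. (\<lambda>T. pvar l * ?D l T + (if l \<in> T then f T else 0)))"
    unfolding pderv_kd kd_wedge wedge_add
    by (rule sum.cong) (auto simp: wedge_contr)
  also have "\<dots> = (\<lambda>T. (\<Sum>l\<in>UNIV. pvar l * ?D l T) + (\<Sum>l\<in>UNIV. if l \<in> T then f T else 0))"
    by (rule ext) (simp add: sum_apply sum.distrib)
  also have "\<dots> = (\<lambda>T. Poly_Mapping.single 0 (of_int (j + int p)) * f T)"
  proof
    fix T
    have "(\<Sum>l\<in>UNIV. if l \<in> T then f T else 0) = of_nat (card T) * f T"
      by (simp add: sum.If_cases)
    also have "\<dots> = of_nat p * f T"
      using assms unfolding is_chain_def by (cases "f T = 0") auto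
    finally have 1: "(\<Sum>l\<in>UNIV. if l \<in> T then f T else 0) = of_nat p * f T" .
    have "homogeneous (f T) j"
      using assms by (simp add: is_chain_def)
    from pderv_euler[OF this] 1
    show "(\<Sum>l\<in>UNIV. pvar l * ?D l T) + (\<Sum>l\<in>UNIV. if l \<in> T then f T else 0)
        = Poly_Mapping.single 0 (of_int (j + int p)) * f T"
      by (simp add: single_add algebra_simps)
  qed
  finally show ?thesis .
qed

lemma is_chain_khom: "is_chain p j f \<Longrightarrow> is_chain (Suc p) (j - 1) (khom f)"
  unfolding khom_def
  by (intro is_chain_sum is_chain_wedge) (auto elim!: is_chain_map simp: homogeneous_pderv)

lemma khom_0 [simp]: "khom 0 = 0"
  by (simp add: khom_def wedge_def fun_eq_iff sum_apply cong: if_cong)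

text \<open>In characteristic zero the Euler identity turns the de Rham differential into a contracting
  homotopy, up to the total degree.\<close>

lemma koszul_exact:
  fixes f :: "('n::finite, 'k::field_char_0) chain"
  assumes "is_chain p j f" "kd f = 0" and const: "p = 0 \<Longrightarrow> Poly_Mapping.lookup (f {}) 0 = 0"
  obtains e where "is_chain (Suc p) (j - 1) e" "kd e = f"
proof (cases "f = 0")
  case True
  then show thesis using that[of 0] by simp
next
  case False
  then obtain T where T: "f T \<noteq> 0" by (auto simp: fun_eq_iff)
  then have "homogeneous (f T) j" "card T = p" using assms(1) by (auto simp: is_chain_def)
  then have "j \<ge> 0" using T homogeneous_neg by force
  \<comment> \<open>Total degree zero occurs only for a constant in homological degree zero, which
    \<open>const\<close> excludes.\<close>
  have "j + int p \<noteq> 0"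
  proof
    assume "j + int p = 0"
    then have "j = 0" "p = 0" using \<open>j \<ge> 0\<close> by auto
    then have "T = {}" "homogeneous (f T) 0" using \<open>card T = p\<close> \<open>homogeneous (f T) j\<close> by auto
    then show False using const[OF \<open>p = 0\<close>] T homogeneous_deg0 by fastforce
  qed
  define c :: 'k where "c = of_int (j + int p)"
  have "c \<noteq> 0" using \<open>j + int p \<noteq> 0\<close> unfolding c_def of_int_eq_0_iff .
  let ?e = "\<lambda>T. Poly_Mapping.single 0 (inverse c) * khom f T"
  have "kd ?e = (\<lambda>T. Poly_Mapping.single 0 (inverse c) * kd (khom f) T)"
    by (rule kd_mult_left)
  also have "kd (khom f) = (\<lambda>T. Poly_Mapping.single 0 c * f T)"
    using khom_homotopy[OF assms(1)] assms(2) by (simp add: c_def)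
  also have "(\<lambda>T. Poly_Mapping.single 0 (inverse c) * (Poly_Mapping.single 0 c * f T)) = f"
    using \<open>c \<noteq> 0\<close> by (simp add: mult_single flip: mult.assoc)
  finally have "kd ?e = f" .
  with that[of ?e] show thesis
    using is_chain_const_times[OF is_chain_khom[OF assms(1)]] by blast
qed

section \<open>Koszul regularity of Stanley--Reisner ideals\<close>

text \<open>Here \<open>j\<close> is the degree of the coefficients, so \<open>is_chain p j\<close>
  lives in total degree \<open>j + p\<close>. The condition is the vanishing of Tor in the positions
  \<open>(p, p + j)\<close> with \<open>j > r\<close>, phrased without a resolution.\<close>

definition koszul_regular :: "('n::finite, 'k::comm_ring_1) mpoly set \<Rightarrow> int \<Rightarrow> bool"
  where "koszul_regular I r \<longleftrightarrow>
    (\<forall>p j c. j > r \<longrightarrow> is_chain p j c \<longrightarrow> (\<forall>T. c T \<in> I) \<longrightarrow> kd c = 0 \<longrightarrow>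
      (\<exists>e. is_chain (Suc p) (j - 1) e \<and> (\<forall>T. e T \<in> I) \<and> kd e = c))"

lemma koszul_regularE:
  assumes "koszul_regular I r" "j > r" "is_chain p j c" "\<And>T. c T \<in> I" "kd c = 0"
  obtains e where "is_chain (Suc p) (j - 1) e" "\<And>T. e T \<in> I" "kd e = c"
  using assms unfolding koszul_regular_def by blast

lemma koszul_regular_mono: "koszul_regular I r \<Longrightarrow> r \<le> r' \<Longrightarrow> koszul_regular I r'"
  unfolding koszul_regular_def by (meson order.strict_trans1)

lemma ksign_times_monI: "p \<in> monI N \<Longrightarrow> ksign i T * p \<in> monI N"
  for p :: "('n::finite, 'k::comm_ring_1) mpoly"
proof -
  have "(ksign i T :: ('n, 'k) mpoly) = 1 \<or> (ksign i T :: ('n, 'k) mpoly) = - 1"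
    by (rule ksign_cases)
  then show "p \<in> monI N \<Longrightarrow> ksign i T * p \<in> monI N" by (auto intro: monI_uminus)
qed

lemma contr_monI: "(\<And>T. f T \<in> monI N) \<Longrightarrow> contr i f T \<in> monI N"
  by (simp add: contr_def ksign_times_monI)

lemma wedge_monI: "(\<And>T. f T \<in> monI N) \<Longrightarrow> wedge i f T \<in> monI N"
  by (simp add: wedge_def ksign_times_monI)

lemma kd_monI: "upclosed N \<Longrightarrow> (\<And>T. f T \<in> monI N) \<Longrightarrow> kd f T \<in> monI N"
  unfolding kd_def by (intro monI_sum monI_mult contr_monI)

lemma koszul_regular_empty: "koszul_regular (monI {} :: ('n::finite, 'k::comm_ring_1) mpoly set) r"
  unfolding koszul_regular_def
proof (intro allI impI)
  fix p j and c :: "('n, 'k) chain"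
  assume "\<forall>T. c T \<in> monI {}"
  then have "c = 0" by (auto simp: monI_def fun_eq_iff)
  then show "\<exists>e. is_chain (Suc p) (j - 1) e \<and> (\<forall>T. e T \<in> monI {}) \<and> kd e = c"
    by (intro exI[of _ 0]) simp
qed

text \<open>Here \<open>vfree x c\<close> is the component of \<open>c\<close> of \<open>x\<close>-degree zero, where the basis vector \<open>e\<^sub>T\<close>
  has \<open>x\<close>-degree one if \<open>x \<in> T\<close>.\<close>

definition vfree :: "'n \<Rightarrow> ('n, 'k::zero) chain \<Rightarrow> ('n, 'k) chain"
  where "vfree x f T = (if x \<in> T then 0 else pfilter (\<lambda>m. Poly_Mapping.lookup m x = 0) (f T))"

lemma pfilter_ksign: "pfilter P (ksign i T * p) = ksign i T * pfilter P p"
  for p :: "('n::finite, 'k::comm_ring_1) mpoly"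
proof -
  have "(ksign i T :: ('n, 'k) mpoly) = 1 \<or> (ksign i T :: ('n, 'k) mpoly) = - 1"
    by (rule ksign_cases)
  then show ?thesis by (auto simp: pfilter_uminus)
qed

text \<open>The Koszul differential preserves the fine grading in which \<open>x_i\<close> and
  \<open>e_i\<close> have the same degree, so it commutes with taking components of that
  grading.\<close>

lemma kd_vfree: "kd (vfree x f) = vfree x (kd f)"
proof
  fix T
  show "kd (vfree x f) T = vfree x (kd f) T"
  proof (cases "x \<in> T")
    case True
    then show ?thesis by (simp add: kd_def vfree_def contr_def cong: if_cong)
  next
    case False
    have "pvar i * contr i (vfree x f) T = pfilter (\<lambda>m. Poly_Mapping.lookup m x = 0) (pvar i * contr i f T)" for i
    proof (cases "i = x")
      case True
      then show ?thesis by (simp add: pfilter_pvar_times_self contr_def vfree_def)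
    next
      case F: False
      then show ?thesis using False
        by (simp add: pfilter_pvar_times_other contr_def vfree_def pfilter_ksign)
    qed
    then show ?thesis using False by (simp add: kd_def vfree_def pfilter_sum)
  qed
qed

lemma is_chain_vfree: "is_chain p j f \<Longrightarrow> is_chain p j (vfree x f)"
  by (erule is_chain_map) (auto simp: vfree_def homogeneous_pfilter)

lemma vfree_monI: "(\<And>T. f T \<in> monI N) \<Longrightarrow> vfree x f T \<in> monI N"
  by (simp add: vfree_def monI_pfilter)

lemma vfree_monI_restrict:
  assumes "f T \<in> monI (N \<union> {A. x \<in> A})"
  shows "vfree x f T \<in> monI N"
  using assms by (auto simp: vfree_def monI_def keys_pfilter in_keys_iff)

text \<open>The first two terms collect the coefficient monomials free of \<open>x\<close>, at basis
  vectors without and with \<open>e_x\<close> respectively; the third collects the multiples of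
  \<open>x\<close>.\<close>

lemma vfree_decompose:
  "c = vfree x c + wedge x (vfree x (contr x c)) + (\<lambda>T. pvar x * pdiv x (c T))"
proof
  fix T
  have "pfilter (\<lambda>m. Poly_Mapping.lookup m x = 0) (c T) = (vfree x c + wedge x (vfree x (contr x c))) T"
    by (simp add: vfree_def wedge_def contr_def pfilter_ksign insert_absorb)
  then show "c T = (vfree x c + wedge x (vfree x (contr x c)) + (\<lambda>T. pvar x * pdiv x (c T))) T"
    using pfilter_plus_pdiv[of x "c T"] by simp
qed

text \<open>The parts of a cycle whose coefficients are free of \<open>x\<close> have coefficients
  in \<open>monI N\<close>, where the assumption applies. What remains is \<open>x\<close> times a
  chain \<open>y\<close> with unrestricted coefficients; cancelling \<open>x\<close> shows that
  \<open>y\<close> is a cycle of the full Koszul complex, and any filling \<open>h\<close> of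
  \<open>y\<close> yields the admissible filling \<open>x h\<close>, since all multiples of
  \<open>x\<close> belong to the enlarged ideal.\<close>

lemma koszul_regular_insert_var:
  fixes N :: "'n::finite set set"
  assumes up: "upclosed N" and reg: "koszul_regular (monI N :: ('n, 'k::field_char_0) mpoly set) r" and r: "1 \<le> r"
  shows "koszul_regular (monI (N \<union> {A. x \<in> A}) :: ('n, 'k) mpoly set) r"
  unfolding koszul_regular_def
proof (intro allI impI)
  fix p j and c :: "('n, 'k) chain"
  let ?I = "monI N :: ('n, 'k) mpoly set"
  let ?J = "monI (N \<union> {A. x \<in> A}) :: ('n, 'k) mpoly set"
  assume j: "j > r" and c: "is_chain p j c" and cJ: "\<forall>T. c T \<in> ?J" and kc: "kd c = 0"
  obtain g0 where g0: "is_chain (Suc p) (j - 1) g0" "\<And>T. g0 T \<in> ?I" "kd g0 = vfree x c"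
  proof (rule koszul_regularE[OF reg j is_chain_vfree[OF c, of x]])
    show "vfree x c T \<in> ?I" for T using cJ by (intro vfree_monI_restrict) auto
    show "kd (vfree x c) = 0" unfolding kd_vfree kc by (simp add: vfree_def fun_eq_iff)
  qed (rule that)
  have kcc: "kd (contr x c) = 0"
  proof -
    have "contr x (0 :: ('n, 'k) chain) = 0" by (simp add: contr_def fun_eq_iff)
    then show ?thesis using contr_kd[of x c] kc by simp
  qed
  obtain g1 where g1: "is_chain p (j - 1) g1" "\<And>T. g1 T \<in> ?I" "kd g1 = vfree x (contr x c)"
  proof (cases p)
    case 0
    then have "contr x c = 0" using c is_chain_contr_0 by blast
    then show thesis using that[of 0] by (simp add: vfree_def fun_eq_iff)
  next
    case (Suc q)
    obtain e where "is_chain (Suc q) (j - 1) e" "\<And>T. e T \<in> ?I" "kd e = vfree x (contr x c)"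
    proof (rule koszul_regularE[OF reg j is_chain_vfree[OF is_chain_contr]])
      show "is_chain (Suc q) j c" using c Suc by simp
      show "vfree x (contr x c) T \<in> ?I" for T
        using cJ by (intro vfree_monI_restrict contr_monI) auto
      show "kd (vfree x (contr x c)) = 0" unfolding kd_vfree kcc by (simp add: vfree_def fun_eq_iff)
    qed (rule that)
    then show thesis using that Suc by blast
  qed
  define b where "b = vfree x g1"
  have b: "is_chain p (j - 1) b" "\<And>T. b T \<in> ?I"
    unfolding b_def using g1 by (auto intro: is_chain_vfree vfree_monI)
  have kb: "kd b = vfree x (contr x c)"
    unfolding b_def kd_vfree g1(3) by (auto simp: vfree_def fun_eq_iff intro!: pfilter_id simp: keys_pfilter)
  define y where "y = b + (\<lambda>T. pdiv x (c T))"
  have y: "is_chain p (j - 1) y"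
    unfolding y_def by (intro is_chain_add b) (use c in \<open>auto elim!: is_chain_map simp: homogeneous_pdiv pdiv_pvar_times[of x 0, simplified]\<close>)
  \<comment> \<open>The part at \<open>e_x\<close> is \<open>wedge x (kd b)\<close>, that is,
    \<open>x b\<close> minus the boundary of \<open>wedge x b\<close>. Only a boundary and a
    multiple of \<open>x\<close> remain.\<close>
  have "c = kd g0 + ((\<lambda>T. pvar x * b T) - kd (wedge x b)) + (\<lambda>T. pvar x * pdiv x (c T))"
    using vfree_decompose[of c x] by (simp add: g0(3) kd_wedge kb)
  then have ceq: "c = kd (g0 - wedge x b) + (\<lambda>T. pvar x * y T)"
    unfolding y_def by (simp add: kd_diff fun_eq_iff algebra_simps)
  have "(\<lambda>T. pvar x * kd y T) = kd (c - kd (g0 - wedge x b))"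
    by (subst ceq) (simp add: kd_mult_left)
  then have "(\<lambda>T. pvar x * kd y T) = 0" by (simp add: kd_diff kc)
  then have "kd y T = 0" for T
    using pvar_times_cancel[of x "kd y T" 0] by (simp add: fun_eq_iff)
  then have "kd y = 0" by (simp add: fun_eq_iff)
  have "homogeneous (y {}) (j - 1)" using y by (simp add: is_chain_def)
  \<comment> \<open>From \<open>j > r\<close> and \<open>1 \<le> r\<close>, the coefficients of
    \<open>y\<close> have degree \<open>j - 1 > 0\<close>, which excludes the only obstruction to
    exactness.\<close>
  then have "Poly_Mapping.lookup (y {}) 0 = 0"
    using j r by (intro homogeneous_const_coeff) auto
  then obtain h where h: "is_chain (Suc p) (j - 1 - 1) h" "kd h = y"
    using koszul_exact[OF y \<open>kd y = 0\<close>] by blast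
  let ?e = "g0 - wedge x b + (\<lambda>T. pvar x * h T)"
  have IJ: "?I \<subseteq> ?J" by (rule monI_mono) auto
  have "pvar x * q \<in> ?J" for q
  proof -
    have "m \<in> Poly_Mapping.keys (pvar x * q) \<Longrightarrow> x \<in> Poly_Mapping.keys m" for m
      by (auto simp: in_keys_iff lookup_pvar_times split: if_splits)
    then show ?thesis by (auto simp: monI_def)
  qed
  moreover have "(g0 - wedge x b) T \<in> ?J" for T
    using IJ monI_diff[OF g0(2) wedge_monI[OF b(2)]] by auto
  ultimately have "?e T \<in> ?J" for T
    by (simp add: monI_add)
  moreover have "is_chain (Suc p) (j - 1) ?e"
    by (intro is_chain_add is_chain_diff g0 is_chain_wedge b is_chain_pvar_times h)
  moreover have "kd ?e = c"
    by (subst ceq) (simp add: kd_add kd_mult_left h(2))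
  ultimately show "\<exists>e. is_chain (Suc p) (j - 1) e \<and> (\<forall>T. e T \<in> ?J) \<and> kd e = c"
    by blast
qed

text \<open>As a family of supports, this belongs to the ideal generated by the variables outside
  \<open>F\<close>.\<close>

definition nonfaces :: "'n set \<Rightarrow> 'n set set"
  where "nonfaces F = {A. \<not> A \<subseteq> F}"

lemma upclosed_nonfaces: "upclosed (nonfaces F)"
  by (auto simp: upclosed_def nonfaces_def)

lemma upclosed_INT: "(\<And>i. i \<in> A \<Longrightarrow> upclosed (N i)) \<Longrightarrow> upclosed (\<Inter>i\<in>A. N i)"
  unfolding upclosed_def by blast

text \<open>Passing to the subcomplex induced on \<open>F\<close> adds the variables outside
  \<open>F\<close> to the ideal, and these can be added one at a time.\<close>

lemma koszul_regular_restrict: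
  fixes N :: "'n::finite set set"
  assumes "upclosed N" "koszul_regular (monI N :: ('n, 'k::field_char_0) mpoly set) r" "1 \<le> r"
  shows "koszul_regular (monI (N \<union> nonfaces F) :: ('n, 'k) mpoly set) r"
proof -
  have "koszul_regular (monI (N \<union> {A. A \<inter> B \<noteq> {}}) :: ('n, 'k) mpoly set) r" for B
    using finite[of B]
  proof (induction B rule: finite_induct)
    case empty
    then show ?case using assms(2) by simp
  next
    case (insert x B)
    have "upclosed (N \<union> {A. A \<inter> B \<noteq> {}})"
      using assms(1) unfolding upclosed_def by blast
    from koszul_regular_insert_var[OF this insert.IH assms(3), of x]
    have "koszul_regular (monI (N \<union> {A. A \<inter> B \<noteq> {}} \<union> {A. x \<in> A}) :: ('n, 'k) mpoly set) r" .
    moreover have "N \<union> {A. A \<inter> B \<noteq> {}} \<union> {A. x \<in> A} = N \<union> {A. A \<inter> insert x B \<noteq> {}}"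
      by blast
    ultimately show ?case by simp
  qed
  moreover have "nonfaces F = {A. A \<inter> - F \<noteq> {}}"
    by (auto simp: nonfaces_def)
  ultimately show ?thesis by metis
qed

lemma koszul_regular_nonfaces:
  "koszul_regular (monI (nonfaces F) :: ('n::finite, 'k::field_char_0) mpoly set) 1"
  using koszul_regular_restrict[of "{}" 1 F, OF _ koszul_regular_empty] by (simp add: upclosed_def)

text \<open>Mayer--Vietoris on the level of chains. A cycle over the intersection bounds
  \<open>a\<close> over the first ideal and \<open>b\<close> over the second; \<open>a - b\<close>
  is a cycle over the sum whose coefficient degree is lower by one, which explains
  \<open>r - 1\<close>. Splitting a filling of \<open>a - b\<close> as \<open>e1 + e2\<close> along
  the two ideals makes \<open>a - kd e1 = b + kd e2\<close> a filling over both.\<close>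

lemma koszul_regular_Int:
  fixes M N :: "'n::finite set set"
  assumes up: "upclosed M" "upclosed N"
    and M: "koszul_regular (monI M :: ('n, 'k::field_char_0) mpoly set) r"
    and N: "koszul_regular (monI N :: ('n, 'k) mpoly set) r"
    and MN: "koszul_regular (monI (M \<union> N) :: ('n, 'k) mpoly set) (r - 1)"
  shows "koszul_regular (monI (M \<inter> N) :: ('n, 'k) mpoly set) r"
  unfolding koszul_regular_def
proof (intro allI impI)
  fix p j and c :: "('n, 'k) chain"
  let ?I = "\<lambda>N. monI N :: ('n, 'k) mpoly set"
  assume j: "j > r" and c: "is_chain p j c" and cI: "\<forall>T. c T \<in> ?I (M \<inter> N)" and kc: "kd c = 0"
  obtain a where a: "is_chain (Suc p) (j - 1) a" "\<And>T. a T \<in> ?I M" "kd a = c"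
    by (rule koszul_regularE[OF M j c _ kc]) (use cI in \<open>auto simp: monI_def\<close>)
  obtain b where b: "is_chain (Suc p) (j - 1) b" "\<And>T. b T \<in> ?I N" "kd b = c"
    by (rule koszul_regularE[OF N j c _ kc]) (use cI in \<open>auto simp: monI_def\<close>)
  have sub: "?I M \<subseteq> ?I (M \<union> N)" "?I N \<subseteq> ?I (M \<union> N)" by (simp_all add: monI_mono)
  obtain e where e: "is_chain (Suc (Suc p)) (j - 1 - 1) e" "\<And>T. e T \<in> ?I (M \<union> N)" "kd e = a - b"
  proof (rule koszul_regularE[OF MN])
    show "r - 1 < j - 1" using j by simp
    show "is_chain (Suc p) (j - 1) (a - b)" by (intro is_chain_diff a b)
    show "(a - b) T \<in> ?I (M \<union> N)" for T
      using sub a(2)[of T] b(2)[of T] by (auto intro: monI_diff)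
    show "kd (a - b) = 0" by (simp add: kd_diff a b)
  qed (rule that)
  define e1 where "e1 = (\<lambda>T. pfilter (\<lambda>m. Poly_Mapping.keys m \<in> M) (e T))"
  define e2 where "e2 = (\<lambda>T. pfilter (\<lambda>m. Poly_Mapping.keys m \<notin> M) (e T))"
  have ee: "e = e1 + e2" by (auto simp: e1_def e2_def pfilter_compl)
  have e12: "e1 T \<in> ?I M" "e2 T \<in> ?I N" for T
    using e(2)[of T] by (auto simp: e1_def e2_def monI_def keys_pfilter)
  have "is_chain (Suc (Suc p)) (j - 1 - 1) e1"
    unfolding e1_def using e(1) by (rule is_chain_map) (auto simp: homogeneous_pfilter)
  then have f: "is_chain (Suc p) (j - 1) (a - kd e1)"
    by (intro is_chain_diff a is_chain_kd)
  have eq: "a - kd e1 = b + kd e2"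
    using e(3) unfolding ee kd_add by (simp add: algebra_simps)
  have "(a - kd e1) T \<in> ?I N" for T
    unfolding eq plus_fun_apply by (intro monI_add b kd_monI up e12)
  moreover have "(a - kd e1) T \<in> ?I M" for T
    unfolding fun_diff_def by (intro monI_diff a kd_monI up e12)
  ultimately have "(a - kd e1) T \<in> ?I (M \<inter> N)" for T
    by (simp add: monI_def)
  moreover have "kd (a - kd e1) = c" by (simp add: kd_diff a)
  ultimately show "\<exists>e. is_chain (Suc p) (j - 1) e \<and> (\<forall>T. e T \<in> ?I (M \<inter> N)) \<and> kd e = c"
    using f by blast
qed

section \<open>Facet orders: regularity of the partial complexes and the vertex count\<close>

lemma conn_witness:
  assumes "0 < j" obtains i where "i < j" "conn \<sigma>s j = card (\<sigma>s ! i \<inter> \<sigma>s ! j)"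
proof -
  have "Max ((\<lambda>i. card (\<sigma>s ! i \<inter> \<sigma>s ! j)) ` {..<j}) \<in> (\<lambda>i. card (\<sigma>s ! i \<inter> \<sigma>s ! j)) ` {..<j}"
    using assms by (intro Max_in) auto
  then show thesis using that unfolding conn_def by auto
qed

text \<open>\<open>monI (N \<union> nonfaces (\<sigma>s ! j))\<close> belongs to the subcomplex induced on \<open>\<sigma>\<^sub>j\<close>, which is a simplex if
  \<open>conn \<sigma>s j = card (\<sigma>\<^sub>j \<inter> (\<Union>i<j. \<sigma>\<^sub>i))\<close>.\<close>

lemma koszul_regular_prefix:
  fixes \<sigma>s :: "'n::finite set list"
  assumes "0 < j"
  shows "koszul_regular (monI (\<Inter>i\<in>{..<j}. nonfaces (\<sigma>s ! i)) :: ('n, 'k::field_char_0) mpoly set)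
    (2 + (\<Sum>i\<in>{1..<j}. int (card (\<sigma>s ! i \<inter> (\<Union>l<i. \<sigma>s ! l))) - int (conn \<sigma>s i)))"
  using assms
proof (induction j)
  case 0
  then show ?case by simp
next
  case (Suc j)
  let ?\<delta> = "\<lambda>i. int (card (\<sigma>s ! i \<inter> (\<Union>l<i. \<sigma>s ! l))) - int (conn \<sigma>s i)"
  let ?N = "\<Inter>i\<in>{..<j}. nonfaces (\<sigma>s ! i)"
  let ?I = "\<lambda>N. monI N :: ('n, 'k) mpoly set"
  show ?case
  proof (cases "j = 0")
    case True
    then show ?thesis
      using koszul_regular_mono[OF koszul_regular_nonfaces, of 2 "\<sigma>s ! 0"] by (simp add: lessThan_Suc)
  next
    case False
    define r where "r = 2 + (\<Sum>i\<in>{1..<j}. ?\<delta> i)"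
    have \<delta>: "0 \<le> ?\<delta> i" if "0 < i" for i
    proof -
      obtain l where "l < i" "conn \<sigma>s i = card (\<sigma>s ! l \<inter> \<sigma>s ! i)" using conn_witness[OF \<open>0 < i\<close>] .
      moreover from this have "card (\<sigma>s ! l \<inter> \<sigma>s ! i) \<le> card (\<sigma>s ! i \<inter> (\<Union>l<i. \<sigma>s ! l))"
        by (intro card_mono) auto
      ultimately show ?thesis by simp
    qed
    have "0 \<le> (\<Sum>i\<in>{1..<j}. ?\<delta> i)" by (intro sum_nonneg \<delta>) auto
    then have r: "2 \<le> r" unfolding r_def by linarith
    have IH: "koszul_regular (?I ?N) r" using Suc.IH False by (simp add: r_def)
    have up: "upclosed ?N" by (intro upclosed_INT upclosed_nonfaces)
    \<comment> \<open>The bound on the sum required by Mayer--Vietoris. For a simplex it holds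
      because \<open>1 \<le> r - 1\<close>; otherwise \<open>?\<delta> j \<ge> 1\<close> absorbs the
      loss of one and restriction keeps the bound \<open>r\<close>.\<close>
    have "koszul_regular (?I (?N \<union> nonfaces (\<sigma>s ! j))) (r + ?\<delta> j - 1)"
    proof (cases "?\<delta> j = 0")
      case True
      obtain l where l: "l < j" "conn \<sigma>s j = card (\<sigma>s ! l \<inter> \<sigma>s ! j)" using conn_witness False by blast
      \<comment> \<open>Equal cardinalities force one earlier facet to contain every vertex of
        \<open>\<sigma>s ! j\<close> that occurred before.\<close>
      have "\<sigma>s ! l \<inter> \<sigma>s ! j = \<sigma>s ! j \<inter> (\<Union>l<j. \<sigma>s ! l)"
      proof (rule card_subset_eq)
        show "\<sigma>s ! l \<inter> \<sigma>s ! j \<subseteq> \<sigma>s ! j \<inter> (\<Union>l<j. \<sigma>s ! l)" using l(1) by auto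
      qed (use True l(2) in auto)
      then have "A \<subseteq> \<sigma>s ! l \<inter> \<sigma>s ! j" if "A \<subseteq> \<sigma>s ! j" "A \<subseteq> \<sigma>s ! i" "i < j" for A i
        using that by blast
      then have "?N \<union> nonfaces (\<sigma>s ! j) = nonfaces (\<sigma>s ! l \<inter> \<sigma>s ! j)"
        using l(1) unfolding nonfaces_def by blast
      moreover have "koszul_regular (?I (nonfaces (\<sigma>s ! l \<inter> \<sigma>s ! j))) (r + ?\<delta> j - 1)"
        by (rule koszul_regular_mono[OF koszul_regular_nonfaces]) (use r True in linarith)
      ultimately show ?thesis by simp
    next
      case F: False
      with \<delta>[of j] False have "0 < ?\<delta> j" by linarith
      moreover have "koszul_regular (?I (?N \<union> nonfaces (\<sigma>s ! j))) r"
        using r by (intro koszul_regular_restrict up IH) auto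
      ultimately show ?thesis by (auto intro: koszul_regular_mono)
    qed
    moreover have "koszul_regular (?I ?N) (r + ?\<delta> j)"
      using IH \<delta>[of j] False by (auto intro: koszul_regular_mono)
    moreover have "koszul_regular (?I (nonfaces (\<sigma>s ! j))) (r + ?\<delta> j)"
      by (rule koszul_regular_mono[OF koszul_regular_nonfaces]) (use \<delta>[of j] False r in linarith)
    ultimately have "koszul_regular (?I (?N \<inter> nonfaces (\<sigma>s ! j))) (r + ?\<delta> j)"
      by (intro koszul_regular_Int up upclosed_nonfaces)
    moreover have "(\<Inter>i\<in>{..<Suc j}. nonfaces (\<sigma>s ! i)) = ?N \<inter> nonfaces (\<sigma>s ! j)"
      by (auto simp: lessThan_Suc)
    moreover have "2 + (\<Sum>i\<in>{1..<Suc j}. ?\<delta> i) = r + ?\<delta> j"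
      using False by (simp add: r_def)
    ultimately show ?thesis by simp
  qed
qed

text \<open>The size of each facet splits into its old vertices, compared with \<open>conn\<close>,
  and its new ones. The new ones, together with the first facet, add up to the size of the union;
  the \<open>- 1\<close> in \<open>face_dim\<close> contributes once for every facet but the
  first.\<close>

lemma gamma_order_eq:
  fixes \<sigma>s :: "'n::finite set list"
  assumes "\<sigma>s \<noteq> []"
  shows "gamma_order \<sigma>s = (\<Sum>i\<in>{1..<length \<sigma>s}. int (card (\<sigma>s ! i \<inter> (\<Union>l<i. \<sigma>s ! l))) - int (conn \<sigma>s i))
    + int (card (\<Union>(set \<sigma>s))) - int (card (\<sigma>s ! 0)) - (int (length \<sigma>s) - 1)"
proof -
  let ?U = "\<lambda>i. \<Union>l<i. \<sigma>s ! l"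
  have *: "(\<Sum>i\<in>{1..<j}. face_dim (\<sigma>s ! i) - int (conn \<sigma>s i)) =
      (\<Sum>i\<in>{1..<j}. int (card (\<sigma>s ! i \<inter> ?U i)) - int (conn \<sigma>s i))
      + int (card (?U j)) - int (card (\<sigma>s ! 0)) - (int j - 1)" if "0 < j" for j
    using that
  proof (induction j)
    case (Suc j)
    show ?case
    proof (cases "j = 0")
      case False
      have "?U (Suc j) = ?U j \<union> \<sigma>s ! j" by (auto simp: lessThan_Suc)
      then have "card (?U (Suc j)) + card (\<sigma>s ! j \<inter> ?U j) = card (?U j) + card (\<sigma>s ! j)"
        using card_Un_Int[of "?U j" "\<sigma>s ! j"] by (simp add: Int_commute)
      then show ?thesis using Suc.IH False by (simp add: face_dim_def)
    qed (simp add: lessThan_Suc)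
  qed simp
  have "?U (length \<sigma>s) = \<Union>(set \<sigma>s)"
    by (auto simp: set_conv_nth)
  with *[of "length \<sigma>s"] assms show ?thesis
    unfolding gamma_order_def by simp
qed

section \<open>Graded free modules and dimension shifting\<close>

lemma lookup_pvar_0: "Poly_Mapping.lookup (pvar i) 0 = 0"
  using lookup_pvar_times[of i 1 0] by simp

definition mat_map :: "nat \<Rightarrow> (nat \<Rightarrow> nat \<Rightarrow> 'a::comm_ring_1) \<Rightarrow> (nat \<Rightarrow> 'a) \<Rightarrow> (nat \<Rightarrow> 'a)"
  where "mat_map r M v = (\<lambda>c. \<Sum>b<r. v b * M b c)"

definition deg_vec :: "(nat \<Rightarrow> int) \<Rightarrow> int \<Rightarrow> (nat \<Rightarrow> ('n, 'k::zero) mpoly) \<Rightarrow> bool"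
  where "deg_vec s d v \<longleftrightarrow> (\<forall>b. homogeneous (v b) (d - s b))"

definition graded_mat ::
  "nat \<Rightarrow> (nat \<Rightarrow> int) \<Rightarrow> nat \<Rightarrow> (nat \<Rightarrow> int) \<Rightarrow> (nat \<Rightarrow> nat \<Rightarrow> ('n, 'k::comm_ring_1) mpoly) \<Rightarrow> bool"
  where "graded_mat r s' r0 s M \<longleftrightarrow>
    (\<forall>b<r. M b \<in> free_mod r0 \<and> (\<forall>c<r0. homogeneous (M b c) (s' b - s c)))"

definition mat_ker :: "nat \<Rightarrow> (nat \<Rightarrow> nat \<Rightarrow> ('n, 'k::comm_ring_1) mpoly) \<Rightarrow> (nat \<Rightarrow> ('n, 'k) mpoly) set"
  where "mat_ker r M = {v \<in> free_mod r. mat_map r M v = (\<lambda>_. 0)}"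

lemma graded_mat_homogeneous:
  "graded_mat r s' r0 s M \<Longrightarrow> b < r \<Longrightarrow> homogeneous (M b c) (s' b - s c)"
  unfolding graded_mat_def free_mod_def by (cases "c < r0") auto

lemma free_mod_diff: "v \<in> free_mod r \<Longrightarrow> w \<in> free_mod r \<Longrightarrow> (\<lambda>b. v b - w b) \<in> free_mod r"
  by (simp add: free_mod_def)

lemma mat_map_diff: "mat_map r M (\<lambda>b. v b - w b) = (\<lambda>c. mat_map r M v c - mat_map r M w c)"
  by (simp add: mat_map_def left_diff_distrib sum_subtractf)

lemma mat_map_sum_scaled:
  "mat_map r M (\<lambda>b. \<Sum>i\<in>A. p i * v i b) = (\<lambda>c. \<Sum>i\<in>A. p i * mat_map r M (v i) c)"
proof
  fix c
  have "mat_map r M (\<lambda>b. \<Sum>i\<in>A. p i * v i b) c = (\<Sum>b<r. \<Sum>i\<in>A. p i * v i b * M b c)"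
    by (simp add: mat_map_def sum_distrib_right)
  also have "\<dots> = (\<Sum>i\<in>A. \<Sum>b<r. p i * v i b * M b c)" by (rule sum.swap)
  finally show "mat_map r M (\<lambda>b. \<Sum>i\<in>A. p i * v i b) c = (\<Sum>i\<in>A. p i * mat_map r M (v i) c)"
    by (simp add: mat_map_def sum_distrib_left mult.assoc)
qed

lemma deg_vec_mat_map:
  fixes M :: "nat \<Rightarrow> nat \<Rightarrow> ('n::finite, 'k::comm_ring_1) mpoly"
  assumes "graded_mat r s' r0 s M" "deg_vec s' d v"
  shows "deg_vec s d (mat_map r M v)"
  unfolding deg_vec_def mat_map_def
proof (intro allI homogeneous_sum)
  fix c b assume "b \<in> {..<r}"
  then have "homogeneous (v b * M b c) ((d - s' b) + (s' b - s c))"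
    using assms graded_mat_homogeneous by (intro homogeneous_mult) (auto simp: deg_vec_def)
  then show "homogeneous (v b * M b c) (d - s c)" by simp
qed

lemma mat_map_hcomp:
  fixes M :: "nat \<Rightarrow> nat \<Rightarrow> ('n::finite, 'k::comm_ring_1) mpoly"
  assumes "graded_mat r s' r0 s M"
  shows "mat_map r M (\<lambda>b. hcomp (d - s' b) (v b)) = (\<lambda>c. hcomp (d - s c) (mat_map r M v c))"
proof
  fix c
  have "hcomp (d - s c) (v b * M b c) = hcomp (d - s' b) (v b) * M b c" if "b < r" for b
    using hcomp_times[OF graded_mat_homogeneous[OF assms that, of c], of "d - s c" "v b"] by simp
  then show "mat_map r M (\<lambda>b. hcomp (d - s' b) (v b)) c = hcomp (d - s c) (mat_map r M v c)"
    by (simp add: mat_map_def hcomp_sum)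
qed

text \<open>A graded map commutes with taking homogeneous components, so the component of degree
  \<open>d\<close> of any preimage will do.\<close>

lemma mat_map_lift:
  fixes M :: "nat \<Rightarrow> nat \<Rightarrow> ('n::finite, 'k::comm_ring_1) mpoly"
  assumes "graded_mat r s' r0 s M" "w \<in> mat_map r M ` free_mod r" "deg_vec s d w"
  obtains v where "v \<in> free_mod r" "deg_vec s' d v" "mat_map r M v = w"
proof -
  obtain v where v: "v \<in> free_mod r" "w = mat_map r M v" using assms(2) by blast
  show thesis
  proof (rule that[of "\<lambda>b. hcomp (d - s' b) (v b)"])
    show "(\<lambda>b. hcomp (d - s' b) (v b)) \<in> free_mod r" using v by (simp add: free_mod_def)
    show "deg_vec s' d (\<lambda>b. hcomp (d - s' b) (v b))" by (simp add: deg_vec_def)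
    show "mat_map r M (\<lambda>b. hcomp (d - s' b) (v b)) = w"
      unfolding mat_map_hcomp[OF assms(1)] v(2)[symmetric]
    proof
      fix c
      show "hcomp (d - s c) (w c) = w c"
        using assms(3) hcomp_homogeneous[of "w c" "d - s c" "d - s c"] by (simp add: deg_vec_def)
    qed
  qed
qed

lemma kd_mat_map:
  "kd (\<lambda>T. mat_map r M (\<lambda>b. e b T) c) = (\<lambda>T. mat_map r M (\<lambda>b. kd (e b) T) c)"
proof -
  have "(\<lambda>T. mat_map r M (\<lambda>b. e b T) c) = (\<Sum>b<r. (\<lambda>T. e b T * M b c))"
    by (simp add: mat_map_def fun_eq_iff sum_apply)
  then show ?thesis
    by (simp add: kd_sum kd_mult_right) (simp add: mat_map_def fun_eq_iff sum_apply)
qed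

text \<open>Vanishing of the degree-\<open>d\<close> part of \<open>H\<^sub>p\<close> of the Koszul complex with coefficients in the
  submodule \<open>Z\<close> of a free module with shifts \<open>s\<close>; a \<open>0\<close>-cycle is moreover required to lie in
  \<open>(x\<^sub>1,\<dots>,x\<^sub>n)\<close> times the free module.\<close>

definition koszul_acyclic ::
  "nat \<Rightarrow> int \<Rightarrow> (nat \<Rightarrow> ('n::finite, 'k::comm_ring_1) mpoly) set \<Rightarrow> (nat \<Rightarrow> int) \<Rightarrow> bool"
  where "koszul_acyclic p d Z s \<longleftrightarrow>
    (\<forall>c. (\<forall>b. is_chain p (d - int p - s b) (c b)) \<longrightarrow> (\<forall>T. (\<lambda>b. c b T) \<in> Z) \<longrightarrow>
      (\<forall>b. kd (c b) = 0) \<longrightarrow> (p = 0 \<longrightarrow> (\<forall>b. Poly_Mapping.lookup (c b {}) 0 = 0)) \<longrightarrow>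
      (\<exists>e. (\<forall>b. is_chain (Suc p) (d - int p - s b - 1) (e b)) \<and> (\<forall>T. (\<lambda>b. e b T) \<in> Z) \<and>
        (\<forall>b. kd (e b) = c b)))"

lemma koszul_acyclicE:
  assumes "koszul_acyclic p d Z s" "\<And>b. is_chain p (d - int p - s b) (c b)"
    "\<And>T. (\<lambda>b. c b T) \<in> Z" "\<And>b. kd (c b) = 0"
    "\<And>b. p = 0 \<Longrightarrow> Poly_Mapping.lookup (c b {}) 0 = 0"
  obtains e where "\<And>b. is_chain (Suc p) (d - int p - s b - 1) (e b)" "\<And>T. (\<lambda>b. e b T) \<in> Z"
    "\<And>b. kd (e b) = c b"
  using assms unfolding koszul_acyclic_def by meson

text \<open>The connecting homomorphism of the sequence kernel, free module, image. A cycle over the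
  kernel bounds \<open>e\<close> over the free module by \<open>koszul_exact\<close>; the image
  \<open>f\<close> of \<open>e\<close> is a cycle one homological degree higher, in the same total
  degree. A filling of \<open>f\<close> lifts to \<open>h\<close>, and \<open>e - kd h\<close> fills
  the cycle within the kernel. The condition on constant terms in \<open>koszul_acyclic\<close> is
  what \<open>koszul_exact\<close> needs for \<open>p = 0\<close>.\<close>

lemma koszul_acyclic_ker:
  fixes M :: "nat \<Rightarrow> nat \<Rightarrow> ('n::finite, 'k::field_char_0) mpoly"
  assumes M: "graded_mat r s' r0 s M"
    and acyc: "koszul_acyclic (Suc p) d (mat_map r M ` free_mod r) s"
  shows "koszul_acyclic p d (mat_ker r M) s'"
  unfolding koszul_acyclic_def
proof (intro allI impI)
  fix c :: "nat \<Rightarrow> ('n, 'k) chain"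
  assume c: "\<forall>b. is_chain p (d - int p - s' b) (c b)" and cK: "\<forall>T. (\<lambda>b. c b T) \<in> mat_ker r M"
    and kc: "\<forall>b. kd (c b) = 0" and const: "p = 0 \<longrightarrow> (\<forall>b. Poly_Mapping.lookup (c b {}) 0 = 0)"
  let ?Z = "mat_map r M ` free_mod r"
  have c0: "c b = 0" if "b \<ge> r" for b
    using cK that by (auto simp: mat_ker_def free_mod_def fun_eq_iff)
  \<comment> \<open>Fillings are chosen coordinatewise, with zero beyond the rank so that
    \<open>e\<close> stays in the free module.\<close>
  have "\<exists>e. is_chain (Suc p) (d - int p - s' b - 1) e \<and> kd e = c b \<and> (b \<ge> r \<longrightarrow> e = 0)" for b
  proof (cases "b \<ge> r")
    case True
    then show ?thesis using c0 by (intro exI[of _ 0]) simp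
  next
    case False
    then show ?thesis using koszul_exact[of p "d - int p - s' b" "c b"] c kc const by metis
  qed
  then obtain e where e: "\<And>b. is_chain (Suc p) (d - int p - s' b - 1) (e b)" "\<And>b. kd (e b) = c b"
      "\<And>b. b \<ge> r \<Longrightarrow> e b = 0"
    by metis
  define f where "f = (\<lambda>c' T. mat_map r M (\<lambda>b. e b T) c')"
  have eT: "(\<lambda>b. e b T) \<in> free_mod r" for T using e(3) by (simp add: free_mod_def)
  have "deg_vec s' (d - int p - 1) (\<lambda>b. e b T)" for T
    using e(1) unfolding deg_vec_def is_chain_def by (simp add: algebra_simps)
  from deg_vec_mat_map[OF M this] have fdeg: "homogeneous (f c' T) (d - int p - 1 - s c')" for c' T
    by (simp add: deg_vec_def f_def)
  obtain g where g: "\<And>c'. is_chain (Suc (Suc p)) (d - int (Suc p) - s c' - 1) (g c')"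
      "\<And>T. (\<lambda>c'. g c' T) \<in> ?Z" "\<And>c'. kd (g c') = f c'"
  proof (rule koszul_acyclicE[OF acyc, of f])
    show "is_chain (Suc p) (d - int (Suc p) - s c') (f c')" for c'
    proof -
      have "f c' T \<noteq> 0 \<Longrightarrow> card T = Suc p" for T
        using e(1) unfolding f_def mat_map_def is_chain_def
        by (metis (no_types, lifting) mult_zero_left sum.neutral)
      then show ?thesis using fdeg[of c'] unfolding is_chain_def by (simp add: algebra_simps)
    qed
    show "(\<lambda>c'. f c' T) \<in> ?Z" for T using eT by (auto simp: f_def)
    show "kd (f c') = 0" for c'
      using cK unfolding f_def kd_mat_map e(2) by (simp add: mat_ker_def fun_eq_iff)
  qed auto
  \<comment> \<open>The filling \<open>g\<close> is lifted separately at each \<open>T\<close>;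
    taking zero at sets of the wrong size makes the lifts a chain again.\<close>
  have "\<exists>v. v \<in> free_mod r \<and> deg_vec s' (d - int p - 2) v \<and> mat_map r M v = (\<lambda>c'. g c' T)
      \<and> (card T \<noteq> Suc (Suc p) \<longrightarrow> v = (\<lambda>_. 0))" for T
  proof (cases "card T = Suc (Suc p)")
    case True
    have "deg_vec s (d - int p - 2) (\<lambda>c'. g c' T)"
      using g(1) unfolding deg_vec_def is_chain_def by (simp add: algebra_simps)
    from mat_map_lift[OF M g(2) this] True show ?thesis by metis
  next
    case False
    then have "(\<lambda>c'. g c' T) = (\<lambda>_. 0)" using g(1) by (auto simp: is_chain_def)
    then show ?thesis by (intro exI[of _ "\<lambda>_. 0"]) (auto simp: free_mod_def deg_vec_def mat_map_def)
  qed
  then obtain h where h: "\<And>T. h T \<in> free_mod r" "\<And>T. deg_vec s' (d - int p - 2) (h T)"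
      "\<And>T. mat_map r M (h T) = (\<lambda>c'. g c' T)" "\<And>T. card T \<noteq> Suc (Suc p) \<Longrightarrow> h T = (\<lambda>_. 0)"
    by metis
  let ?h = "\<lambda>b T. h T b"
  have hc: "is_chain (Suc (Suc p)) (d - int p - s' b - 1 - 1) (?h b)" for b
    unfolding is_chain_def
  proof (intro allI conjI impI)
    fix T
    show "homogeneous (h T b) (d - int p - s' b - 1 - 1)"
      using h(2)[of T] by (simp add: deg_vec_def algebra_simps)
    show "card T = Suc (Suc p)" if "h T b \<noteq> 0" using h(4)[of T] that by force
  qed
  let ?e = "\<lambda>b. e b - kd (?h b)"
  have "is_chain (Suc p) (d - int p - s' b - 1) (?e b)" for b
    by (intro is_chain_diff e is_chain_kd hc)
  moreover have "kd (?e b) = c b" for b by (simp add: kd_diff e)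
  moreover have "(\<lambda>b. ?e b T) \<in> mat_ker r M" for T
  proof -
    have "kd (?h b) T = 0" if "b \<ge> r" for b
      using h(1) that by (simp add: kd_def contr_def free_mod_def cong: if_cong)
    then have "(\<lambda>b. kd (?h b) T) \<in> free_mod r" by (simp add: free_mod_def)
    then have "(\<lambda>b. ?e b T) \<in> free_mod r" using free_mod_diff[OF eT] by simp
    moreover have "mat_map r M (\<lambda>b. ?e b T) c' = 0" for c'
    proof -
      have "(\<lambda>T. mat_map r M (\<lambda>b. kd (?h b) T) c') = kd (g c')"
        unfolding kd_mat_map[symmetric] h(3) ..
      then have "mat_map r M (\<lambda>b. kd (?h b) T) c' = f c' T" by (simp add: g(3) fun_eq_iff)
      then show ?thesis using mat_map_diff[of r M "\<lambda>b. e b T" "\<lambda>b. kd (?h b) T"]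
        by (simp add: f_def)
    qed
    ultimately show ?thesis by (auto simp: mat_ker_def intro!: ext)
  qed
  ultimately show "\<exists>e. (\<forall>b. is_chain (Suc p) (d - int p - s' b - 1) (e b)) \<and> (\<forall>T. (\<lambda>b. e b T) \<in> mat_ker r M)
      \<and> (\<forall>b. kd (e b) = c b)"
    by (intro exI[of _ ?e]) simp
qed

text \<open>Every \<open>w\<close> in \<open>Z\<close> is a cycle in homological degree zero, placed
  at the empty set. A filling of it has values at singletons only, and its boundary expresses
  \<open>w\<close> through elements of \<open>Z\<close> of degree \<open>d - 1\<close>, multiplied
  by variables.\<close>

lemma koszul_acyclic_0_generates:
  fixes Z :: "(nat \<Rightarrow> ('n::finite, 'k::comm_ring_1) mpoly) set"
  assumes "koszul_acyclic 0 d Z s" "w \<in> Z" "(\<lambda>_. 0) \<in> Z" "deg_vec s d w" "\<And>b. Poly_Mapping.lookup (w b) 0 = 0"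
  obtains z :: "'n \<Rightarrow> nat \<Rightarrow> ('n, 'k) mpoly" and a where "\<And>i. z i \<in> Z" "\<And>i. deg_vec s (d - 1) (z i)"
    "w = (\<lambda>b. \<Sum>i\<in>UNIV. (pvar i * a i) * z i b)"
proof -
  let ?c = "\<lambda>b T. if T = {} then w b else 0"
  obtain e where e: "\<And>b. is_chain (Suc 0) (d - int 0 - s b - 1) (e b)" "\<And>T. (\<lambda>b. e b T) \<in> Z"
    "\<And>b. kd (e b) = ?c b"
  proof (rule koszul_acyclicE[OF assms(1), of ?c])
    show "is_chain 0 (d - int 0 - s b) (?c b)" for b
      using assms(4) by (auto simp: is_chain_def deg_vec_def)
    show "(\<lambda>b. ?c b T) \<in> Z" for T using assms(2,3) by (cases "T = {}") simp_all
    show "kd (?c b) = 0" for b by (simp add: kd_def contr_def fun_eq_iff cong: if_cong)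
  qed (use assms(5) in auto)
  show thesis
  proof (rule that[of "\<lambda>i b. e b {i}" "\<lambda>i. ksign i {}"])
    show "deg_vec s (d - 1) (\<lambda>b. e b {i})" for i
      using e(1) unfolding deg_vec_def is_chain_def by (simp add: algebra_simps)
    show "w = (\<lambda>b. \<Sum>i\<in>UNIV. (pvar i * ksign i {}) * e b {i})"
    proof
      fix b
      have "w b = kd (e b) {}" by (simp add: e(3))
      then show "w b = (\<Sum>i\<in>UNIV. (pvar i * ksign i {}) * e b {i})"
        by (simp add: kd_def contr_def mult.assoc)
    qed
  qed (use e(2) in auto)
qed

text \<open>The scalar vector \<open>v\<close> is read as a vector \<open>w\<close> of constants.
  Its image has no constant terms, so acyclicity writes that image as a sum of variables times
  images of some \<open>y i\<close>. Subtracting the corresponding combination of the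
  \<open>y i\<close> puts \<open>w\<close> into the kernel, hence into the image of
  \<open>M2\<close>, without changing constant terms.\<close>

lemma tensor_cycle_is_boundary:
  fixes M :: "nat \<Rightarrow> nat \<Rightarrow> ('n::finite, 'k::field_char_0) mpoly" and v :: "nat \<Rightarrow> 'k"
  assumes M: "graded_mat r s' r0 s M" and M2: "graded_mat r2 s2 r s' M2"
    and exact: "mat_ker r M = mat_map r2 M2 ` free_mod r2"
    and acyc: "koszul_acyclic 0 d (mat_map r M ` free_mod r) s"
    and v: "\<And>b. v b \<noteq> 0 \<Longrightarrow> b < r \<and> s' b = d"
    and const: "\<And>c. Poly_Mapping.lookup (mat_map r M (\<lambda>b. Poly_Mapping.single 0 (v b)) c) 0 = 0"
  obtains u where "\<And>b. u b \<noteq> 0 \<Longrightarrow> b < r2 \<and> s2 b = d"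
    "v = (\<lambda>c. \<Sum>b<r2. u b * Poly_Mapping.lookup (M2 b c) 0)"
proof -
  let ?Z = "mat_map r M ` free_mod r"
  define w where "w = (\<lambda>b. Poly_Mapping.single 0 (v b) :: ('n, 'k) mpoly)"
  have "homogeneous (w b) (d - s' b)" for b
    using v[of b] homogeneous_const[of "v b"] by (cases "v b = 0") (auto simp: w_def)
  then have "deg_vec s' d w" by (simp add: deg_vec_def)
  then have "deg_vec s d (mat_map r M w)" by (rule deg_vec_mat_map[OF M])
  have wf: "w \<in> free_mod r" using v by (auto simp: free_mod_def w_def) (metis not_less single_zero)
  have zf: "(\<lambda>_. 0) \<in> free_mod r" by (simp add: free_mod_def)
  have "mat_map r M (\<lambda>_. 0) = (\<lambda>_. 0)" by (simp add: mat_map_def)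
  then have Z0: "(\<lambda>_. 0) \<in> ?Z" using zf by (metis imageI)
  obtain z a where z: "\<And>i. z i \<in> ?Z" and weq: "mat_map r M w = (\<lambda>b. \<Sum>i\<in>(UNIV::'n set). (pvar i * a i) * z i b)"
    by (rule koszul_acyclic_0_generates[OF acyc imageI[OF wf] Z0 \<open>deg_vec s d (mat_map r M w)\<close>])
      (use const in \<open>auto simp: w_def\<close>)
  obtain y where y: "\<And>i. y i \<in> free_mod r" "\<And>i. z i = mat_map r M (y i)"
    using z unfolding image_iff by metis
  define u' where "u' = (\<lambda>b. w b - (\<Sum>i\<in>(UNIV::'n set). (pvar i * a i) * y i b))"
  have "mat_map r M u' = (\<lambda>_. 0)"
    unfolding u'_def mat_map_diff mat_map_sum_scaled weq y(2) by simp
  moreover have "u' \<in> free_mod r"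
    unfolding u'_def using wf y(1) by (simp add: free_mod_def)
  ultimately obtain x where x: "u' = mat_map r2 M2 x"
    using exact unfolding mat_ker_def by blast
  have vu: "v c = (\<Sum>b<r2. Poly_Mapping.lookup (x b) 0 * Poly_Mapping.lookup (M2 b c) 0)" for c
  proof -
    have "Poly_Mapping.lookup (u' c) 0 = v c"
      by (simp add: u'_def w_def lookup_minus lookup_sum lookup_times_0 lookup_pvar_0)
    then show ?thesis by (simp add: x mat_map_def lookup_sum lookup_times_0)
  qed
  \<comment> \<open>Constant entries of \<open>M2\<close> are nonzero only between basis elements of
    equal degree, so discarding the other degrees leaves the result unchanged.\<close>
  define u where "u = (\<lambda>b. if b < r2 \<and> s2 b = d then Poly_Mapping.lookup (x b) 0 else 0)"
  have deg: "s2 b = s' c" if "b < r2" "Poly_Mapping.lookup (M2 b c) 0 \<noteq> 0" for b c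
    using homogeneous_const_coeff[OF graded_mat_homogeneous[OF M2 that(1)]] that(2) by force
  have "v c = (\<Sum>b<r2. u b * Poly_Mapping.lookup (M2 b c) 0)" for c
  proof (cases "s' c = d")
    case True
    show ?thesis unfolding vu
      by (rule sum.cong) (use deg True in \<open>auto simp: u_def\<close>)
  next
    case False
    then have "v c = 0" using v by blast
    also have "0 = (\<Sum>b<r2. u b * Poly_Mapping.lookup (M2 b c) 0)"
      by (rule sum.neutral[symmetric]) (use deg False in \<open>auto simp: u_def\<close>)
    finally show ?thesis .
  qed
  then have "v = (\<lambda>c. \<Sum>b<r2. u b * Poly_Mapping.lookup (M2 b c) 0)" ..
  moreover have "b < r2 \<and> s2 b = d" if "u b \<noteq> 0" for b
    using that by (simp add: u_def split: if_splits)
  ultimately show thesis using that by blast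
qed

section \<open>Comparison of dimensions inside finitely spanned spaces\<close>

lemma (in vector_space) dim_subset_finite:
  assumes "V \<subseteq> W" "W \<subseteq> span B" "finite B"
  shows "dim V \<le> dim W"
proof -
  obtain C where C: "C \<subseteq> W" "independent C" "W \<subseteq> span C" "card C = dim W" using basis_exists by blast
  then have "finite C" using independent_span_bound[of B C] assms by auto
  then show ?thesis using dim_le_card[of V C] C assms(1) by auto
qed

lemma (in vector_space) dim_psubset_finite:
  assumes "subspace V" "V \<subseteq> W" "x \<in> W" "x \<notin> V" "W \<subseteq> span B" "finite B"
  shows "dim V < dim W"
proof -
  obtain C where C: "C \<subseteq> V" "independent C" "V \<subseteq> span C" "card C = dim V" using basis_exists by blast
  have "span C \<subseteq> V" using C(1) assms(1) by (rule span_minimal)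
  then have "x \<notin> span C" using assms(4) by blast
  then have ind: "independent (insert x C)" using C(2) by (simp add: independent_insert)
  obtain D where D: "D \<subseteq> W" "independent D" "W \<subseteq> span D" "card D = dim W" using basis_exists by blast
  then have "finite D" using independent_span_bound[of B D] assms by auto
  then have "finite (insert x C) \<and> card (insert x C) \<le> card D"
    using ind D(3) C(1) assms by (intro independent_span_bound) auto
  then have "card C < card D"
    using \<open>x \<notin> span C\<close> span_base by (metis card_insert_disjoint finite_insert less_eq_Suc_le)
  then show ?thesis using C D by simp
qed

lemma finite_support_span:
  "{v. \<forall>b\<ge>r. v b = 0} \<subseteq> module.span vec_scale ((\<lambda>b c. if c = b then 1 else 0 :: 'k::field) ` {..<r})"
proof
  interpret vector_space "vec_scale :: 'k \<Rightarrow> _" by (rule vector_space_vec_scale)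
  let ?e = "\<lambda>b c. if c = b then 1 else 0 :: 'k"
  fix v :: "nat \<Rightarrow> 'k" assume v: "v \<in> {v. \<forall>b\<ge>r. v b = 0}"
  have "v = (\<Sum>b<r. vec_scale (v b) (?e b))"
  proof
    fix c
    have "(\<Sum>b<r. vec_scale (v b) (?e b)) c = (\<Sum>b<r. if c = b then v b else 0)"
      unfolding sum_apply by (rule sum.cong) (auto simp: vec_scale_def)
    also have "\<dots> = v c" using v by (cases "c < r") auto
    finally show "v c = (\<Sum>b<r. vec_scale (v b) (?e b)) c" ..
  qed
  also have "\<dots> \<in> span (?e ` {..<r})"
    by (intro span_sum span_scale span_base) auto
  finally show "v \<in> span (?e ` {..<r})" .
qed

section \<open>Betti numbers from a resolution\<close>

definition rank_one :: "('n, 'k::comm_ring_1) mpoly set \<Rightarrow> (nat \<Rightarrow> ('n, 'k) mpoly) set"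
  where "rank_one I = {v \<in> free_mod 1. v 0 \<in> I}"

lemma monI_const: "{} \<notin> N \<Longrightarrow> p \<in> monI N \<Longrightarrow> Poly_Mapping.lookup p 0 = 0"
  unfolding monI_def by (metis (no_types, lifting) in_keys_iff keys_zero mem_Collect_eq)

lemma rank_one_nth: "v \<in> rank_one (monI N) \<Longrightarrow> v c \<in> monI N"
  by (cases c) (auto simp: rank_one_def free_mod_def)

text \<open>In total degree \<open>d\<close> the coefficients of a \<open>p\<close>-chain have
  degree \<open>d - p\<close>. The negative case, where all chains vanish, later bounds the set of
  Betti positions from below.\<close>

lemma koszul_acyclic_rank_one:
  assumes reg: "koszul_regular (monI N :: ('n::finite, 'k::comm_ring_1) mpoly set) r" and j: "d - int p > r \<or> d - int p < 0"
  shows "koszul_acyclic p d (rank_one (monI N :: ('n, 'k) mpoly set)) (\<lambda>_. 0)"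
  unfolding koszul_acyclic_def
proof (intro allI impI)
  fix c :: "nat \<Rightarrow> ('n, 'k) chain"
  assume c: "\<forall>b. is_chain p (d - int p - 0) (c b)" and cI: "\<forall>T. (\<lambda>b. c b T) \<in> rank_one (monI N)"
    and kc: "\<forall>b. kd (c b) = 0"
  have c0: "c b = 0" if "b \<noteq> 0" for b
  proof
    fix T
    have "(\<lambda>b. c b T) \<in> rank_one (monI N)" using cI by blast
    then show "c b T = 0 T" using that by (simp add: rank_one_def free_mod_def)
  qed
  obtain e where e: "is_chain (Suc p) (d - int p - 1) e" "\<And>T. e T \<in> monI N" "kd e = c 0"
  proof (cases "d - int p < 0")
    case True
    have "c 0 = 0"
      using c True homogeneous_neg unfolding is_chain_def fun_eq_iff by fastforce
    then show thesis using that[of 0] by simp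
  next
    case False
    then have "d - int p > r" using j by simp
    then show thesis
      by (rule koszul_regularE[OF reg _ _ _ _ that]) (use c cI kc in \<open>auto simp: rank_one_def\<close>)
  qed
  let ?e = "\<lambda>b. if b = 0 then e else 0"
  have "(\<lambda>b. ?e b T) \<in> rank_one (monI N)" for T
    using e(2) by (simp add: rank_one_def free_mod_def)
  moreover have "kd (?e b) = c b" for b using e(3) c0 by simp
  moreover have "is_chain (Suc p) (d - int p - 0 - 1) (?e b)" for b using e(1) by simp
  ultimately show "\<exists>e. (\<forall>b. is_chain (Suc p) (d - int p - 0 - 1) (e b)) \<and> (\<forall>T. (\<lambda>b. e b T) \<in> rank_one (monI N))
      \<and> (\<forall>b. kd (e b) = c b)"
    by (intro exI[of _ ?e] conjI allI)
qed

text \<open>The maps of a free complex of an ideal, starting with the augmentation, in which the ideal is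
  viewed as a submodule of the free module of rank one in degree zero.\<close>

fun res_mat :: "('n, 'k::comm_ring_1) mpoly free_complex \<Rightarrow> nat \<Rightarrow> nat \<Rightarrow> nat \<Rightarrow> ('n, 'k) mpoly" where
  "res_mat F 0 = (\<lambda>b c. if c = 0 then aug F b else 0)"
| "res_mat F (Suc i) = diff F i"

fun target_rank :: "'s free_complex \<Rightarrow> nat \<Rightarrow> nat" where
  "target_rank F 0 = 1"
| "target_rank F (Suc i) = rnk F i"

fun target_shift :: "'s free_complex \<Rightarrow> nat \<Rightarrow> nat \<Rightarrow> int" where
  "target_shift F 0 = (\<lambda>_. 0)"
| "target_shift F (Suc i) = shift F i"

lemma mat_map_aug: "mat_map (rnk F 0) (res_mat F 0) v = (\<lambda>c. if c = 0 then aug_map F v else 0)"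
  by (auto simp: mat_map_def aug_map_def)

lemma mat_map_diff_map: "mat_map (rnk F (Suc i)) (res_mat F (Suc i)) = diff_map F i"
  by (auto simp: mat_map_def diff_map_def fun_eq_iff)

lemma image_aug_rank_one:
  "mat_map (rnk F 0) (res_mat F 0) ` free_mod (rnk F 0) = rank_one I \<longleftrightarrow> aug_map F ` free_mod (rnk F 0) = I"
proof -
  let ?f = "\<lambda>p c. if c = 0 then p else 0 :: ('a, 'b) mpoly"
  have inj: "inj ?f" by (rule injI) (metis)
  have "rank_one I = ?f ` I"
  proof (intro equalityI subsetI)
    fix v assume "v \<in> rank_one I"
    then have "v = ?f (v 0)" "v 0 \<in> I" by (auto simp: rank_one_def free_mod_def fun_eq_iff)
    then show "v \<in> ?f ` I" by blast
  qed (auto simp: rank_one_def free_mod_def)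
  moreover have "mat_map (rnk F 0) (res_mat F 0) ` free_mod (rnk F 0) = ?f ` (aug_map F ` free_mod (rnk F 0))"
    unfolding mat_map_aug image_image ..
  ultimately show ?thesis using inj_image_eq_iff[OF inj] by metis
qed

lemma graded_free_resolutionD:
  assumes "graded_free_resolution F I"
  shows "b < rnk F 0 \<Longrightarrow> homogeneous (aug F b) (shift F 0 b)"
    and "b < rnk F (Suc i) \<Longrightarrow> diff F i b \<in> free_mod (rnk F i)"
    and "b < rnk F (Suc i) \<Longrightarrow> c < rnk F i \<Longrightarrow> homogeneous (diff F i b c) (shift F (Suc i) b - shift F i c)"
    and "aug_map F ` free_mod (rnk F 0) = I"
    and "v \<in> free_mod (rnk F 1) \<Longrightarrow> aug_map F (diff_map F 0 v) = 0"
proof -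
  note d = assms[unfolded graded_free_resolution_def]
  show "b < rnk F 0 \<Longrightarrow> homogeneous (aug F b) (shift F 0 b)"
    using conjunct1[OF d] by blast
  show "b < rnk F (Suc i) \<Longrightarrow> diff F i b \<in> free_mod (rnk F i)"
    "b < rnk F (Suc i) \<Longrightarrow> c < rnk F i \<Longrightarrow> homogeneous (diff F i b c) (shift F (Suc i) b - shift F i c)"
    using conjunct1[OF conjunct2[OF d]] by blast+
  show "aug_map F ` free_mod (rnk F 0) = I"
    by (rule conjunct1[OF conjunct2[OF conjunct2[OF d]]])
  assume "v \<in> free_mod (rnk F 1)"
  then have "diff_map F 0 v \<in> {v \<in> free_mod (rnk F 0). aug_map F v = 0}"
    unfolding conjunct1[OF conjunct2[OF conjunct2[OF conjunct2[OF d]]]] by (rule imageI)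
  then show "aug_map F (diff_map F 0 v) = 0" by blast
qed

lemma all_nat_cases: "(\<forall>i. P i) \<longleftrightarrow> P 0 \<and> (\<forall>i. P (Suc i))"
  by (metis not0_implies_Suc)

lemma graded_free_resolution_iff:
  "graded_free_resolution F I \<longleftrightarrow>
    (\<forall>i. graded_mat (rnk F i) (shift F i) (target_rank F i) (target_shift F i) (res_mat F i)) \<and>
    mat_map (rnk F 0) (res_mat F 0) ` free_mod (rnk F 0) = rank_one I \<and>
    (\<forall>i. mat_ker (rnk F i) (res_mat F i) = mat_map (rnk F (Suc i)) (res_mat F (Suc i)) ` free_mod (rnk F (Suc i)))"
  (is "_ \<longleftrightarrow> ?A \<and> ?B \<and> ?C")
proof -
  have A: "?A \<longleftrightarrow> (\<forall>b<rnk F 0. homogeneous (aug F b) (shift F 0 b)) \<and>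
    (\<forall>i. \<forall>b<rnk F (Suc i). diff F i b \<in> free_mod (rnk F i) \<and>
       (\<forall>c<rnk F i. homogeneous (diff F i b c) (shift F (Suc i) b - shift F i c)))"
    by (subst all_nat_cases) (auto simp: graded_mat_def free_mod_def)
  have C: "?C \<longleftrightarrow> {v \<in> free_mod (rnk F 0). aug_map F v = 0} = diff_map F 0 ` free_mod (rnk F 1) \<and>
    (\<forall>i. {v \<in> free_mod (rnk F (Suc i)). diff_map F i v = (\<lambda>_. 0)}
         = diff_map F (Suc i) ` free_mod (rnk F (Suc (Suc i))))"
  proof -
    have "mat_ker (rnk F 0) (res_mat F 0) = {v \<in> free_mod (rnk F 0). aug_map F v = 0}"
      unfolding mat_ker_def mat_map_aug by (auto simp: fun_eq_iff split: if_splits)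
    then show ?thesis
      by (subst all_nat_cases) (simp only: mat_ker_def mat_map_diff_map One_nat_def)
  qed
  show ?thesis unfolding A C image_aug_rank_one graded_free_resolution_def by (rule iffI; elim conjE; intro conjI; assumption)
qed

text \<open>Iterated dimension shifting: each passage to the next syzygy module trades one
  homological degree, at fixed total degree \<open>d\<close>.\<close>

lemma koszul_acyclic_syzygy:
  fixes I :: "('n::finite, 'k::field_char_0) mpoly set"
  assumes F: "graded_free_resolution F I" and "koszul_acyclic (p + i) d (rank_one I) (\<lambda>_. 0)"
  shows "koszul_acyclic p d (mat_map (rnk F i) (res_mat F i) ` free_mod (rnk F i)) (target_shift F i)"
  using assms(2)
proof (induction i arbitrary: p)
  case 0
  have "mat_map (rnk F 0) (res_mat F 0) ` free_mod (rnk F 0) = rank_one I"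
    using F by (simp only: graded_free_resolution_iff)
  with 0 show ?case by simp
next
  case (Suc i)
  have M: "graded_mat (rnk F i) (shift F i) (target_rank F i) (target_shift F i) (res_mat F i)"
    and ex: "mat_ker (rnk F i) (res_mat F i) = mat_map (rnk F (Suc i)) (res_mat F (Suc i)) ` free_mod (rnk F (Suc i))"
    using F unfolding graded_free_resolution_iff by blast+
  have "koszul_acyclic (Suc p) d (mat_map (rnk F i) (res_mat F i) ` free_mod (rnk F i)) (target_shift F i)"
    using Suc.prems by (intro Suc.IH) simp
  from koszul_acyclic_ker[OF M this] show ?case by (simp add: ex)
qed

lemma tens_boundaries_support:
  assumes "graded_free_resolution F I"
  shows "tens_boundaries F i d \<subseteq> {v. \<forall>b\<ge>rnk F i. v b = 0}"
  using graded_free_resolutionD(2)[OF assms]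
  by (auto simp: tens_boundaries_def tens_diff_def free_mod_def intro!: sum.neutral)

text \<open>The difference of dimensions is one of natural numbers, so it suffices that every cycle
  is a boundary.\<close>

lemma tens_homology_dim_eq_0:
  fixes F :: "('n::finite, 'k::field_char_0) mpoly free_complex"
  assumes F: "graded_free_resolution F (monI N)" and N: "{} \<notin> N"
    and acyc: "koszul_acyclic i d (rank_one (monI N :: ('n, 'k) mpoly set)) (\<lambda>_. 0)"
  shows "tens_homology_dim F i d = 0"
proof -
  interpret vector_space "vec_scale :: 'k \<Rightarrow> _" by (rule vector_space_vec_scale)
  have M: "\<And>i. graded_mat (rnk F i) (shift F i) (target_rank F i) (target_shift F i) (res_mat F i)"
    and ex: "\<And>i. mat_ker (rnk F i) (res_mat F i) = mat_map (rnk F (Suc i)) (res_mat F (Suc i)) ` free_mod (rnk F (Suc i))"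
    and im: "mat_map (rnk F 0) (res_mat F 0) ` free_mod (rnk F 0) = rank_one (monI N)"
    using F unfolding graded_free_resolution_iff by blast+
  have "tens_cycles F i d \<subseteq> tens_boundaries F i d"
  proof
    fix v assume v: "v \<in> tens_cycles F i d"
    have vs: "b < rnk F i \<and> shift F i b = d" if "v b \<noteq> 0" for b
      using v that by (cases i) (auto simp: tens_mod_def)
    \<comment> \<open>In position zero the image lies in a proper monomial ideal and thus has no
      constant term; in later positions this is the cycle condition.\<close>
    have const: "Poly_Mapping.lookup (mat_map (rnk F i) (res_mat F i) (\<lambda>b. Poly_Mapping.single 0 (v b)) c) 0 = 0" for c
    proof (cases i)
      case 0
      let ?w = "\<lambda>b. Poly_Mapping.single 0 (v b) :: ('n, 'k) mpoly"
      have "?w \<in> free_mod (rnk F 0)" using vs 0 by (auto simp: free_mod_def) (metis not_less single_zero)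
      then have "mat_map (rnk F 0) (res_mat F 0) ?w \<in> rank_one (monI N)" using im by blast
      then have "mat_map (rnk F 0) (res_mat F 0) ?w c \<in> monI N"
        by (rule rank_one_nth)
      then show ?thesis using monI_const[OF N] 0 by blast
    next
      case (Suc l)
      then have "tens_diff F l v c = 0" using v by simp
      then show ?thesis
        using Suc by (simp add: tens_diff_def mat_map_def lookup_sum lookup_times_0)
    qed
    from acyc have "koszul_acyclic 0 d (mat_map (rnk F i) (res_mat F i) ` free_mod (rnk F i)) (target_shift F i)"
      by (intro koszul_acyclic_syzygy[OF F]) simp
    have M2: "graded_mat (rnk F (Suc i)) (shift F (Suc i)) (rnk F i) (shift F i) (res_mat F (Suc i))"
      using M[of "Suc i"] by simp
    obtain u where u: "\<And>b. u b \<noteq> 0 \<Longrightarrow> b < rnk F (Suc i) \<and> shift F (Suc i) b = d"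
      "v = (\<lambda>c. \<Sum>b<rnk F (Suc i). u b * Poly_Mapping.lookup (res_mat F (Suc i) b c) 0)"
      by (rule tensor_cycle_is_boundary[OF M M2 ex \<open>koszul_acyclic 0 d _ _\<close> vs const]; (assumption | (rule that; assumption)))
    then have "u \<in> tens_mod F (Suc i) d" by (simp add: tens_mod_def)
    moreover have "v = tens_diff F i u" by (simp add: u(2) tens_diff_def)
    ultimately show "v \<in> tens_boundaries F i d"
      unfolding tens_boundaries_def by blast
  qed
  moreover have "tens_boundaries F i d \<subseteq> span ((\<lambda>b c. if c = b then 1 else 0) ` {..<rnk F i})"
    using tens_boundaries_support[OF F] finite_support_span by blast
  ultimately have "dim (tens_cycles F i d) \<le> dim (tens_boundaries F i d)"
    by (rule dim_subset_finite) simp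
  then show ?thesis by (simp add: tens_homology_dim_def)
qed

lemma monomial_in_monI: "Poly_Mapping.keys m \<in> N \<Longrightarrow> Poly_Mapping.single m c \<in> monI N"
  by (simp add: monI_def)

definition indicator_mono :: "'n::finite set \<Rightarrow> ('n \<Rightarrow>\<^sub>0 nat)"
  where "indicator_mono A = (\<Sum>i\<in>A. evar i)"

lemma lookup_indicator_mono: "Poly_Mapping.lookup (indicator_mono A) i = (if i \<in> A then 1 else 0)"
  by (simp add: indicator_mono_def lookup_sum lookup_single when_def)

lemma keys_indicator_mono [simp]: "Poly_Mapping.keys (indicator_mono A) = A"
  by (auto simp: in_keys_iff lookup_indicator_mono split: if_splits)

lemma mono_degree_indicator_mono [simp]: "mono_degree (indicator_mono A) = card A"
  by (simp add: mono_degree_def lookup_indicator_mono)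

lemma card_keys_le_mono_degree: "card (Poly_Mapping.keys m) \<le> mono_degree m"
proof -
  have "(\<Sum>i\<in>Poly_Mapping.keys m. 1) \<le> mono_degree m"
    unfolding mono_degree_def by (rule sum_mono) (simp add: in_keys_iff)
  then show ?thesis by simp
qed

text \<open>A monomial \<open>g\<close> of least degree in the ideal cannot be generated from lower
  degrees. The constant terms \<open>v\<close> of a preimage of \<open>g\<close> form a cycle, and
  if \<open>v\<close> were a boundary, \<open>g\<close> would be the image of an element of the
  kernel.\<close>

lemma tens_homology_dim_0_nonzero:
  fixes F :: "('n::finite, 'k::field_char_0) mpoly free_complex"
  assumes F: "graded_free_resolution F (monI N)" and N: "N \<noteq> {}"
  obtains d where "tens_homology_dim F 0 d \<noteq> 0"
proof -
  interpret vector_space "vec_scale :: 'k \<Rightarrow> _" by (rule vector_space_vec_scale)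
  obtain A where A: "A \<in> N" "\<And>B. B \<in> N \<Longrightarrow> card A \<le> card B"
  proof -
    from N obtain B where "B \<in> N" by blast
    from arg_min_nat_lemma[of "\<lambda>A. A \<in> N" B card, OF this] show thesis using that by blast
  qed
  define g :: "('n, 'k) mpoly" where "g = Poly_Mapping.single (indicator_mono A) 1"
  let ?d = "int (card A)"
  have mindeg: "?d \<le> e" if "homogeneous p e" "p \<in> monI N" "p \<noteq> 0" for p :: "('n, 'k) mpoly" and e
  proof -
    obtain m where m: "m \<in> Poly_Mapping.keys p" using \<open>p \<noteq> 0\<close> by (metis all_not_in_conv keys_eq_empty)
    then have "Poly_Mapping.keys m \<in> N" using that(2) by (simp add: monI_def)
    then have "card A \<le> mono_degree m"
      using A(2) card_keys_le_mono_degree order_trans by blast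
    then show ?thesis using that(1) m by (auto simp: homogeneous_def)
  qed
  have M: "graded_mat (rnk F 0) (shift F 0) 1 (\<lambda>_. 0) (res_mat F 0)"
  proof -
    have "graded_mat (rnk F 0) (shift F 0) (target_rank F 0) (target_shift F 0) (res_mat F 0)"
      using F unfolding graded_free_resolution_iff by blast
    then show ?thesis by simp
  qed
  have im: "mat_map (rnk F 0) (res_mat F 0) ` free_mod (rnk F 0) = rank_one (monI N)"
    using F unfolding graded_free_resolution_iff by (elim conjE)
  have augI: "aug_map F ` free_mod (rnk F 0) = monI N"
    by (rule graded_free_resolutionD(4)[OF F])
  have aug: "?d \<le> shift F 0 b" if "b < rnk F 0" "aug F b \<noteq> 0" for b
  proof (rule mindeg)
    show "homogeneous (aug F b) (shift F 0 b)"
      by (rule graded_free_resolutionD(1)[OF F that(1)])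
    have "aug_map F (\<lambda>c. if c = b then 1 else 0) = (\<Sum>c<rnk F 0. if c = b then aug F c else 0)"
      unfolding aug_map_def by (rule sum.cong) auto
    also have "\<dots> = aug F b" using that(1) by simp
    finally have "aug F b = aug_map F (\<lambda>c. if c = b then 1 else 0)" ..
    moreover have "(\<lambda>c. if c = b then 1 else 0 :: ('n, 'k) mpoly) \<in> free_mod (rnk F 0)"
      using that(1) by (simp add: free_mod_def)
    ultimately show "aug F b \<in> monI N" using augI by blast
  qed (rule that(2))
  \<comment> \<open>A basis element with nonzero image has degree at least \<open>card A\<close>, so
    its coefficient in a vector of degree \<open>card A\<close> is constant. Where
    \<open>aug F b = 0\<close> the shift is unconstrained, but the term vanishes.\<close>
  have aug_const: "aug_map F w = (\<Sum>b<rnk F 0. Poly_Mapping.single 0 (Poly_Mapping.lookup (w b) 0) * aug F b)"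
    if "\<And>b. homogeneous (w b) (?d - shift F 0 b)" for w
    unfolding aug_map_def
  proof (rule sum.cong)
    fix b assume "b \<in> {..<rnk F 0}"
    then consider "aug F b = 0" | "?d < shift F 0 b" | "?d = shift F 0 b" using aug[of b] by fastforce
    then show "w b * aug F b = Poly_Mapping.single 0 (Poly_Mapping.lookup (w b) 0) * aug F b"
    proof cases
      case 2
      then have "w b = 0" using homogeneous_neg[OF that[of b]] by simp
      then show ?thesis by simp
    next
      case 3
      then show ?thesis using homogeneous_deg0[of "w b"] that[of b] by simp
    qed simp
  qed simp
  have "(\<lambda>c. if c = 0 then g else 0) \<in> mat_map (rnk F 0) (res_mat F 0) ` free_mod (rnk F 0)"
    unfolding im using A(1) by (simp add: rank_one_def free_mod_def g_def monomial_in_monI)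
  moreover have "deg_vec (\<lambda>_. 0) ?d (\<lambda>c. if c = 0 then g else 0)"
    using homogeneous_single[of "indicator_mono A" "1::'k"] by (simp add: deg_vec_def g_def)
  ultimately obtain w where w: "w \<in> free_mod (rnk F 0)" "deg_vec (shift F 0) ?d w"
      "mat_map (rnk F 0) (res_mat F 0) w = (\<lambda>c. if c = 0 then g else 0)"
    by (rule mat_map_lift[OF M])
  have "aug_map F w = g" using fun_cong[OF w(3)[unfolded mat_map_aug], of 0] by simp
  define v where "v = (\<lambda>b. Poly_Mapping.lookup (w b) 0)"
  have gv: "g = (\<Sum>b<rnk F 0. Poly_Mapping.single 0 (v b) * aug F b)"
    using aug_const[of w] w(2) \<open>aug_map F w = g\<close> by (simp add: deg_vec_def v_def)
  have v1: "v \<in> tens_cycles F 0 ?d"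
    unfolding tens_cycles.simps tens_mod_def
  proof (safe)
    fix b assume b: "v b \<noteq> 0"
    then show "b < rnk F 0" using w(1) by (auto simp: v_def free_mod_def) (metis not_less lookup_zero)
    show "shift F 0 b = ?d"
    proof (rule ccontr)
      assume "shift F 0 b \<noteq> ?d"
      then show False
        using homogeneous_const_coeff[of "w b" "?d - shift F 0 b"] w(2) b by (simp add: v_def deg_vec_def)
    qed
  qed
  have v2: "v \<notin> tens_boundaries F 0 ?d"
  proof
    assume "v \<in> tens_boundaries F 0 ?d"
    then obtain u where u: "u \<in> tens_mod F 1 ?d" "v = tens_diff F 0 u"
      by (auto simp: tens_boundaries_def)
    define u' where "u' = (\<lambda>b. Poly_Mapping.single 0 (u b) :: ('n, 'k) mpoly)"
    have u'0: "u' \<in> free_mod (rnk F 1)"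
      using u(1) by (auto simp: u'_def free_mod_def tens_mod_def) (metis not_less single_zero)
    have "homogeneous (u' b) (?d - shift F 1 b)" for b
      using u(1) homogeneous_const[of "u b"] by (cases "u b = 0") (auto simp: u'_def tens_mod_def)
    then have u'd: "deg_vec (shift F 1) ?d u'" by (simp add: deg_vec_def)
    have M1: "graded_mat (rnk F 1) (shift F 1) (rnk F 0) (shift F 0) (res_mat F 1)"
    proof -
      have "graded_mat (rnk F (Suc 0)) (shift F (Suc 0)) (target_rank F (Suc 0)) (target_shift F (Suc 0)) (res_mat F (Suc 0))"
        using F unfolding graded_free_resolution_iff by blast
      then show ?thesis by simp
    qed
    \<comment> \<open>The vector \<open>y\<close> has the same constant terms as the preimage of
      \<open>g\<close> but is killed by the augmentation; \<open>aug_const\<close> then gives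
      \<open>g = 0\<close>.\<close>
    define y where "y = diff_map F 0 u'"
    have "deg_vec (shift F 0) ?d y"
      using deg_vec_mat_map[OF M1 u'd] mat_map_diff_map[of F 0] by (simp add: y_def)
    moreover have "aug_map F y = 0"
      unfolding y_def by (rule graded_free_resolutionD(5)[OF F u'0])
    moreover have "Poly_Mapping.lookup (y c) 0 = v c" for c
      by (simp add: y_def u(2) tens_diff_def diff_map_def u'_def lookup_sum lookup_times_0)
    ultimately have "g = 0" using aug_const[of y] gv by (simp add: deg_vec_def)
    then have "Poly_Mapping.lookup g (indicator_mono A) = 0" by simp
    then show False by (simp add: g_def)
  qed
  have sub: "subspace (tens_boundaries F 0 ?d)"
  proof (rule subspaceI)
    have "0 = tens_diff F 0 (\<lambda>_. 0)" "(\<lambda>_. 0) \<in> tens_mod F (Suc 0) ?d"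
      by (auto simp: tens_diff_def tens_mod_def)
    then show "0 \<in> tens_boundaries F 0 ?d" unfolding tens_boundaries_def by blast
  next
    fix x y assume "x \<in> tens_boundaries F 0 ?d" "y \<in> tens_boundaries F 0 ?d"
    then obtain a b where ab: "a \<in> tens_mod F (Suc 0) ?d" "b \<in> tens_mod F (Suc 0) ?d"
      "x = tens_diff F 0 a" "y = tens_diff F 0 b" by (auto simp: tens_boundaries_def)
    have "x + y = tens_diff F 0 (a + b)"
      by (simp add: ab tens_diff_def fun_eq_iff sum.distrib distrib_right)
    moreover have "a + b \<in> tens_mod F (Suc 0) ?d"
      using ab(1,2) unfolding tens_mod_def by (auto) (metis add.right_neutral)+
    ultimately show "x + y \<in> tens_boundaries F 0 ?d" unfolding tens_boundaries_def by blast
  next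
    fix k x assume "x \<in> tens_boundaries F 0 ?d"
    then obtain a where ab: "a \<in> tens_mod F (Suc 0) ?d" "x = tens_diff F 0 a"
      by (auto simp: tens_boundaries_def)
    have "vec_scale k x = tens_diff F 0 (vec_scale k a)"
      by (simp add: ab tens_diff_def vec_scale_def sum_distrib_left mult.assoc)
    moreover have "vec_scale k a \<in> tens_mod F (Suc 0) ?d"
      using ab(1) unfolding tens_mod_def vec_scale_def by auto
    ultimately show "vec_scale k x \<in> tens_boundaries F 0 ?d" unfolding tens_boundaries_def by blast
  qed
  have sub2: "tens_boundaries F 0 ?d \<subseteq> tens_cycles F 0 ?d"
  proof
    fix x assume "x \<in> tens_boundaries F 0 ?d"
    then obtain a where a: "a \<in> tens_mod F (Suc 0) ?d" "x = tens_diff F 0 a"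
      by (auto simp: tens_boundaries_def)
    show "x \<in> tens_cycles F 0 ?d"
      unfolding tens_cycles.simps tens_mod_def
    proof (safe)
      fix c assume "x c \<noteq> 0"
      then obtain b where b: "b < rnk F (Suc 0)" "a b \<noteq> 0" "Poly_Mapping.lookup (diff F 0 b c) 0 \<noteq> 0"
        unfolding a(2) tens_diff_def by (metis (no_types, lifting) lessThan_iff mult_eq_0_iff sum.neutral)
      have h: "diff F 0 b \<in> free_mod (rnk F 0)" "\<And>c. c<rnk F 0 \<Longrightarrow> homogeneous (diff F 0 b c) (shift F (Suc 0) b - shift F 0 c)"
        using graded_free_resolutionD[OF F] b(1) by auto
      show c: "c < rnk F 0" using h(1) b(3) by (auto simp: free_mod_def) (metis not_less lookup_zero)
      show "shift F 0 c = ?d"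
        using homogeneous_const_coeff[OF h(2)[OF c]] b a(1) by (auto simp: tens_mod_def)
    qed
  qed
  have "tens_cycles F 0 ?d \<subseteq> {v. \<forall>b\<ge>rnk F 0. v b = 0}"
    by (auto simp: tens_mod_def)
  then have "tens_cycles F 0 ?d \<subseteq> span ((\<lambda>b c. if c = b then 1 else 0) ` {..<rnk F 0})"
    using finite_support_span by blast
  then have "dim (tens_boundaries F 0 ?d) < dim (tens_cycles F 0 ?d)"
    by (rule dim_psubset_finite[OF sub sub2 v1 v2 _ finite_imageI[OF finite_lessThan]])
  then show thesis using that[of ?d] by (simp add: tens_homology_dim_def)
qed

section \<open>Existence of resolutions and regularity\<close>

definition graded_submodule :: "nat \<Rightarrow> (nat \<Rightarrow> ('n, 'k::comm_ring_1) mpoly) set \<Rightarrow> (nat \<Rightarrow> int) \<Rightarrow> bool"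
  where "graded_submodule r Z s \<longleftrightarrow> Z \<subseteq> free_mod r \<and> (\<lambda>_. 0) \<in> Z \<and>
    (\<forall>v\<in>Z. \<forall>w\<in>Z. (\<lambda>b. v b + w b) \<in> Z) \<and> (\<forall>p. \<forall>v\<in>Z. (\<lambda>b. p * v b) \<in> Z) \<and>
    (\<forall>d. \<forall>v\<in>Z. (\<lambda>b. hcomp (d - s b) (v b)) \<in> Z)"

lemma graded_submodule_sum:
  assumes "graded_submodule r Z s" "\<And>i. i \<in> A \<Longrightarrow> v i \<in> Z"
  shows "(\<lambda>b. \<Sum>i\<in>A. p i * v i b) \<in> Z"
  using assms(2)
proof (induction A rule: infinite_finite_induct)
  case (insert x A)
  then have "(\<lambda>b. p x * v x b) \<in> Z" "(\<lambda>b. \<Sum>i\<in>A. p i * v i b) \<in> Z"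
    using assms(1) unfolding graded_submodule_def by auto
  then show ?case using insert.hyps assms(1) unfolding graded_submodule_def by auto
qed (use assms(1) in \<open>auto simp: graded_submodule_def\<close>)

lemma graded_submodule_ker:
  assumes M: "graded_mat r s' r0 s (M :: nat \<Rightarrow> nat \<Rightarrow> ('n::finite, 'k::comm_ring_1) mpoly)"
  shows "graded_submodule r (mat_ker r M) s'"
  unfolding graded_submodule_def
proof (intro conjI ballI allI)
  fix v w and d assume v: "v \<in> mat_ker r M" and w: "w \<in> mat_ker r M"
  show "(\<lambda>b. v b + w b) \<in> mat_ker r M"
    using v w by (auto simp: mat_ker_def free_mod_def mat_map_def fun_eq_iff distrib_right sum.distrib)
next
  fix v d assume v: "v \<in> mat_ker r M"
  show "(\<lambda>b. hcomp (d - s' b) (v b)) \<in> mat_ker r M"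
    using v mat_map_hcomp[OF M, of d v] by (simp add: mat_ker_def free_mod_def)
next
  fix v p assume v: "v \<in> mat_ker r M"
  then show "(\<lambda>b. p * v b) \<in> mat_ker r M"
    by (auto simp: mat_ker_def free_mod_def mat_map_def fun_eq_iff mult.assoc simp flip: sum_distrib_left)
qed (auto simp: mat_ker_def free_mod_def mat_map_def)

lemma graded_submodule_rank_one:
  assumes "upclosed N"
  shows "graded_submodule 1 (rank_one (monI N :: ('n, 'k::comm_ring_1) mpoly set)) (\<lambda>_. 0)"
  unfolding graded_submodule_def
  by (auto simp: rank_one_def free_mod_def hcomp_def intro: monI_add monI_mult[OF assms] monI_pfilter)

definition vscale :: "'k \<Rightarrow> (nat \<Rightarrow> ('n, 'k::comm_ring_1) mpoly) \<Rightarrow> nat \<Rightarrow> ('n, 'k) mpoly"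
  where "vscale c v = (\<lambda>b. Poly_Mapping.single 0 c * v b)"

lemma vector_space_vscale: "vector_space (vscale :: 'k::field \<Rightarrow> _)"
  by unfold_locales (auto simp: vscale_def fun_eq_iff distrib_left distrib_right single_add mult_single simp flip: mult.assoc)

lemma finite_mono_degree_le: "finite {m :: 'n::finite \<Rightarrow>\<^sub>0 nat. mono_degree m \<le> D}"
proof -
  have "Poly_Mapping.lookup ` {m :: 'n \<Rightarrow>\<^sub>0 nat. mono_degree m \<le> D} \<subseteq> {f. \<forall>i. f i \<in> {..D}}"
  proof (clarsimp)
    fix m :: "'n \<Rightarrow>\<^sub>0 nat" and i assume "mono_degree m \<le> D"
    moreover have "Poly_Mapping.lookup m i \<le> (\<Sum>i\<in>UNIV. Poly_Mapping.lookup m i)"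
      by (rule member_le_sum) auto
    ultimately show "Poly_Mapping.lookup m i \<le> D" by (simp add: mono_degree_eq)
  qed
  moreover have "finite {f :: 'n \<Rightarrow> nat. \<forall>i. f i \<in> {..D}}"
    using finite_set_of_finite_funs[of "UNIV :: 'n set" "{..D}" 0] by simp
  ultimately have "finite (Poly_Mapping.lookup ` {m :: 'n \<Rightarrow>\<^sub>0 nat. mono_degree m \<le> D})"
    by (rule finite_subset)
  then show ?thesis
    by (rule finite_imageD) (auto intro!: inj_onI poly_mapping_eqI)
qed

lemma sum_single_keys: "(\<Sum>m\<in>Poly_Mapping.keys p. Poly_Mapping.single m (Poly_Mapping.lookup p m)) = p"
  for p :: "'a \<Rightarrow>\<^sub>0 'b::comm_monoid_add"
  by (intro poly_mapping_eqI) (auto simp: lookup_sum lookup_single when_def in_keys_iff)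

lemma graded_piece_finite_span:
  fixes s :: "nat \<Rightarrow> int"
  obtains B :: "(nat \<Rightarrow> ('n::finite, 'k::field) mpoly) set"
  where "finite B" "{v \<in> free_mod r. deg_vec s d v} \<subseteq> module.span vscale B"
proof -
  interpret vector_space "vscale :: 'k \<Rightarrow> (nat \<Rightarrow> ('n, 'k) mpoly) \<Rightarrow> _" by (rule vector_space_vscale)
  define e :: "nat \<times> ('n \<Rightarrow>\<^sub>0 nat) \<Rightarrow> nat \<Rightarrow> ('n, 'k) mpoly"
    where "e = (\<lambda>(b, m) c. if c = b then Poly_Mapping.single m 1 else 0)"
  \<comment> \<open>A crude bound: it dominates the degree \<open>d - s b\<close> of each coordinate
    at once.\<close>
  define D where "D = (\<Sum>b<r. nat (d - s b))"
  define B where "B = e ` ({..<r} \<times> {m. mono_degree m \<le> D})"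
  show thesis
  proof (rule that)
    show "finite B" unfolding B_def by (intro finite_imageI finite_cartesian_product finite_mono_degree_le) simp
    show "{v \<in> free_mod r. deg_vec s d v} \<subseteq> span B"
    proof safe
      fix v :: "nat \<Rightarrow> ('n, 'k) mpoly" assume v: "v \<in> free_mod r" "deg_vec s d v"
      have "v = (\<Sum>b<r. \<Sum>m\<in>Poly_Mapping.keys (v b). vscale (Poly_Mapping.lookup (v b) m) (e (b, m)))"
      proof
        fix c
        have "(\<Sum>b<r. \<Sum>m\<in>Poly_Mapping.keys (v b). vscale (Poly_Mapping.lookup (v b) m) (e (b, m))) c
          = (\<Sum>b<r. if c = b then v c else 0)"
          unfolding sum_apply
        proof (rule sum.cong)
          fix b
          show "(\<Sum>m\<in>Poly_Mapping.keys (v b). vscale (Poly_Mapping.lookup (v b) m) (e (b, m)) c) = (if c = b then v c else 0)"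
            by (simp add: vscale_def e_def mult_single sum_single_keys)
        qed simp
        also have "\<dots> = v c" using v(1) by (auto simp: free_mod_def)
        finally show "v c = (\<Sum>b<r. \<Sum>m\<in>Poly_Mapping.keys (v b). vscale (Poly_Mapping.lookup (v b) m) (e (b, m))) c" ..
      qed
      moreover have "e (b, m) \<in> B" if "b < r" "m \<in> Poly_Mapping.keys (v b)" for b m
      proof -
        have "int (mono_degree m) = d - s b"
          using v(2) that(2) by (simp add: deg_vec_def homogeneous_def)
        then have "mono_degree m = nat (d - s b)" by simp
        also have "\<dots> \<le> D" unfolding D_def using that(1) by (intro member_le_sum) auto
        finally show ?thesis using that(1) by (auto simp: B_def)
      qed
      then have "(\<Sum>b<r. \<Sum>m\<in>Poly_Mapping.keys (v b). vscale (Poly_Mapping.lookup (v b) m) (e (b, m))) \<in> span B"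
        by (intro span_sum span_scale span_base) auto
      ultimately show "v \<in> span B" by metis
    qed
  qed
qed

lemma graded_piece_basis:
  fixes Z :: "(nat \<Rightarrow> ('n::finite, 'k::field) mpoly) set"
  assumes "Z \<subseteq> free_mod r"
  obtains C where "finite C" "C \<subseteq> {z \<in> Z. deg_vec s d z}" "{z \<in> Z. deg_vec s d z} \<subseteq> module.span vscale C"
proof -
  interpret vector_space "vscale :: 'k \<Rightarrow> (nat \<Rightarrow> ('n, 'k) mpoly) \<Rightarrow> _" by (rule vector_space_vscale)
  obtain B :: "(nat \<Rightarrow> ('n, 'k) mpoly) set" where B: "finite B" "{v \<in> free_mod r. deg_vec s d v} \<subseteq> span B"
    by (rule graded_piece_finite_span)
  obtain C where C: "C \<subseteq> {z \<in> Z. deg_vec s d z}" "independent C" "{z \<in> Z. deg_vec s d z} \<subseteq> span C"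
    using maximal_independent_subset by blast
  have "C \<subseteq> span B" using C(1) B(2) assms by blast
  then have "finite C" using independent_span_bound[OF B(1) C(2)] by blast
  then show thesis using that C by blast
qed

text \<open>Nonnegative shifts keep all occurring degrees among the naturals, so the components can
  be indexed by \<open>nat\<close> and treated by induction on the degree; this is why nonnegativity
  is carried along.\<close>

lemma sum_hcomp:
  fixes v :: "nat \<Rightarrow> ('n::finite, 'k::comm_ring_1) mpoly"
  assumes "v \<in> free_mod r" "\<And>b. 0 \<le> s b"
  obtains E where "v = (\<lambda>b. \<Sum>d\<le>E. hcomp (int d - s b) (v b))"
proof -
  define E where "E = (\<Sum>b<r. \<Sum>m\<in>Poly_Mapping.keys (v b). mono_degree m + nat (s b))"
  have "v b = (\<Sum>d\<le>E. hcomp (int d - s b) (v b))" for b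
  proof (intro poly_mapping_eqI)
    fix m
    show "Poly_Mapping.lookup (v b) m = Poly_Mapping.lookup (\<Sum>d\<le>E. hcomp (int d - s b) (v b)) m"
    proof (cases "Poly_Mapping.lookup (v b) m = 0")
      case True
      then show ?thesis by (simp add: lookup_sum hcomp_def lookup_pfilter cong: if_cong)
    next
      case False
      then have b: "b < r" using assms(1) by (auto simp: free_mod_def) (metis lookup_zero not_less)
      let ?d = "mono_degree m + nat (s b)"
      have "?d \<le> (\<Sum>m\<in>Poly_Mapping.keys (v b). mono_degree m + nat (s b))"
        using False by (intro member_le_sum) (auto simp: in_keys_iff)
      also have "\<dots> \<le> E" unfolding E_def using b
        by (intro member_le_sum[of b "{..<r}" "\<lambda>b. \<Sum>m\<in>Poly_Mapping.keys (v b). mono_degree m + nat (s b)"]) auto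
      finally have "?d \<le> E" .
      have "Poly_Mapping.lookup (\<Sum>d\<le>E. hcomp (int d - s b) (v b)) m
        = (\<Sum>d\<le>E. if d = ?d then Poly_Mapping.lookup (v b) m else 0)"
        unfolding lookup_sum
        by (rule sum.cong) (use assms(2)[of b] in \<open>auto simp: hcomp_def lookup_pfilter\<close>)
      also have "\<dots> = Poly_Mapping.lookup (v b) m" using \<open>?d \<le> E\<close> by simp
      finally show ?thesis ..
    qed
  qed
  then show thesis using that by blast
qed

text \<open>In degrees \<open>d > R\<close> exceeding all shifts, acyclicity gives \<open>Z\<^sub>d = (x\<^sub>1,\<dots>,x\<^sub>n) Z\<^sub>d\<^sub>-\<^sub>1\<close>, so that bases of
  the finitely many graded pieces in lower degrees generate \<open>Z\<close>.\<close>

lemma graded_submodule_presentation: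
  fixes Z :: "(nat \<Rightarrow> ('n::finite, 'k::field_char_0) mpoly) set"
  assumes Z: "graded_submodule r Z s" and s: "\<And>b. 0 \<le> s b"
    and acyc: "\<And>d. d > R \<Longrightarrow> koszul_acyclic 0 d Z s"
  obtains r' s' M where "\<And>b. 0 \<le> s' b" "graded_mat r' s' r s M" "Z = mat_map r' M ` free_mod r'"
proof -
  have Zf: "Z \<subseteq> free_mod r" and Z0: "(\<lambda>_. 0) \<in> Z" using Z by (simp_all add: graded_submodule_def)
  \<comment> \<open>Beyond \<open>D\<close> the degree exceeds both \<open>R\<close> and every
    shift: acyclicity applies, and homogeneous vectors have no constant terms.\<close>
  define D where "D = nat R + (\<Sum>b<r. nat (s b))"
  have "\<forall>d. \<exists>C. finite C \<and> C \<subseteq> {z \<in> Z. deg_vec s (int d) z} \<and>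
      {z \<in> Z. deg_vec s (int d) z} \<subseteq> module.span vscale C"
    by (rule allI, rule graded_piece_basis[OF Zf], intro exI conjI)
  from choice[OF this] obtain C where CC: "\<forall>d. finite (C d) \<and> C d \<subseteq> {z \<in> Z. deg_vec s (int d) z} \<and>
      {z \<in> Z. deg_vec s (int d) z} \<subseteq> module.span vscale (C d)" ..
  have C: "finite (C d)" "C d \<subseteq> {z \<in> Z. deg_vec s (int d) z}"
      "{z \<in> Z. deg_vec s (int d) z} \<subseteq> module.span vscale (C d)" for d
    by (fact conjunct1[OF spec[OF CC]] conjunct1[OF conjunct2[OF spec[OF CC]]]
      conjunct2[OF conjunct2[OF spec[OF CC]]])+
  have "finite (SIGMA d:{..D}. C d)" using C(1) by simp
  then obtain xs where xs: "set xs = (SIGMA d:{..D}. C d)" using finite_list by blast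
  define r' where "r' = length xs"
  \<comment> \<open>The value zero beyond the rank makes the shifts nonnegative at every
    index.\<close>
  define s' where "s' = (\<lambda>b. if b < r' then int (fst (xs ! b)) else 0)"
  define M where "M = (\<lambda>b. snd (xs ! b))"
  have Mb: "M b \<in> Z \<and> deg_vec s (s' b) (M b)" if "b < r'" for b
  proof -
    have "xs ! b \<in> (SIGMA d:{..D}. C d)" using that xs nth_mem unfolding r'_def by blast
    then have "snd (xs ! b) \<in> C (fst (xs ! b))" by auto
    then show ?thesis using C(2) that by (auto simp: M_def s'_def)
  qed
  have M: "graded_mat r' s' r s M"
    unfolding graded_mat_def
  proof (intro allI impI conjI)
    fix b c assume "b < r'"
    then have "M b \<in> Z" "deg_vec s (s' b) (M b)" using Mb by blast+
    then show "M b \<in> free_mod r" "homogeneous (M b c) (s' b - s c)"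
      using Zf by (auto simp: deg_vec_def)
  qed
  let ?Im = "mat_map r' M ` free_mod r'"
  have ImZ: "?Im \<subseteq> Z"
  proof
    fix w assume "w \<in> ?Im"
    then obtain v where "w = (\<lambda>c. \<Sum>b<r'. v b * M b c)" by (auto simp: mat_map_def)
    moreover have "(\<lambda>c. \<Sum>b\<in>{..<r'}. v b * M b c) \<in> Z"
      by (rule graded_submodule_sum[OF Z]) (use Mb in blast)
    ultimately show "w \<in> Z" by simp
  qed
  have Im_sum: "(\<lambda>b. \<Sum>i\<in>A. p i * v i b) \<in> ?Im" if "\<And>i. i \<in> A \<Longrightarrow> v i \<in> ?Im" for A :: "'x set" and p v
  proof -
    obtain w where w: "\<And>i. i \<in> A \<Longrightarrow> w i \<in> free_mod r'" "\<And>i. i \<in> A \<Longrightarrow> v i = mat_map r' M (w i)"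
      using \<open>\<And>i. i \<in> A \<Longrightarrow> v i \<in> ?Im\<close> unfolding image_iff by metis
    have "(\<lambda>b. \<Sum>i\<in>A. p i * v i b) = mat_map r' M (\<lambda>b. \<Sum>i\<in>A. p i * w i b)"
      using w(2) by (simp add: mat_map_sum_scaled)
    moreover have "(\<lambda>b. \<Sum>i\<in>A. p i * w i b) \<in> free_mod r'"
      using w(1) by (simp add: free_mod_def)
    ultimately show ?thesis by blast
  qed
  have gen: "z \<in> ?Im" if "z \<in> C d" "d \<le> D" for z d
  proof -
    have "(d, z) \<in> set xs" using that xs by auto
    then obtain b where b: "b < r'" "xs ! b = (d, z)" by (metis in_set_conv_nth r'_def)
    have "mat_map r' M (\<lambda>c. if c = b then 1 else 0) = z"
    proof
      fix c
      have "mat_map r' M (\<lambda>c. if c = b then 1 else 0) c = (\<Sum>a<r'. if a = b then M a c else 0)"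
        unfolding mat_map_def by (rule sum.cong) auto
      then show "mat_map r' M (\<lambda>c. if c = b then 1 else 0) c = z c" using b by (simp add: M_def)
    qed
    moreover have "(\<lambda>c. if c = b then 1 else 0) \<in> (free_mod r' :: (nat \<Rightarrow> ('n, 'k) mpoly) set)"
      using b by (simp add: free_mod_def)
    ultimately show ?thesis by (metis imageI)
  qed
  have hom: "z \<in> ?Im" if "z \<in> Z" "deg_vec s (int d) z" for z d
    using that
  proof (induction d arbitrary: z rule: less_induct)
    case (less d)
    show ?case
    proof (cases "d \<le> D")
      case True
      interpret vector_space "vscale :: 'k \<Rightarrow> (nat \<Rightarrow> ('n, 'k) mpoly) \<Rightarrow> _" by (rule vector_space_vscale)
      have "z \<in> span (C d)" using C(3) less.prems by blast
      then show ?thesis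
      proof (induction rule: span_induct_alt)
        case base
        show ?case using Im_sum[of "{} :: nat set"] by (simp add: zero_fun_def)
      next
        case (step c x y)
        have "x \<in> ?Im" using gen step True by blast
        \<comment> \<open>The two-term combination is written as a sum over the booleans so that
          \<open>Im_sum\<close> covers it.\<close>
        then have "(\<lambda>b. \<Sum>i\<in>{True, False}. (if i then Poly_Mapping.single 0 c else 1) * (if i then x else y) b) \<in> ?Im"
          using step by (intro Im_sum) auto
        then show ?case by (simp add: vscale_def plus_fun_def)
      qed
    next
      case False
      have "Poly_Mapping.lookup (z b) 0 = 0" for b
      proof (cases "b < r")
        case True
        have "nat (s b) \<le> (\<Sum>b<r. nat (s b))" using True by (intro member_le_sum) auto
        then have "int d - s b \<noteq> 0" using False s[of b] unfolding D_def by linarith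
        then show ?thesis using less.prems(2) homogeneous_const_coeff unfolding deg_vec_def by blast
      next
        case F: False
        then show ?thesis using less.prems(1) Zf by (auto simp: free_mod_def)
      qed
      note const = this
      have "int d > R" using False unfolding D_def by linarith
      obtain y :: "'n \<Rightarrow> nat \<Rightarrow> ('n, 'k) mpoly" and a where y: "\<And>i. y i \<in> Z" "\<And>i. deg_vec s (int d - 1) (y i)"
        "z = (\<lambda>b. \<Sum>i\<in>UNIV. (pvar i * a i) * y i b)"
        by (rule koszul_acyclic_0_generates[OF acyc[OF \<open>int d > R\<close>] less.prems(1) Z0 less.prems(2) const]) (rule that)
      have "d > 0" using False by simp
      then have "y i \<in> ?Im" for i using less.IH[of "d - 1" "y i"] y by (simp add: of_nat_diff)
      then show ?thesis unfolding y(3) by (intro Im_sum)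
    qed
  qed
  have "Z \<subseteq> ?Im"
  proof
    fix z assume z: "z \<in> Z"
    then obtain E where E: "z = (\<lambda>b. \<Sum>d\<le>E. hcomp (int d - s b) (z b))"
      using sum_hcomp[of z r s] Zf s by blast
    have "(\<lambda>b. hcomp (int d - s b) (z b)) \<in> ?Im" for d
      using z Z by (intro hom[of _ d]) (auto simp: graded_submodule_def deg_vec_def)
    then have "(\<lambda>b. \<Sum>d\<in>{..E}. 1 * hcomp (int d - s b) (z b)) \<in> ?Im"
      by (intro Im_sum)
    then show "z \<in> ?Im" using E by simp
  qed
  then have "Z = ?Im" using ImZ by blast
  moreover have "0 \<le> s' b" for b by (simp add: s'_def)
  ultimately show thesis using that M by blast
qed

text \<open>Dependent choice builds the matrices one by one; the resolution may be infinite. The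
  bound in the invariant grows by one with each syzygy module, as dimension shifting dictates, but
  stays finite, which is all that \<open>graded_submodule_presentation\<close> asks for.\<close>

lemma graded_free_resolution_exists:
  assumes up: "upclosed N" and reg: "koszul_regular (monI N :: ('n::finite, 'k::field_char_0) mpoly set) R"
  obtains F where "graded_free_resolution F (monI N :: ('n, 'k) mpoly set)"
proof -
  let ?I = "rank_one (monI N :: ('n, 'k) mpoly set)"
  \<comment> \<open>A state consists of rank, shifts and matrix of the current map and of rank and
    shifts of its target. The clause for \<open>n = 0\<close> fixes the augmentation.\<close>
  define P :: "nat \<Rightarrow> nat \<times> (nat \<Rightarrow> int) \<times> (nat \<Rightarrow> nat \<Rightarrow> ('n, 'k) mpoly) \<times> nat \<times> (nat \<Rightarrow> int) \<Rightarrow> bool"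
    where "P = (\<lambda>n (r, s, M, r0, s0). (\<forall>b. 0 \<le> s b) \<and> graded_mat r s r0 s0 M \<and>
      (\<forall>p d. d - int p > R + int n + 1 \<longrightarrow> koszul_acyclic p d (mat_ker r M) s) \<and>
      (n = 0 \<longrightarrow> r0 = 1 \<and> s0 = (\<lambda>_. 0) \<and> mat_map r M ` free_mod r = ?I))"
  define Q :: "nat \<Rightarrow> nat \<times> (nat \<Rightarrow> int) \<times> (nat \<Rightarrow> nat \<Rightarrow> ('n, 'k) mpoly) \<times> nat \<times> (nat \<Rightarrow> int) \<Rightarrow>
      nat \<times> (nat \<Rightarrow> int) \<times> (nat \<Rightarrow> nat \<Rightarrow> ('n, 'k) mpoly) \<times> nat \<times> (nat \<Rightarrow> int) \<Rightarrow> bool"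
    where "Q = (\<lambda>n (r, s, M, r0, s0) (r', s', M', r0', s0'). r0' = r \<and> s0' = s \<and>
      mat_ker r M = mat_map r' M' ` free_mod r')"
  have acyc0: "koszul_acyclic p d ?I (\<lambda>_. 0)" if "d - int p > R" for p d
    using koszul_acyclic_rank_one[OF reg] that by blast
  obtain r0 s0 M0 where M0: "\<And>b. 0 \<le> s0 b" "graded_mat r0 s0 1 (\<lambda>_. 0) M0" "?I = mat_map r0 M0 ` free_mod r0"
  proof (rule graded_submodule_presentation[OF graded_submodule_rank_one[OF up]])
    show "koszul_acyclic 0 d ?I (\<lambda>_. 0)" if "d > R" for d using acyc0[of d 0] that by simp
  qed auto
  have "koszul_acyclic p d (mat_ker r0 M0) s0" if "d - int p > R + 1" for p d
  proof (rule koszul_acyclic_ker[OF M0(2)])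
    show "koszul_acyclic (Suc p) d (mat_map r0 M0 ` free_mod r0) (\<lambda>_. 0)"
      unfolding M0(3)[symmetric] using that by (intro acyc0) simp
  qed
  then have P0: "P 0 (r0, s0, M0, 1, \<lambda>_. 0)" using M0 by (simp add: P_def)
  have "\<exists>f. \<forall>n. P n (f n) \<and> Q n (f n) (f (Suc n))"
  proof (rule dependent_nat_choice)
    show "\<exists>x. P 0 x" using P0 by blast
  next
    fix x n assume "P n x"
    obtain r s M rr ss where x: "x = (r, s, M, rr, ss)" by (cases x)
    have s: "\<And>b. 0 \<le> s b" and M: "graded_mat r s rr ss M"
      and ac: "\<And>p d. d - int p > R + int n + 1 \<Longrightarrow> koszul_acyclic p d (mat_ker r M) s"
      using \<open>P n x\<close> by (auto simp: P_def x)
    obtain r' s' M' where M': "\<And>b. 0 \<le> s' b" "graded_mat r' s' r s M'" "mat_ker r M = mat_map r' M' ` free_mod r'"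
    proof (rule graded_submodule_presentation[OF graded_submodule_ker[OF M] s])
      show "koszul_acyclic 0 d (mat_ker r M) s" if "d > R + int n + 1" for d using ac[where p = 0 and d = d] that by simp
    qed auto
    have "koszul_acyclic p d (mat_ker r' M') s'" if "d - int p > R + int (Suc n) + 1" for p d
    proof (rule koszul_acyclic_ker[OF M'(2)])
      show "koszul_acyclic (Suc p) d (mat_map r' M' ` free_mod r') s"
        unfolding M'(3)[symmetric] using that by (intro ac) simp
    qed
    then have "P (Suc n) (r', s', M', r, s)" using M' by (simp add: P_def)
    moreover have "Q n x (r', s', M', r, s)" using M'(3) by (simp add: Q_def x)
    ultimately show "\<exists>y. P (Suc n) y \<and> Q n x y" by blast
  qed
  then obtain f where f: "\<And>n. P n (f n)" "\<And>n. Q n (f n) (f (Suc n))" by blast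
  define mat where "mat = (\<lambda>n. fst (snd (snd (f n))))"
  define F where "F = \<lparr>rnk = (\<lambda>n. fst (f n)), shift = (\<lambda>n. fst (snd (f n))),
      aug = (\<lambda>b. mat 0 b 0), diff = (\<lambda>n. mat (Suc n))\<rparr>"
  have target: "fst (snd (snd (snd (f n)))) = target_rank F n \<and> snd (snd (snd (snd (f n)))) = target_shift F n" for n
  proof (cases n)
    case 0
    then show ?thesis using f(1)[of 0] by (auto simp: P_def split: prod.splits)
  next
    case (Suc l)
    then show ?thesis using f(2)[of l] by (auto simp: Q_def F_def split: prod.splits)
  qed
  have gm: "graded_mat (rnk F n) (shift F n) (target_rank F n) (target_shift F n) (mat n)" for n
  proof -
    have "graded_mat (fst (f n)) (fst (snd (f n))) (fst (snd (snd (snd (f n))))) (snd (snd (snd (snd (f n))))) (mat n)"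
      using f(1)[of n] by (auto simp: P_def mat_def split: prod.splits)
    then show ?thesis using target[of n] by (simp add: F_def)
  qed
  \<comment> \<open>For \<open>n = 0\<close>, a row of \<open>mat 0\<close> lies in a free module of
    rank one and is thus determined by the single entry kept in \<open>aug\<close>; only rows below
    the rank are controlled.\<close>
  have eq: "res_mat F n b = mat n b" if "b < rnk F n" for n b
  proof (cases n)
    case 0
    then have "mat 0 b \<in> free_mod 1" using gm[of 0] that by (simp add: graded_mat_def)
    then show ?thesis using 0 by (auto simp: F_def free_mod_def fun_eq_iff)
  qed (simp add: F_def)
  have map_eq: "mat_map (rnk F n) (res_mat F n) = mat_map (rnk F n) (mat n)" for n
    by (simp add: mat_map_def eq fun_eq_iff)
  have "mat_map (rnk F 0) (mat 0) ` free_mod (rnk F 0) = ?I"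
    using f(1)[of 0] by (auto simp: P_def mat_def F_def split: prod.splits)
  moreover have "graded_mat (rnk F n) (shift F n) (target_rank F n) (target_shift F n) (res_mat F n)" for n
    using gm[of n] by (simp add: graded_mat_def eq)
  moreover have "mat_ker (rnk F n) (mat n) = mat_map (rnk F (Suc n)) (mat (Suc n)) ` free_mod (rnk F (Suc n))" for n
    using f(2)[of n] by (auto simp: Q_def mat_def F_def split: prod.splits)
  ultimately have "graded_free_resolution F (monI N)"
    unfolding graded_free_resolution_iff mat_ker_def map_eq by blast
  then show thesis by (rule that)
qed

lemma regularity_monI_le:
  assumes up: "upclosed N" and N: "{} \<notin> N" and r: "1 \<le> r"
    and reg: "koszul_regular (monI N :: ('n::finite, 'k::field_char_0) mpoly set) r"
  shows "regularity (monI N :: ('n, 'k) mpoly set) \<le> r"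
proof (cases "monI N = ({0} :: ('n, 'k) mpoly set)")
  case True
  then show ?thesis using r by (simp add: regularity_def)
next
  case False
  let ?I = "monI N :: ('n, 'k) mpoly set"
  let ?J = "{j. \<exists>i. betti ?I i (int i + j) \<noteq> 0}"
  have "N \<noteq> {}" using False by (auto simp: monI_def)
  define F where "F = (SOME F. graded_free_resolution F ?I)"
  obtain F0 where "graded_free_resolution F0 ?I" using graded_free_resolution_exists[OF up reg] .
  then have F: "graded_free_resolution F ?I" unfolding F_def by (rule someI)
  have betti: "betti ?I = tens_homology_dim F" by (simp add: betti_def F_def fun_eq_iff)
  \<comment> \<open>The lower bound makes the set finite; with the nonzero Betti number below, its
    \<open>Max\<close> is an element and inherits the upper bound.\<close>
  have J: "?J \<subseteq> {0..r}"
  proof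
    fix j assume "j \<in> ?J"
    then obtain i where "betti ?I i (int i + j) \<noteq> 0" by blast
    then have "\<not> koszul_acyclic i (int i + j) (rank_one ?I) (\<lambda>_. 0)"
      using tens_homology_dim_eq_0[OF F N] betti by metis
    then have "\<not> (int i + j - int i > r \<or> int i + j - int i < 0)"
      using koszul_acyclic_rank_one[OF reg] by blast
    then show "j \<in> {0..r}" by auto
  qed
  obtain d where "tens_homology_dim F 0 d \<noteq> 0" using tens_homology_dim_0_nonzero[OF F \<open>N \<noteq> {}\<close>] .
  then have "d \<in> ?J" by (auto simp: betti intro!: exI[of _ 0])
  then have "Max ?J \<in> ?J" using J finite_subset[OF J] by (intro Max_in) auto
  then show ?thesis using False J by (auto simp: regularity_def)
qed

section \<open>Hilbert functions and multiplicity\<close>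

lemma dim_homogeneous_part_monI:
  "vector_space.dim poly_scale (homogeneous_part (monI N :: ('n::finite, 'k::field) mpoly set) t)
    = card {m. mono_degree m = t \<and> Poly_Mapping.keys m \<in> N}"
proof -
  interpret vector_space "poly_scale :: 'k \<Rightarrow> ('n, 'k) mpoly \<Rightarrow> _" by (rule vector_space_poly_scale)
  let ?S = "{m :: 'n \<Rightarrow>\<^sub>0 nat. mono_degree m = t \<and> Poly_Mapping.keys m \<in> N}"
  let ?b = "\<lambda>m. Poly_Mapping.single m 1 :: ('n, 'k) mpoly"
  have fin: "finite ?S" by (rule finite_subset[OF _ finite_mono_degree_le[of t]]) auto
  have scale: "poly_scale c (?b m) = Poly_Mapping.single m c" for c m
    by (simp add: poly_scale_def mult_single)
  have inj: "inj_on ?b A" for A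
    by (rule inj_onI) (metis keys_single one_neq_zero the_elem_eq)
  show ?thesis
  proof (rule dim_unique[of "?b ` ?S"])
    show "?b ` ?S \<subseteq> homogeneous_part (monI N) t"
      by (auto simp: homogeneous_part_def homogeneous_def monI_def)
    show "homogeneous_part (monI N) t \<subseteq> span (?b ` ?S)"
    proof
      fix p :: "('n, 'k) mpoly" assume p: "p \<in> homogeneous_part (monI N) t"
      have "(\<Sum>m\<in>Poly_Mapping.keys p. poly_scale (Poly_Mapping.lookup p m) (?b m)) \<in> span (?b ` ?S)"
        using p by (intro span_sum span_scale span_base)
          (auto simp: homogeneous_part_def homogeneous_def monI_def)
      then show "p \<in> span (?b ` ?S)" by (simp add: scale sum_single_keys)
    qed
    show "independent (?b ` ?S)"
    proof (rule independent_if_scalars_zero)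
      fix u x assume 0: "(\<Sum>x\<in>?b ` ?S. poly_scale (u x) x) = 0" and x: "x \<in> ?b ` ?S"
      then obtain m where m: "m \<in> ?S" "x = ?b m" by blast
      have "0 = Poly_Mapping.lookup (\<Sum>x\<in>?b ` ?S. poly_scale (u x) x) m" by (simp add: 0)
      also have "\<dots> = (\<Sum>m'\<in>?S. if m' = m then u x else 0)"
        unfolding sum.reindex[OF inj] lookup_sum o_def scale
        by (rule sum.cong) (auto simp: lookup_single m(2))
      also have "\<dots> = u x" using m(1) fin by simp
      finally show "u x = 0" ..
    qed (use fin in simp)
    show "card (?b ` ?S) = card ?S" by (rule card_image[OF inj])
  qed
qed

text \<open>Splitting off the power of \<open>x\<close>: if the rest has degree \<open>u\<close>,
  the exponent of \<open>x\<close> is \<open>t - u\<close>, which must be positive, hence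
  \<open>u < t\<close>.\<close>

lemma card_monomials_insert:
  fixes F :: "'n::finite set"
  assumes "x \<notin> F"
  shows "card {m. Poly_Mapping.keys m = insert x F \<and> mono_degree m = t}
    = (\<Sum>u<t. card {m. Poly_Mapping.keys m = F \<and> mono_degree m = u})"
proof -
  let ?A = "\<lambda>F t. {m :: 'n \<Rightarrow>\<^sub>0 nat. Poly_Mapping.keys m = F \<and> mono_degree m = t}"
  have fin: "finite (?A F t)" for F t
    by (rule finite_subset[OF _ finite_mono_degree_le[of t]]) auto
  have "bij_betw (\<lambda>m. (t - Poly_Mapping.lookup m x, m - Poly_Mapping.single x (Poly_Mapping.lookup m x)))
      (?A (insert x F) t) (SIGMA u:{..<t}. ?A F u)"
  proof (rule bij_betw_byWitness[where f' = "\<lambda>(u, m). m + Poly_Mapping.single x (t - u)"])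
    have split: "m - Poly_Mapping.single x (Poly_Mapping.lookup m x) + Poly_Mapping.single x (Poly_Mapping.lookup m x) = m"
      for m :: "'n \<Rightarrow>\<^sub>0 nat"
      by (intro poly_mapping_eqI) (auto simp: lookup_add lookup_minus lookup_single when_def)
    have deg: "mono_degree m = mono_degree (m - Poly_Mapping.single x (Poly_Mapping.lookup m x)) + Poly_Mapping.lookup m x"
      for m :: "'n \<Rightarrow>\<^sub>0 nat"
      using mono_degree_add[of "m - Poly_Mapping.single x (Poly_Mapping.lookup m x)" "Poly_Mapping.single x (Poly_Mapping.lookup m x)"]
      by (simp add: split)
    show "\<forall>m\<in>?A (insert x F) t. (\<lambda>(u, m). m + Poly_Mapping.single x (t - u))
        (t - Poly_Mapping.lookup m x, m - Poly_Mapping.single x (Poly_Mapping.lookup m x)) = m"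
    proof
      fix m assume "m \<in> ?A (insert x F) t"
      then have "Poly_Mapping.lookup m x \<le> t" using deg[of m] by simp
      then show "(\<lambda>(u, m). m + Poly_Mapping.single x (t - u))
        (t - Poly_Mapping.lookup m x, m - Poly_Mapping.single x (Poly_Mapping.lookup m x)) = m"
        using split[of m] by simp
    qed
    have x0: "Poly_Mapping.lookup m x = 0" if "Poly_Mapping.keys m = F" for m :: "'n \<Rightarrow>\<^sub>0 nat"
      using assms that by (simp flip: not_in_keys_iff_lookup_eq_zero)
    show "\<forall>um\<in>(SIGMA u:{..<t}. ?A F u). (\<lambda>m. (t - Poly_Mapping.lookup m x, m - Poly_Mapping.single x (Poly_Mapping.lookup m x)))
        ((\<lambda>(u, m). m + Poly_Mapping.single x (t - u)) um) = um"
      by (auto simp: lookup_add x0)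
    show "(\<lambda>m. (t - Poly_Mapping.lookup m x, m - Poly_Mapping.single x (Poly_Mapping.lookup m x))) ` ?A (insert x F) t
        \<subseteq> (SIGMA u:{..<t}. ?A F u)"
    proof (rule image_subsetI)
      fix m assume "m \<in> ?A (insert x F) t"
      then have m: "Poly_Mapping.keys m = insert x F" and t: "t = mono_degree m" by auto
      let ?m = "m - Poly_Mapping.single x (Poly_Mapping.lookup m x)"
      have "Poly_Mapping.lookup m x > 0" using m by (auto simp: in_keys_iff)
      moreover have "Poly_Mapping.keys ?m = F"
        using m assms by (auto simp: set_eq_iff in_keys_iff lookup_minus lookup_single when_def)
      ultimately show "(t - Poly_Mapping.lookup m x, ?m) \<in> (SIGMA u:{..<t}. ?A F u)"
        using deg[of m] by (auto simp: t)
    qed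
    show "(\<lambda>(u, m). m + Poly_Mapping.single x (t - u)) ` (SIGMA u:{..<t}. ?A F u) \<subseteq> ?A (insert x F) t"
      by (auto simp: keys_add_nat mono_degree_add)
  qed
  then have "card (?A (insert x F) t) = card (SIGMA u:{..<t}. ?A F u)" by (rule bij_betw_same_card)
  also have "\<dots> = (\<Sum>u<t. card (?A F u))" using fin by simp
  finally show ?thesis .
qed

text \<open>These are the compositions of \<open>t + 1\<close> into \<open>card F\<close> positive
  parts; the induction step is the summation of binomials over the upper index. Stating it for
  \<open>Suc t\<close> avoids the truncated difference \<open>t - 1\<close>, which is wrong in
  degree zero.\<close>

lemma card_monomials:
  fixes F :: "'n::finite set"
  assumes "F \<noteq> {}"
  shows "card {m. Poly_Mapping.keys m = F \<and> mono_degree m = Suc t} = t choose (card F - 1)"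
  using finite[of F] assms
proof (induction F arbitrary: t rule: finite_ne_induct)
  case (singleton x)
  have "(\<Sum>u<Suc t. card {m :: 'n \<Rightarrow>\<^sub>0 nat. Poly_Mapping.keys m = {} \<and> mono_degree m = u})
    = (\<Sum>u<Suc t. if u = 0 then 1 else 0)"
    by (rule sum.cong) (auto simp: card_1_singleton_iff)
  then show ?case using card_monomials_insert[of x "{}" "Suc t"] by simp
next
  case (insert x F)
  have "card {m. Poly_Mapping.keys m = F \<and> mono_degree m = 0} = 0"
    using insert.hyps by (auto simp: card_eq_0_iff mono_degree_eq_0_iff)
  then have "card {m. Poly_Mapping.keys m = insert x F \<and> mono_degree m = Suc t} = (\<Sum>u<t. u choose (card F - 1))"
    using card_monomials_insert[OF insert.hyps(3), of "Suc t"] insert.IH by (simp add: sum.lessThan_Suc_shift del: sum.lessThan_Suc)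
  also have "\<dots> = t choose (Suc (card F - 1))"
    by (cases t) (simp_all add: sum_choose_upper lessThan_Suc_atMost)
  also have "Suc (card F - 1) = card (insert x F) - 1"
    using insert.hyps by (simp add: card_gt_0_iff)
  finally show ?case .
qed

text \<open>The monomials outside the ideal are sorted by support, which is a face. In positive
  degree the empty face contributes none.\<close>

lemma hilbert_fun_monI:
  assumes "{} \<notin> N"
  shows "hilbert_fun (monI N :: ('n::finite, 'k::field) mpoly set) (Suc t)
    = (\<Sum>F\<in>- N - {{}}. t choose (card F - 1))"
proof -
  let ?A = "\<lambda>F. {m :: 'n \<Rightarrow>\<^sub>0 nat. Poly_Mapping.keys m = F \<and> mono_degree m = Suc t}"
  let ?S = "\<lambda>N. {m :: 'n \<Rightarrow>\<^sub>0 nat. mono_degree m = Suc t \<and> Poly_Mapping.keys m \<in> N}"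
  have fin: "finite (?S N)" for N
    by (rule finite_subset[OF _ finite_mono_degree_le[of "Suc t"]]) auto
  have "hilbert_fun (monI N :: ('n, 'k) mpoly set) (Suc t) = card (?S UNIV) - card (?S N)"
  proof -
    have "monI UNIV = (UNIV :: ('n, 'k) mpoly set)" by (simp add: monI_def)
    then show ?thesis
      using dim_homogeneous_part_monI[of "UNIV :: 'n set set" "Suc t", where 'k = 'k]
      unfolding hilbert_fun_def by (simp only: dim_homogeneous_part_monI)
  qed
  also have "\<dots> = card (?S UNIV - ?S N)" using fin by (subst card_Diff_subset) auto
  also have "?S UNIV - ?S N = (\<Union>F\<in>- N - {{}}. ?A F)"
    by (auto simp: mono_degree_def)
  also have "card \<dots> = (\<Sum>F\<in>- N - {{}}. card (?A F))"
    using fin[of UNIV] by (intro card_UN_disjoint) (auto intro: finite_subset[OF _ fin[of UNIV]])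
  also have "\<dots> = (\<Sum>F\<in>- N - {{}}. t choose (card F - 1))"
    by (rule sum.cong) (auto simp: card_monomials)
  finally show ?thesis .
qed

text \<open>The polynomial with value \<open>(t - 1) choose k\<close> at \<open>t\<close>.\<close>

primrec binom_poly :: "nat \<Rightarrow> real poly" where
  "binom_poly 0 = 1"
| "binom_poly (Suc k) = smult (1 / real (Suc k)) (binom_poly k * [:- real (Suc k), 1:])"

lemma poly_binom_poly: "poly (binom_poly k) (real (Suc t)) = real (t choose k)"
proof (induction k)
  case (Suc k)
  have "real (Suc k) * real (t choose Suc k) = (real t - real k) * real (t choose k)"
  proof (cases "k \<le> t")
    case True
    have "Suc k * (t choose Suc k) = (t - k) * (t choose k)"
      by (simp only: binomial_absorption binomial_absorb_comp)
    then have "real (Suc k * (t choose Suc k)) = real ((t - k) * (t choose k))" by simp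
    then show ?thesis using True by (simp only: of_nat_mult of_nat_diff)
  qed (simp add: binomial_eq_0)
  then show ?case using Suc by (simp add: field_simps)
qed simp

lemma degree_binom_poly_le: "degree (binom_poly k) \<le> k"
proof (induction k)
  case (Suc k)
  have "degree (binom_poly k * [:- real (Suc k), 1:]) \<le> k + 1"
    using degree_mult_le[of "binom_poly k" "[:- real (Suc k), 1:]"] Suc by simp
  then show ?case using degree_smult_le[of "1 / real (Suc k)" "binom_poly k * [:- real (Suc k), 1:]"]
    by (simp del: degree_smult_eq)
qed simp

lemma coeff_binom_poly: "coeff (binom_poly k) k = 1 / fact k"
proof (induction k)
  case (Suc k)
  have "coeff (binom_poly k) (Suc k) = 0"
    using degree_binom_poly_le[of k] by (intro coeff_eq_0) simp
  then have "coeff (binom_poly (Suc k)) (Suc k) = 1 / real (Suc k) * coeff (binom_poly k) k"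
    by (simp add: mult.commute[of "binom_poly k"])
  then show ?case using Suc by (simp add: fact_Suc)
qed simp

lemma poly_eq_of_eventually_eq:
  fixes p q :: "real poly"
  assumes "eventually (\<lambda>t. poly p (real t) = poly q (real t)) sequentially"
  shows "p = q"
proof (rule ccontr)
  assume "p \<noteq> q"
  then have fin: "finite {x. poly (p - q) x = 0}" by (intro poly_roots_finite) simp
  obtain T where T: "\<And>t. t \<ge> T \<Longrightarrow> poly p (real t) = poly q (real t)"
    using assms by (auto simp: eventually_sequentially)
  have "real ` {T..} \<subseteq> {x. poly (p - q) x = 0}" using T by auto
  then have "finite (real ` {T..})" using fin by (rule finite_subset)
  then have "finite {T..}" by (rule finite_imageD) (simp add: inj_on_def)
  then show False by (simp add: infinite_Ici)
qed

text \<open>Only faces of the largest size \<open>d\<close> reach the coefficient at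
  \<open>d - 1\<close> of the Hilbert polynomial, and each contributes
  \<open>1 / fact (d - 1)\<close>. Since such a face exists, this is the leading coefficient and the
  polynomial is nonzero.\<close>

lemma multiplicity_quot_monI:
  fixes N :: "'n::finite set set"
  assumes N: "{} \<notin> N" and F0: "F0 \<notin> N" "card F0 = d" "0 < d" and d: "\<And>F. F \<notin> N \<Longrightarrow> card F \<le> d"
  shows "multiplicity_quot (monI N :: ('n, 'k::field) mpoly set) = real (card {F. F \<notin> N \<and> card F = d})"
proof -
  let ?I = "monI N :: ('n, 'k) mpoly set"
  define P where "P = (\<Sum>F\<in>- N - {{}}. binom_poly (card F - 1))"
  have P: "poly P (real (Suc t)) = real (hilbert_fun ?I (Suc t))" for t
    unfolding P_def hilbert_fun_monI[OF N] poly_sum poly_binom_poly by simp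
  have ev: "eventually (\<lambda>t. poly P (real t) = real (hilbert_fun ?I t)) sequentially"
    unfolding eventually_sequentially
  proof (intro exI[of _ 1] allI impI)
    fix t :: nat assume "1 \<le> t"
    then show "poly P (real t) = real (hilbert_fun ?I t)" using P[of "t - 1"] by simp
  qed
  have HP: "hilbert_poly ?I = P"
    unfolding hilbert_poly_def
  proof (rule the_equality)
    fix Q assume "eventually (\<lambda>t. poly Q (real t) = real (hilbert_fun ?I t)) sequentially"
    with ev have "eventually (\<lambda>t. poly Q (real t) = poly P (real t)) sequentially"
      by eventually_elim simp
    then show "Q = P" by (rule poly_eq_of_eventually_eq)
  qed (rule ev)
  have "degree P \<le> d - 1"
    unfolding P_def
  proof (rule degree_sum_le)
    fix F assume "F \<in> - N - {{}}"
    then have "card F - 1 \<le> d - 1" using d[of F] by simp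
    then show "degree (binom_poly (card F - 1)) \<le> d - 1"
      using degree_binom_poly_le order_trans by blast
  qed simp
  have "coeff P (d - 1) = (\<Sum>F\<in>- N - {{}}. if card F = d then 1 / fact (d - 1) else 0)"
    unfolding P_def coeff_sum
  proof (rule sum.cong)
    fix F assume F: "F \<in> - N - {{}}"
    show "coeff (binom_poly (card F - 1)) (d - 1) = (if card F = d then 1 / fact (d - 1) else 0)"
    proof (cases "card F = d")
      case True
      then show ?thesis by (simp add: coeff_binom_poly)
    next
      case False
      then have "card F - 1 < d - 1" using d[of F] F by (simp add: card_gt_0_iff diff_less_mono Suc_le_eq)
      then have "degree (binom_poly (card F - 1)) < d - 1"
        using degree_binom_poly_le le_less_trans by blast
      then show ?thesis using False by (simp add: coeff_eq_0)
    qed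
  qed simp
  also have "\<dots> = real (card {F. F \<notin> N \<and> card F = d}) / fact (d - 1)"
  proof -
    have "{F \<in> - N - {{}}. card F = d} = {F. F \<notin> N \<and> card F = d}" using F0(3) by auto
    then show ?thesis by (simp add: sum.If_cases Int_def)
  qed
  finally have c: "coeff P (d - 1) = real (card {F. F \<notin> N \<and> card F = d}) / fact (d - 1)" .
  have "{F. F \<notin> N \<and> card F = d} \<noteq> {}" using F0 by blast
  then have "card {F. F \<notin> N \<and> card F = d} \<noteq> 0" by simp
  then have "coeff P (d - 1) \<noteq> 0" unfolding c by simp
  then have "degree P = d - 1" "P \<noteq> 0"
    using \<open>degree P \<le> d - 1\<close> le_degree[of P "d - 1"] by (simp_all only: le_antisym) auto
  then show ?thesis by (simp add: multiplicity_quot_def HP c[simplified])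
qed

section \<open>From the square-free ideal to its facets\<close>

lemma prod_pvar: "(\<Prod>i\<in>A. pvar i) = (Poly_Mapping.single (indicator_mono A) 1 :: ('n::finite, 'k::comm_ring_1) mpoly)"
  using finite[of A] by (induction A rule: finite_induct)
    (simp_all add: indicator_mono_def pvar_def mult_single)

lemma squarefree_monomial_ideal_monI:
  fixes I :: "('n::finite, 'k::comm_ring_1) mpoly set"
  assumes "squarefree_monomial_ideal I"
  obtains N where "upclosed N" "I = monI N"
proof -
  interpret module "(*) :: ('n, 'k) mpoly \<Rightarrow> _" by (rule module_times)
  obtain G :: "'n set set" where G: "I = span ((\<lambda>A. \<Prod>i\<in>A. pvar i) ` G)"
    using assms by (auto simp: squarefree_monomial_ideal_def)
  \<comment> \<open>A monomial lies in the ideal exactly if its support contains the support of a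
    generator.\<close>
  define N where "N = {A. \<exists>B\<in>G. B \<subseteq> A}"
  have up: "upclosed N" unfolding N_def upclosed_def by blast
  have "span ((\<lambda>A. \<Prod>i\<in>A. pvar i) ` G) \<subseteq> monI N"
  proof (rule span_minimal)
    show "(\<lambda>A. \<Prod>i\<in>A. pvar i) ` G \<subseteq> (monI N :: ('n, 'k) mpoly set)"
    proof (rule image_subsetI)
      fix B assume "B \<in> G"
      then have "B \<in> N" unfolding N_def by blast
      then show "(\<Prod>i\<in>B. pvar i) \<in> (monI N :: ('n, 'k) mpoly set)"
        unfolding prod_pvar by (simp add: monomial_in_monI)
    qed
    show "subspace (monI N :: ('n, 'k) mpoly set)"
      by (intro subspaceI monI_0 monI_add monI_mult[OF up])
  qed
  moreover have "monI N \<subseteq> span ((\<lambda>A. \<Prod>i\<in>A. pvar i) ` G)"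
  proof
    fix p :: "('n, 'k) mpoly" assume p: "p \<in> monI N"
    have "Poly_Mapping.single m c \<in> span ((\<lambda>A. \<Prod>i\<in>A. pvar i) ` G)" if "m \<in> Poly_Mapping.keys p" for m c
    proof -
      obtain B where B: "B \<in> G" "B \<subseteq> Poly_Mapping.keys m" using p \<open>m \<in> _\<close> by (auto simp: monI_def N_def)
      have "m = (m - indicator_mono B) + indicator_mono B"
        using B(2) by (intro poly_mapping_eqI) (auto simp: lookup_add lookup_minus lookup_indicator_mono in_keys_iff Suc_le_eq)
      then have "Poly_Mapping.single m c = Poly_Mapping.single (m - indicator_mono B) c * (\<Prod>i\<in>B. pvar i)"
        by (simp add: prod_pvar mult_single)
      moreover have "Poly_Mapping.single (m - indicator_mono B) c * (\<Prod>i\<in>B. pvar i) \<in> span ((\<lambda>A. \<Prod>i\<in>A. pvar i) ` G)"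
        using B(1) by (intro span_scale span_base) auto
      ultimately show ?thesis by simp
    qed
    then have "(\<Sum>m\<in>Poly_Mapping.keys p. Poly_Mapping.single m (Poly_Mapping.lookup p m)) \<in> span ((\<lambda>A. \<Prod>i\<in>A. pvar i) ` G)"
      by (intro span_sum)
    then show "p \<in> span ((\<lambda>A. \<Prod>i\<in>A. pvar i) ` G)" by (simp add: sum_single_keys)
  qed
  ultimately show thesis using that[OF up] G by blast
qed

lemma stanley_reisner_monI: "stanley_reisner (monI N :: ('n::finite, 'k::comm_ring_1) mpoly set) = - N"
  by (auto simp: stanley_reisner_def prod_pvar monI_def)

lemma facet_above:
  fixes X :: "'a::finite set set"
  assumes "A \<in> X" obtains F where "F \<in> facets X" "A \<subseteq> F"
proof -
  obtain F where F: "F \<in> X" "A \<subseteq> F" "\<forall>G\<in>X. F \<subseteq> G \<longrightarrow> F = G"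
    using finite_has_maximal2[OF finite assms] by auto
  then have "F \<in> facets X" by (auto simp: facets_def)
  then show thesis using F(2) by (rule that)
qed

lemma gamma_attained:
  fixes X :: "'a::finite set set"
  obtains \<sigma>s where "distinct \<sigma>s" "set \<sigma>s = facets X" "gamma X = gamma_order \<sigma>s"
proof -
  have "facet_orders X \<subseteq> {xs. set xs \<subseteq> facets X \<and> length xs = card (facets X)}"
    by (auto simp: facet_orders_def) (metis distinct_card)
  then have fin: "finite (facet_orders X)"
    by (rule finite_subset) (intro finite_lists_length_eq finite)
  have ne: "facet_orders X \<noteq> {}"
    using finite_distinct_list[OF finite[of "facets X"]] by (auto simp: facet_orders_def)
  have "gamma X \<in> gamma_order ` facet_orders X"
    unfolding gamma_def using fin ne by (intro Min_in) auto
  then show thesis using that by (auto simp: facet_orders_def)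
qed

theorem corollary5p2:
  fixes I :: "('n::finite, 'k::field_char_0) mpoly set"
  assumes "squarefree_monomial_ideal I"
    and "I \<noteq> UNIV"
    and "\<And>i. pvar i \<notin> I"
  shows "real_of_int (regularity I) \<le>
    multiplicity_quot I - real_of_int (codim (stanley_reisner I)) + 1
      + real (alpha (stanley_reisner I)) + real_of_int (gamma (stanley_reisner I))"
proof -
  obtain N where up: "upclosed N" and I: "I = monI N"
    by (rule squarefree_monomial_ideal_monI[OF assms(1)])
  define X where "X = - N"
  have SR: "stanley_reisner I = X" by (simp add: I X_def stanley_reisner_monI)
  have "{} \<notin> N"
  proof
    assume "{} \<in> N"
    then have "A \<in> N" for A using up unfolding upclosed_def by blast
    then show False using assms(2) by (auto simp: I monI_def)
  qed
  have sing: "{i} \<in> X" for i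
    using assms(3)[of i] by (simp add: X_def I monI_def pvar_def)
  obtain \<sigma>s where \<sigma>s: "distinct \<sigma>s" "set \<sigma>s = facets X" "gamma X = gamma_order \<sigma>s"
    by (rule gamma_attained)
  have ex: "\<exists>F\<in>set \<sigma>s. A \<subseteq> F" if "A \<in> X" for A
    using facet_above[OF that] \<sigma>s(2) by metis
  have "\<sigma>s \<noteq> []" using ex[OF sing] by force
  \<comment> \<open>No variable lies in \<open>I\<close>, so every vertex is a face. The size of the
    union in \<open>gamma_order_eq\<close> therefore is the number of variables, which cancels
    against \<open>codim\<close>.\<close>
  have U: "\<Union>(set \<sigma>s) = UNIV" using ex[OF sing] by blast
  have facX: "F \<in> X" if "F \<in> set \<sigma>s" for F using that \<sigma>s(2) by (simp add: facets_def)
  have N: "N = (\<Inter>i\<in>{..<length \<sigma>s}. nonfaces (\<sigma>s ! i))"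
  proof -
    have "A \<in> X \<longleftrightarrow> (\<exists>F\<in>set \<sigma>s. A \<subseteq> F)" for A
      using ex[of A] facX up unfolding X_def upclosed_def by blast
    then have "A \<notin> N \<longleftrightarrow> (\<exists>i<length \<sigma>s. A \<subseteq> \<sigma>s ! i)" for A
      unfolding X_def by (metis ComplI Compl_iff in_set_conv_nth)
    then show ?thesis by (auto simp: nonfaces_def)
  qed
  define S where "S = (\<Sum>i\<in>{1..<length \<sigma>s}. int (card (\<sigma>s ! i \<inter> (\<Union>l<i. \<sigma>s ! l))) - int (conn \<sigma>s i))"
  have g: "gamma_order \<sigma>s = S + int (card (UNIV :: 'n set)) - int (card (\<sigma>s ! 0)) - (int (length \<sigma>s) - 1)"
    using gamma_order_eq[OF \<open>\<sigma>s \<noteq> []\<close>] by (simp add: U S_def)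
  have reg: "koszul_regular I (2 + S)"
    using koszul_regular_prefix[of "length \<sigma>s" \<sigma>s, where 'k = 'k] \<open>\<sigma>s \<noteq> []\<close> unfolding I S_def
    by (subst N) simp
  have "0 \<le> S"
    unfolding S_def
  proof (rule sum_nonneg)
    fix i assume "i \<in> {1..<length \<sigma>s}"
    then obtain l where l: "l < i" "conn \<sigma>s i = card (\<sigma>s ! l \<inter> \<sigma>s ! i)" using conn_witness[of i \<sigma>s] by auto
    then have "card (\<sigma>s ! l \<inter> \<sigma>s ! i) \<le> card (\<sigma>s ! i \<inter> (\<Union>l<i. \<sigma>s ! l))"
      by (intro card_mono) auto
    then show "0 \<le> int (card (\<sigma>s ! i \<inter> (\<Union>l<i. \<sigma>s ! l))) - int (conn \<sigma>s i)" using l by simp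
  qed
  then have bound: "regularity I \<le> 2 + S"
    using regularity_monI_le[OF up \<open>{} \<notin> N\<close>, of "2 + S", where 'k = 'k] reg by (simp add: I)
  define d where "d = Max (card ` X)"
  have "X \<noteq> {}" using sing by blast
  then have "d \<in> card ` X" unfolding d_def by (intro Max_in) auto
  then obtain F0 where F0: "F0 \<in> X" "card F0 = d" by blast
  have dmax: "card F \<le> d" if "F \<in> X" for F unfolding d_def using that by (intro Max_ge) auto
  have "0 < d" using dmax[OF sing] by simp
  have cd: "complex_dim X = int d - 1"
    unfolding complex_dim_def face_dim_def
  proof (rule Max_eqI)
    show "int d - 1 \<in> (\<lambda>F. int (card F) - 1) ` X" using F0 by force
    show "y \<le> int d - 1" if y: "y \<in> (\<lambda>F. int (card F) - 1) ` X" for y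
    proof -
      obtain F where "F \<in> X" "y = int (card F) - 1" using y by blast
      then show ?thesis using dmax[of F] by simp
    qed
  qed simp
  have mult: "multiplicity_quot I = real (card {F \<in> X. card F = d})"
    using multiplicity_quot_monI[OF \<open>{} \<notin> N\<close> _ F0(2) \<open>0 < d\<close>, where 'k = 'k] F0(1) dmax
    by (simp add: I X_def)
  have top: "{F \<in> X. card F = d} = {F \<in> facets X. card F = d}"
  proof -
    have "F \<in> facets X" if "F \<in> X" "card F = d" for F
      using that dmax card_seteq[OF finite, of F] by (auto simp: facets_def)
    then show ?thesis by (auto simp: facets_def)
  qed
  have "alpha X = card {F \<in> facets X. card F < d}"
    by (simp add: alpha_def cd face_dim_def)
  moreover have "card (facets X) = card {F \<in> facets X. card F = d} + card {F \<in> facets X. card F < d}"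
  proof -
    have "card F = d \<or> card F < d" if "F \<in> facets X" for F
      using dmax[of F] that by (auto simp: facets_def)
    then have "facets X = {F \<in> facets X. card F = d} \<union> {F \<in> facets X. card F < d}"
      by blast
    moreover have "card ({F \<in> facets X. card F = d} \<union> {F \<in> facets X. card F < d})
        = card {F \<in> facets X. card F = d} + card {F \<in> facets X. card F < d}"
      by (rule card_Un_disjoint) auto
    ultimately show ?thesis by simp
  qed
  moreover have "card (facets X) = length \<sigma>s" using distinct_card[OF \<sigma>s(1)] \<sigma>s(2) by simp
  \<comment> \<open>Degree and \<open>alpha\<close> count the facets of top and of smaller
    dimension, together all of them.\<close>
  ultimately have len: "multiplicity_quot I + real (alpha X) = real (length \<sigma>s)"
    by (simp add: mult top)
  \<comment> \<open>The first facet may be smaller than the dimension of \<open>X\<close> allows;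
    the difference \<open>d - card (\<sigma>s ! 0)\<close> is the slack in the inequality.\<close>
  have "card (\<sigma>s ! 0) \<le> d" using dmax facX \<open>\<sigma>s \<noteq> []\<close> by simp
  then have "2 + S \<le> int (length \<sigma>s) - codim X + 1 + gamma X"
    unfolding \<sigma>s(3) g codim_def cd by simp
  with bound have "real_of_int (regularity I) \<le> real_of_int (int (length \<sigma>s) - codim X + 1 + gamma X)"
    unfolding of_int_le_iff by linarith
  then show ?thesis using len unfolding SR by simp
qed

end
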